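(* Let $n \geq 5$ and let $s, t \in \{1, 2, \ldots, \lfloor \frac{n}{2}\rfloor\}$ with $s \neq t$ be such that $n \notin \{2s, 2t, 2(s+t)\}$, $3s \neq t$, $3t \neq s$, $3s \neq 5t$ and $3t \neq 5s$. Then each connected component of $\mathcal{N}(C_n(s,t))$ is homotopy equivalent to (A) either $S^1$ or $S^3$, if one of $3s-t$, $3t-s$, $3s+t$ or $3t+s$ is equal to $n$; (B) a garland of $2$-dimensional spheres $S^2$, if $3s-t, 3t-s, 3s+t, 3t+s \neq n$ and, $4t = n$ or $4s = n$; (C) a connected sum of tori, if $3s-t, 3t-s, 3s+t, 3t+s, 4s, 4t \neq n$.
   Context: The circulant graph $C_n(s,t)$ is the simple graph with vertex set $\{1,2,\ldots,n\}$ in which two vertices $x,y$ are adjacent if and only if $x-y \pmod n$ lies in $\{s, t, n-s, n-t\}$. The neighborhood complex $\mathcal{N}(G)$ of a graph $G$ is the (abstract) simplicial complex whose vertices are all non-isolated vertices of $G$ and whose simplices are those subsets of $V(G)$ which have a common neighbor in $G$. Topological statements about a simplicial complex refer to its geometric realization. Garland: a topological space $X = \bigcup_{i=1}^{m} X_i$ is said to be a garland of $X_1,\ldots,X_m$ if, for all $1 \le i \ne j \le m$, $|X_i \cap X_j| = 1$ when $i-j \equiv \pm 1 \pmod m$ and $X_i \cap X_j = \emptyset$ when $i-j \not\equiv \pm 1 \pmod m$. A garland of $2$-dimensional spheres is a garland of some $X_1,\ldots,X_m$ with every $X_i$ homeomorphic to $S^2$. A connected sum of tori means a connected sum of one or more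 tori $S^1\times S^1$ (a single torus is allowed). In (B) the condition is: none of $3s-t, 3t-s, 3s+t, 3t+s$ equals $n$, and moreover ($4t=n$ or $4s=n$). *)

theory Defs
  imports "HOL-Analysis.Analysis" "HOL-Number_Theory.Cong"
begin

text \<open>A graph is given by its vertex set and its adjacency relation.\<close>

definition circulant_adj :: "nat \<Rightarrow> nat \<Rightarrow> nat \<Rightarrow> nat \<Rightarrow> nat \<Rightarrow> bool" where
  "circulant_adj n s t x y \<longleftrightarrow>
     x \<in> {1..n} \<and> y \<in> {1..n} \<and>
     (int x - int y) mod int n \<in> {int s, int t, int n - int s, int n - int t}"

lemma circulant_adj_irrefl:
  assumes "s \<in> {1..<n}" "t \<in> {1..<n}"
  shows "\<not> circulant_adj n s t x x"
  using assms by (auto simp: circulant_adj_def)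

lemma circulant_adj_sym:
  assumes "s \<in> {1..<n}" "t \<in> {1..<n}" "circulant_adj n s t x y"
  shows "circulant_adj n s t y x"
proof -
  have "(int y - int x) mod int n = (- (int x - int y)) mod int n"
    by simp
  then show ?thesis
    using assms unfolding circulant_adj_def zmod_zminus1_eq_if by auto
qed

text \<open>
  An abstract simplicial complex is represented by the set of its nonempty simplices; its vertices
  are the points occurring in singletons. For the neighborhood complex these are the
  non-isolated vertices of the graph.
\<close>

definition neighborhood_complex :: "'a set \<Rightarrow> ('a \<Rightarrow> 'a \<Rightarrow> bool) \<Rightarrow> 'a set set" where
  "neighborhood_complex V adj =
     {\<sigma>. \<sigma> \<noteq> {} \<and> \<sigma> \<subseteq> V \<and> (\<exists>v\<in>V. \<forall>x\<in>\<sigma>. adj v x)}"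

text \<open>
  Barycentric coordinates. The realization is regarded as a subspace of the product space
  \<open>'a \<Rightarrow> real\<close>; for a finite complex this is the usual topology.
\<close>

definition geometric_realization :: "'a set set \<Rightarrow> ('a \<Rightarrow> real) set" where
  "geometric_realization K =
     {f. (\<forall>v. 0 \<le> f v) \<and> {v. f v \<noteq> 0} \<in> K \<and> (\<Sum>v | f v \<noteq> 0. f v) = 1}"

definition garland :: "'a topology \<Rightarrow> nat \<Rightarrow> (nat \<Rightarrow> 'a set) \<Rightarrow> bool" where
  "garland X m A \<longleftrightarrow>
     1 \<le> m \<and> topspace X = (\<Union>i\<in>{1..m}. A i) \<and>
     (\<forall>i\<in>{1..m}. \<forall>j\<in>{1..m}. i \<noteq> j \<longrightarrow>
        (if [int i - int j = 1] (mod int m) \<or> [int i - int j = - 1] (mod int m)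
         then card (A i \<inter> A j) = 1
         else A i \<inter> A j = {}))"

text \<open>
  The Hausdorff condition makes each sphere closed, so that the topology of \<open>X\<close> is the one
  obtained by gluing the spheres at the common points; without it, \<open>X\<close> could carry pathological
  topologies inducing the right one on every sphere.
\<close>

definition garland_of_spheres :: "'a topology \<Rightarrow> bool" where
  "garland_of_spheres X \<longleftrightarrow>
     Hausdorff_space X \<and>
     (\<exists>m A. garland X m A \<and>
        (\<forall>i\<in>{1..m}. subtopology X (A i) homeomorphic_space nsphere 2))"

text \<open>
  \<open>Z\<close> is a connected sum of the surfaces \<open>X\<close> and \<open>Y\<close>: the interiors of embedded closed discs
  (the images of \<open>d\<close> and \<open>e\<close>) are removed, and \<open>Z\<close> is the quotient of the disjoint union of the
  remainders that identifies exactly \<open>x\<close> with \<open>h x\<close>, for a homeomorphism \<open>h\<close> between the boundary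
  circles. In dimension 2 every embedded closed disc is tame, so no further condition on the
  discs is needed.
\<close>

definition is_connected_sum :: "'a topology \<Rightarrow> 'a topology \<Rightarrow> 'a topology \<Rightarrow> bool" where
  "is_connected_sum X Y Z \<longleftrightarrow>
     (\<exists>(d :: complex \<Rightarrow> 'a) (e :: complex \<Rightarrow> 'a) h q.
        embedding_map (top_of_set (cball 0 1)) X d \<and>
        embedding_map (top_of_set (cball 0 1)) Y e \<and>
        homeomorphic_map (subtopology X (d ` sphere 0 1)) (subtopology Y (e ` sphere 0 1)) h \<and>
        (let A = topspace X - d ` ball 0 1; B = topspace Y - e ` ball 0 1 in
          quotient_map
            (sum_topology (\<lambda>b. if b then subtopology X A else subtopology Y B) (UNIV :: bool set))
            Z q \<and>
          inj_on (\<lambda>x. q (True, x)) A \<and>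
          inj_on (\<lambda>y. q (False, y)) B \<and>
          (\<forall>x\<in>A. \<forall>y\<in>B. q (True, x) = q (False, y) \<longleftrightarrow> x \<in> d ` sphere 0 1 \<and> y = h x)))"

abbreviation torus :: "((nat \<Rightarrow> real) \<times> (nat \<Rightarrow> real)) topology" where
  "torus \<equiv> prod_topology (nsphere 1) (nsphere 1)"

text \<open>
  Connected sums of one or more tori. Orientations play no role, since the torus has an
  orientation-reversing self-homeomorphism.
\<close>

inductive connected_sum_of_tori :: "'a topology \<Rightarrow> bool" where
  single: "X homeomorphic_space torus \<Longrightarrow> connected_sum_of_tori X"
| sum: "connected_sum_of_tori X \<Longrightarrow> Y homeomorphic_space torus \<Longrightarrow> is_connected_sum X Y Z
        \<Longrightarrow> connected_sum_of_tori Z"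

end

theory Submission
  imports Defs "HOL-Homology.Invariance_of_Domain"
begin

text \<open>
  The facets of the neighborhood complex are the tetrahedra \<open>{v + s, v - s, v + t, v - t}\<close>, with labels
  taken modulo \<open>n\<close>; a component collects the \<open>v\<close> in a coset of the subgroup generated by \<open>s + t\<close>
  and \<open>s - t\<close>. In the generic case (C) the vertices of a component are the points of a planar
  lattice with steps \<open>s + t\<close> and \<open>s - t\<close> modulo a sublattice, every tetrahedron being spanned by the
  corners of a unit square, and the component is equivalent to the quotient torus. In case (A) a
  facet consists of four consecutive elements of a cyclic group of order \<open>m\<close> with step \<open>2s\<close>
  (up to exchanging \<open>s\<close> and \<open>t\<close>). This gives a circle for \<open>m \<ge> 7\<close> and the boundary of a
  4-simplex for \<open>m = 5\<close>; the hypotheses exclude all other values of \<open>m\<close>. In case (B), say \<open>4s = n\<close>, the tetrahedra of \<open>v\<close> and \<open>v + 2s\<close> share the edge \<open>{v + s, v - s}\<close>. Collapsing the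
  free edges \<open>{v + t, v - t}\<close> leaves a cyclic chain of tetrahedron boundaries, consecutive ones sharing
  an edge, and contracting these edges gives the garland.
\<close>

section \<open>Closed simplices and lattice models\<close>

text \<open>The case distinction reflects short relations. The planar picture of (C) is faithful as
  long as \<open>n\<close> divides no \<open>a * (s + t) + b * (s - t)\<close> with
  \<open>(a, b)\<close> nonzero and both coefficients at most 2 in absolute value. Up to sign,
  \<open>(1, 2)\<close>, \<open>(1, -2)\<close>, \<open>(2, 1)\<close> and \<open>(2, -1)\<close>
  give \<open>3s - t\<close>, \<open>3t - s\<close>, \<open>3s + t\<close> and
  \<open>3t + s\<close>: if one of them equals \<open>n\<close>, the plane degenerates to a line,
  which is (A). The pairs \<open>(2, 2)\<close> and \<open>(2, -2)\<close> give \<open>4s\<close>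
  and \<open>4t\<close>, hence (B). The other coincidences are ruled out by the hypotheses. The
  condition \<open>3s \<noteq> 5t\<close> and its mirror image act elsewhere: in (A) they exclude
  the order 6, in (B) they keep the edges to be collapsed free.

  Every space is kept inside a function space and every equivalence is an explicit formula in
  coordinates, so no nerve or quotient construction intervenes. The difficult point is (B), where
  contracting an edge has no evident inverse; a reserve of weight near the contracted edge is used
  to open the point up again.\<close>

definition closed_simplex :: "'v set \<Rightarrow> ('v \<Rightarrow> real) set" where
  "closed_simplex A = {f. (\<forall>v. 0 \<le> f v) \<and> (\<forall>v. v \<notin> A \<longrightarrow> f v = 0) \<and> sum f A = 1}"

lemma closed_simplexD:
  assumes "f \<in> closed_simplex A"
  shows "0 \<le> f v" "v \<notin> A \<Longrightarrow> f v = 0" "sum f A = 1"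
  using assms by (auto simp: closed_simplex_def)

lemma closed_simplex_mono:
  assumes "finite B" "A \<subseteq> B"
  shows "closed_simplex A \<subseteq> closed_simplex B"
proof
  fix f assume f: "f \<in> closed_simplex A"
  have "sum f A = sum f B"
    using assms f by (intro sum.mono_neutral_left) (auto simp: closed_simplex_def)
  then show "f \<in> closed_simplex B"
    using f assms(2) by (auto simp: closed_simplex_def)
qed

text \<open>Common points of two facets lie on their common face. In particular, facets with
  disjoint vertex sets are disjoint, which later separates the components.\<close>

lemma closed_simplex_Int:
  assumes "finite A" "f \<in> closed_simplex A" "f \<in> closed_simplex B"
  shows "f \<in> closed_simplex (A \<inter> B)"
proof -
  have "sum f (A \<inter> B) = sum f A"
    using assms by (intro sum.mono_neutral_left) (auto simp: closed_simplex_def)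
  then show ?thesis
    using assms by (auto simp: closed_simplex_def)
qed

lemma closed_simplex_convex:
  assumes "f \<in> closed_simplex A" "g \<in> closed_simplex A" "0 \<le> t" "t \<le> (1::real)"
  shows "(\<lambda>v. (1 - t) * f v + t * g v) \<in> closed_simplex A"
  using assms by (auto simp: closed_simplex_def sum.distrib simp flip: sum_distrib_left)

lemma vertex_in_closed_simplex:
  assumes "finite A" "a \<in> A"
  shows "(\<lambda>v. if v = a then 1 else 0) \<in> closed_simplex A"
  using assms by (auto simp: closed_simplex_def)

lemma closed_closed_simplex: "closed (closed_simplex A)"
proof -
  have eq: "closed_simplex A =
      (\<Inter>v. {f. 0 \<le> f v}) \<inter> (\<Inter>v\<in>-A. {f. f v = 0}) \<inter> {f. (\<Sum>v\<in>A. f v) = 1}"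
    by (auto simp: closed_simplex_def)
  show ?thesis
    unfolding eq
    by (intro closed_Int closed_INT ballI closed_Collect_le closed_Collect_eq continuous_intros) auto
qed

lemma connected_closed_simplex: "connected (closed_simplex A)"
proof -
  have "path_component (closed_simplex A) f g"
    if "f \<in> closed_simplex A" "g \<in> closed_simplex A" for f g
    unfolding path_component_def path_def
  proof (intro exI conjI)
    show "continuous_on {0..1} (\<lambda>t v. (1 - t) * f v + t * g v)"
      by (intro continuous_on_coordinatewise_then_product continuous_intros)
    show "path_image (\<lambda>t v. (1 - t) * f v + t * g v) \<subseteq> closed_simplex A"
      using that by (auto simp: path_image_def intro: closed_simplex_convex)
  qed (auto simp: pathstart_def pathfinish_def)
  then show ?thesis
    by (meson path_connected_component path_connected_imp_connected)
qed

text \<open>Coordinates that sum to 1 cannot all vanish, so the support of a point of a closed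
  simplex is automatically a nonempty face. \<open>J\<close> may be infinite, which permits facets
  indexed by all integers.\<close>

lemma geometric_realization_eq_Union:
  fixes K :: "'v set set"
  assumes "\<And>j. j \<in> J \<Longrightarrow> finite (N j)"
    and "K = {\<sigma>. \<sigma> \<noteq> {} \<and> (\<exists>j\<in>J. \<sigma> \<subseteq> N j)}"
  shows "geometric_realization K = (\<Union>j\<in>J. closed_simplex (N j))"
proof (rule Set.set_eqI)
  fix f :: "'v \<Rightarrow> real"
  have sum_eq: "(\<Sum>v | f v \<noteq> 0. f v) = sum f (N j)" if "j \<in> J" "{v. f v \<noteq> 0} \<subseteq> N j" for j
    using that assms(1)[of j] by (intro sum.mono_neutral_left) auto
  show "f \<in> geometric_realization K \<longleftrightarrow> f \<in> (\<Union>j\<in>J. closed_simplex (N j))"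
  proof
    assume f: "f \<in> geometric_realization K"
    then obtain j where j: "j \<in> J" "{v. f v \<noteq> 0} \<subseteq> N j"
      using assms(2) by (auto simp: geometric_realization_def)
    then have "f \<in> closed_simplex (N j)"
      using f sum_eq[OF j] by (auto simp: geometric_realization_def closed_simplex_def)
    then show "f \<in> (\<Union>j\<in>J. closed_simplex (N j))"
      using j by blast
  next
    assume "f \<in> (\<Union>j\<in>J. closed_simplex (N j))"
    then obtain j where j: "j \<in> J" and f: "f \<in> closed_simplex (N j)"
      by blast
    then have sub: "{v. f v \<noteq> 0} \<subseteq> N j"
      by (auto simp: closed_simplex_def)
    have one: "(\<Sum>v | f v \<noteq> 0. f v) = 1"
      using sum_eq[OF j sub] f by (simp add: closed_simplex_def)
    then have "{v. f v \<noteq> 0} \<noteq> {}"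
      by (metis sum.empty zero_neq_one)
    then show "f \<in> geometric_realization K"
      using j f sub one assms(2) by (auto simp: geometric_realization_def closed_simplex_def)
  qed
qed

section \<open>Homotopies and the gluing of continuous maps\<close>

lemma homotopic_with_canonI:
  fixes h :: "real \<Rightarrow> 'a::topological_space \<Rightarrow> 'b::topological_space"
  assumes "continuous_on ({0..1} \<times> S) (\<lambda>z. h (fst z) (snd z))"
    and "\<And>x t. x \<in> S \<Longrightarrow> 0 \<le> t \<Longrightarrow> t \<le> 1 \<Longrightarrow> h t x \<in> T"
    and "\<And>x. x \<in> S \<Longrightarrow> h 0 x = f x" "\<And>x. x \<in> S \<Longrightarrow> h 1 x = g x"
  shows "homotopic_with_canon (\<lambda>_. True) S T f g"
proof (subst homotopic_with, simp, intro exI conjI ballI)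
  show "continuous_map (prod_topology (top_of_set {0..1}) (top_of_set S)) (top_of_set T)
      (\<lambda>z. h (fst z) (snd z))"
    using assms(1,2) by (auto simp: continuous_map_in_subtopology subtopology_Times[symmetric]
        simp del: subtopology_Times)
qed (use assms(3,4) in auto)

lemma homotopic_straight_line:
  fixes f g :: "'a::topological_space \<Rightarrow> 'v \<Rightarrow> real"
  assumes f: "continuous_on S f" and g: "continuous_on S g"
    and C: "\<And>x t. x \<in> S \<Longrightarrow> 0 \<le> t \<Longrightarrow> t \<le> 1 \<Longrightarrow> (\<lambda>v. (1 - t) * f x v + t * g x v) \<in> C"
  shows "homotopic_with_canon (\<lambda>_. True) S C f g"
proof (rule homotopic_with_canonI)
  have *: "continuous_on ({0..1} \<times> S) (\<lambda>z. h (snd z) v)" if "continuous_on S h"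
    for h :: "'a \<Rightarrow> 'v \<Rightarrow> real" and v
    by (rule continuous_on_compose2[OF continuous_on_product_then_coordinatewise[OF that]])
      (auto intro!: continuous_intros)
  show "continuous_on ({0..1} \<times> S) (\<lambda>z v. (1 - fst z) * f (snd z) v + fst z * g (snd z) v)"
    by (intro continuous_on_coordinatewise_then_product continuous_intros * f g)
qed (use C in auto)

text \<open>A continuous map from a compact set to a Hausdorff space is closed, hence a quotient map
  onto its image; continuity can therefore be tested after composing with \<open>E\<close>.\<close>

lemma continuous_on_image_compact:
  fixes E :: "'a::t2_space \<Rightarrow> 'b::t2_space"
  assumes K: "compact K" and E: "continuous_on K E" and fE: "continuous_on K (\<lambda>x. f (E x))"
  shows "continuous_on (E ` K) f"
  unfolding continuous_on_closed_invariant
proof (intro allI impI)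
  fix B :: "'c set" assume "closed B"
  then obtain A where A: "closed A" "A \<inter> K = (\<lambda>x. f (E x)) -` B \<inter> K"
    using fE unfolding continuous_on_closed_invariant by blast
  have "compact (A \<inter> K)"
    using A(1) K by (simp add: closed_Int_compact)
  then have "closed (E ` (A \<inter> K))"
    using E by (meson compact_continuous_image compact_imp_closed continuous_on_subset inf_le2)
  moreover have "E ` (A \<inter> K) \<inter> E ` K = f -` B \<inter> E ` K"
    using A(2) by auto
  ultimately show "\<exists>A. closed A \<and> A \<inter> E ` K = f -` B \<inter> E ` K"
    by blast
qed

lemma continuous_on_finite_closed_Union:
  assumes "finite I" "\<And>i. i \<in> I \<Longrightarrow> closed (U i)" "\<And>i. i \<in> I \<Longrightarrow> continuous_on (U i) f"
  shows "continuous_on (\<Union>i\<in>I. U i) f"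
  using assms
  by (induction I rule: finite_induct) (auto intro!: continuous_on_closed_Un)

text \<open>
  Facets of a complex are lifted to windows \<open>V j\<close> of a lattice \<open>D\<close>. The inverse homotopy
  equivalences are the affine maps on facets and the partition of unity made of translates of
  \<open>\<phi>\<close>; as \<open>\<phi>\<close> reproduces affine functions on windows, one composition is the identity, and the
  other preserves facets.
\<close>

locale lattice_model =
  fixes D :: "'m::euclidean_space set" and lab :: "'m \<Rightarrow> 'v"
    and J :: "'j set" and V :: "'j \<Rightarrow> 'm set" and \<phi> :: "'m \<Rightarrow> real"
    and E :: "'m \<Rightarrow> 'b::t2_space" and L :: "'m set"
  assumes finite_J: "finite J"
    and finite_V: "\<And>j. j \<in> J \<Longrightarrow> finite (V j)"
    and V_subset: "\<And>j. j \<in> J \<Longrightarrow> V j \<subseteq> D"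
    and inj_V: "\<And>j. j \<in> J \<Longrightarrow> inj_on lab (V j)"
    and \<phi>_cont: "continuous_on UNIV \<phi>"
    and \<phi>_nonneg: "\<And>x. 0 \<le> \<phi> x"
    and \<phi>_support: "\<And>j y u. j \<in> J \<Longrightarrow> y \<in> convex hull V j \<Longrightarrow> u \<in> D \<Longrightarrow> \<phi> (y - u) \<noteq> 0 \<Longrightarrow> u \<in> V j"
    and \<phi>_unity: "\<And>j y. j \<in> J \<Longrightarrow> y \<in> convex hull V j \<Longrightarrow> (\<Sum>u\<in>V j. \<phi> (y - u)) = 1"
    and \<phi>_affine: "\<And>j y. j \<in> J \<Longrightarrow> y \<in> convex hull V j \<Longrightarrow> (\<Sum>u\<in>V j. \<phi> (y - u) *\<^sub>R u) = y"
    and E_cont: "continuous_on UNIV E"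
    and E_eq: "\<And>x y. E x = E y \<longleftrightarrow> x - y \<in> L"
    and L_D: "\<And>\<tau> u. \<tau> \<in> L \<Longrightarrow> u \<in> D \<Longrightarrow> u + \<tau> \<in> D \<and> lab (u + \<tau>) = lab u"
    and compatible: "\<And>j k. j \<in> J \<Longrightarrow> k \<in> J \<Longrightarrow>
          \<exists>\<tau>\<in>L. \<forall>u\<in>V j. \<forall>u'\<in>V k. lab u = lab u' \<longrightarrow> u' = u + \<tau>"
begin

text \<open>Summing over \<open>D\<close> instead of one window makes \<open>F\<close> independent
  of the window and periodic under \<open>L\<close>. The condition on \<open>\<phi>\<close> cuts the
  index set down to points of \<open>V j\<close> as soon as \<open>y\<close> lies in the hull of
  \<open>V j\<close>.\<close>

definition F :: "'m \<Rightarrow> 'v \<Rightarrow> real" where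
  "F y v = (\<Sum>u | u \<in> D \<and> \<phi> (y - u) \<noteq> 0 \<and> lab u = v. \<phi> (y - u))"

definition bary :: "'j \<Rightarrow> ('v \<Rightarrow> real) \<Rightarrow> 'm" where
  "bary j x = (\<Sum>u\<in>V j. x (lab u) *\<^sub>R u)"

definition windows :: "'m set" where "windows = (\<Union>j\<in>J. convex hull V j)"

definition C :: "('v \<Rightarrow> real) set" where "C = (\<Union>j\<in>J. closed_simplex (lab ` V j))"

definition f :: "'b \<Rightarrow> 'v \<Rightarrow> real" where
  "f z = F (SOME y. y \<in> windows \<and> E y = z)"

definition g :: "('v \<Rightarrow> real) \<Rightarrow> 'b" where
  "g x = E (bary (SOME j. j \<in> J \<and> x \<in> closed_simplex (lab ` V j)) x)"

lemma L_uminus: "\<tau> \<in> L \<Longrightarrow> - \<tau> \<in> L"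
  using E_eq[of \<tau> 0] E_eq[of 0 \<tau>] by auto

lemma F_window:
  assumes "j \<in> J" "y \<in> convex hull V j"
  shows "F y v = (\<Sum>u\<in>V j. if lab u = v then \<phi> (y - u) else 0)"
  unfolding F_def
proof (rule sum.mono_neutral_cong_left)
  show "{u \<in> D. \<phi> (y - u) \<noteq> 0 \<and> lab u = v} \<subseteq> V j"
    using assms \<phi>_support by blast
qed (use assms finite_V V_subset in auto)

lemma F_lab:
  assumes "j \<in> J" "y \<in> convex hull V j" "u \<in> V j"
  shows "F y (lab u) = \<phi> (y - u)"
proof -
  have "F y (lab u) = (\<Sum>u'\<in>V j. if u' = u then \<phi> (y - u') else 0)"
    unfolding F_window[OF assms(1,2)]
    using inj_onD[OF inj_V[OF assms(1)] _ _ assms(3)] by (intro sum.cong) auto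
  then show ?thesis
    using assms finite_V by simp
qed

lemma F_in_simplex:
  assumes "j \<in> J" "y \<in> convex hull V j"
  shows "F y \<in> closed_simplex (lab ` V j)"
  unfolding closed_simplex_def
proof (intro CollectI conjI allI impI)
  show "0 \<le> F y v" for v
    unfolding F_def by (intro sum_nonneg \<phi>_nonneg)
  show "F y v = 0" if "v \<notin> lab ` V j" for v
    unfolding F_window[OF assms] using that by (intro sum.neutral) auto
  have "sum (F y) (lab ` V j) = (\<Sum>u\<in>V j. F y (lab u))"
    using sum.reindex[OF inj_V[OF assms(1)]] by simp
  also have "\<dots> = 1"
    using \<phi>_unity[OF assms] F_lab[OF assms] by simp
  finally show "sum (F y) (lab ` V j) = 1" .
qed

lemma F_periodic:
  assumes "\<tau> \<in> L"
  shows "F (y + \<tau>) = F y"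
proof
  fix v
  have "bij_betw (\<lambda>u. u + \<tau>) {u \<in> D. \<phi> (y - u) \<noteq> 0 \<and> lab u = v}
      {u \<in> D. \<phi> (y + \<tau> - u) \<noteq> 0 \<and> lab u = v}"
  proof (rule bij_betw_byWitness[where f' = "\<lambda>u. u - \<tau>"])
    have "u - \<tau> \<in> D \<and> lab (u - \<tau>) = lab u" if "u \<in> D" for u
      using L_D[OF L_uminus[OF assms] that] by simp
    then show "(\<lambda>u. u - \<tau>) ` {u \<in> D. \<phi> (y + \<tau> - u) \<noteq> 0 \<and> lab u = v}
        \<subseteq> {u \<in> D. \<phi> (y - u) \<noteq> 0 \<and> lab u = v}"
      by (auto simp: algebra_simps)
  qed (use L_D[OF assms] in auto)
  from sum.reindex_bij_betw[OF this, of "\<lambda>u. \<phi> (y + \<tau> - u)"]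
  show "F (y + \<tau>) v = F y v"
    unfolding F_def by simp
qed

lemma F_eq:
  assumes "E y = E y'"
  shows "F y = F y'"
  using F_periodic[of "y - y'" y'] assms by (simp add: E_eq)

lemma f_E:
  assumes "y \<in> windows"
  shows "f (E y) = F y"
  unfolding f_def using someI[of "\<lambda>y'. y' \<in> windows \<and> E y' = E y" y] assms F_eq by blast

text \<open>\<open>x\<close> is supported on labels common to both windows. Their lifts to
  \<open>V j\<close> and \<open>V k\<close> correspond under a single translation
  \<open>\<tau>\<close>, and since the weights sum to 1 the barycentre moves by exactly
  \<open>\<tau>\<close>, which \<open>E\<close> does not see. Hence the choice in \<open>g\<close>
  is harmless.\<close>

lemma bary_eq:
  assumes "j \<in> J" "k \<in> J" "x \<in> closed_simplex (lab ` V j)" "x \<in> closed_simplex (lab ` V k)"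
  shows "E (bary j x) = E (bary k x)"
proof -
  obtain \<tau> where \<tau>: "\<tau> \<in> L" "\<And>u u'. u \<in> V j \<Longrightarrow> u' \<in> V k \<Longrightarrow> lab u = lab u' \<Longrightarrow> u' = u + \<tau>"
    using compatible[OF assms(1,2)] by blast
  define A where "A = {u \<in> V j. lab u \<in> lab ` V k}"
  define B where "B = {u \<in> V k. lab u \<in> lab ` V j}"
  have fin: "finite (V j)" "finite (V k)"
    using assms finite_V by auto
  have zero: "x v = 0" if "v \<notin> lab ` V j \<or> v \<notin> lab ` V k" for v
    using that assms by (auto simp: closed_simplex_def)
  have bij: "bij_betw (\<lambda>u. u + \<tau>) A B"
  proof (rule bij_betwI')
    show "u + \<tau> \<in> B" if u: "u \<in> A" for u
    proof -
      obtain u' where "u' \<in> V k" "lab u = lab u'"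
        using u A_def by auto
      then show ?thesis
        using \<tau>(2)[of u u'] u by (auto simp: A_def B_def image_iff) metis
    qed
    show "\<exists>u\<in>A. u' = u + \<tau>" if u': "u' \<in> B" for u'
    proof -
      obtain u where "u \<in> V j" "lab u' = lab u"
        using u' B_def by auto
      then show ?thesis
        using \<tau>(2)[of u u'] u' by (auto simp: A_def B_def image_iff) metis
    qed
  qed auto
  have labB: "lab (u + \<tau>) = lab u" if "u \<in> A" for u
    using that L_D[OF \<tau>(1)] V_subset assms(1) by (auto simp: A_def)
  have one: "(\<Sum>u\<in>A. x (lab u)) = 1"
  proof -
    have "(\<Sum>u\<in>A. x (lab u)) = (\<Sum>u\<in>V j. x (lab u))"
      using fin zero by (intro sum.mono_neutral_left) (auto simp: A_def)
    also have "\<dots> = sum x (lab ` V j)"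
      using sum.reindex[OF inj_V[OF assms(1)], of x] by simp
    finally show ?thesis
      using assms(3) by (simp add: closed_simplex_def)
  qed
  have "bary k x = (\<Sum>u\<in>B. x (lab u) *\<^sub>R u)"
    unfolding bary_def using fin zero by (intro sum.mono_neutral_right) (auto simp: B_def)
  also have "\<dots> = (\<Sum>u\<in>A. x (lab (u + \<tau>)) *\<^sub>R (u + \<tau>))"
    using sum.reindex_bij_betw[OF bij, of "\<lambda>u. x (lab u) *\<^sub>R u"] by simp
  also have "\<dots> = (\<Sum>u\<in>A. x (lab u) *\<^sub>R u) + (\<Sum>u\<in>A. x (lab u) *\<^sub>R \<tau>)"
    using labB by (simp add: scaleR_add_right sum.distrib)
  also have "(\<Sum>u\<in>A. x (lab u) *\<^sub>R u) = bary j x"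
    unfolding bary_def using fin zero by (intro sum.mono_neutral_left) (auto simp: A_def)
  also have "(\<Sum>u\<in>A. x (lab u) *\<^sub>R \<tau>) = \<tau>"
    using one by (simp flip: scaleR_left.sum)
  finally have "bary k x - bary j x \<in> L"
    using \<tau>(1) by simp
  then show ?thesis
    using E_eq by metis
qed

lemma g_eq:
  assumes "j \<in> J" "x \<in> closed_simplex (lab ` V j)"
  shows "g x = E (bary j x)"
  unfolding g_def
  using someI[of "\<lambda>j. j \<in> J \<and> x \<in> closed_simplex (lab ` V j)" j] assms bary_eq by blast

lemma bary_in_hull:
  assumes "j \<in> J" "x \<in> closed_simplex (lab ` V j)"
  shows "bary j x \<in> convex hull V j"
proof -
  have "(\<Sum>u\<in>V j. x (lab u)) = 1"
    using sum.reindex[OF inj_V[OF assms(1)], of x] assms(2) by (simp add: closed_simplex_def)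
  then show ?thesis
    unfolding bary_def using assms finite_V
    by (intro convex_sum) (auto simp: closed_simplex_def hull_inc)
qed

lemma continuous_on_F:
  assumes "j \<in> J"
  shows "continuous_on (convex hull V j) F"
proof (rule continuous_on_coordinatewise_then_product)
  fix v
  have *: "continuous_on S (\<lambda>y. \<phi> (y - u))" for u S
    by (rule continuous_on_compose2[OF \<phi>_cont]) (auto intro!: continuous_intros)
  have "continuous_on S (\<lambda>y. if lab u = v then \<phi> (y - u) else 0)" for u S
    using * by (cases "lab u = v") auto
  then have "continuous_on (convex hull V j) (\<lambda>y. \<Sum>u\<in>V j. if lab u = v then \<phi> (y - u) else 0)"
    by (intro continuous_on_sum)
  then show "continuous_on (convex hull V j) (\<lambda>y. F y v)"
    using F_window[OF assms] by (simp cong: continuous_on_cong)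
qed

theorem homotopy_equivalent:
  "top_of_set C homotopy_equivalent_space top_of_set (E ` windows)"
proof -
  have contE: "continuous_on S E" for S
    using E_cont continuous_on_subset by blast
  have compact_hull: "compact (convex hull V j)" if "j \<in> J" for j
    using that finite_V by (simp add: compact_convex_hull finite_imp_compact)
  \<comment> \<open>\<open>f\<close> involves a choice of lifts, so its continuity is tested on the
    images of the finitely many compact hulls, where it becomes continuity of
    \<open>F\<close>.\<close>
  have f_cont: "continuous_on (E ` windows) f"
  proof -
    have "continuous_on (\<Union>j\<in>J. E ` (convex hull V j)) f"
    proof (rule continuous_on_finite_closed_Union[OF finite_J])
      fix j assume j: "j \<in> J"
      show "closed (E ` (convex hull V j))"
        using compact_hull[OF j] contE compact_continuous_image compact_imp_closed by blast
      have "continuous_on (convex hull V j) (\<lambda>y. f (E y)) \<longleftrightarrow> continuous_on (convex hull V j) F"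
        using j by (intro continuous_on_cong refl f_E) (auto simp: windows_def)
      then show "continuous_on (E ` (convex hull V j)) f"
        using continuous_on_image_compact[OF compact_hull[OF j] contE] continuous_on_F[OF j]
        by blast
    qed
    then show ?thesis
      by (simp add: windows_def image_UN)
  qed
  have g_cont: "continuous_on C g"
    unfolding C_def
  proof (rule continuous_on_finite_closed_Union[OF finite_J])
    fix j assume j: "j \<in> J"
    have cont: "continuous_on (closed_simplex (lab ` V j)) (\<lambda>x. bary j x)"
      unfolding bary_def
      by (intro continuous_intros continuous_on_subset[OF continuous_on_product_coordinates]) auto
    have "continuous_on (closed_simplex (lab ` V j)) (\<lambda>x. E (bary j x))"
      by (rule continuous_on_compose2[OF E_cont cont]) auto
    then show "continuous_on (closed_simplex (lab ` V j)) g"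
      using g_eq[OF j] by (simp cong: continuous_on_cong)
  qed (rule closed_closed_simplex)
  have f_in: "f z \<in> C" if z: "z \<in> E ` windows" for z
    using z f_E F_in_simplex by (fastforce simp: C_def windows_def)
  have g_in: "g x \<in> E ` windows" if x: "x \<in> C" for x
    using x bary_in_hull g_eq by (fastforce simp: C_def windows_def)
  have gf: "g (f z) = z" if z: "z \<in> E ` windows" for z
  proof -
    obtain j y where j: "j \<in> J" and y: "y \<in> convex hull V j" and zy: "z = E y"
      using z by (auto simp: windows_def)
    then have "y \<in> windows"
      by (auto simp: windows_def)
    then have "g (f z) = g (F y)"
      by (simp add: zy f_E)
    also have "\<dots> = E (bary j (F y))"
      by (rule g_eq[OF j F_in_simplex[OF j y]])
    also have "bary j (F y) = y"
      unfolding bary_def using F_lab[OF j y] \<phi>_affine[OF j y] by simp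
    finally show ?thesis
      using zy by simp
  qed
  have fg: "homotopic_with_canon (\<lambda>_. True) C C (f \<circ> g) id"
  proof (rule homotopic_straight_line)
    show "continuous_on C (f \<circ> g)"
      using g_cont continuous_on_subset[OF f_cont] g_in by (blast intro: continuous_on_compose)
    fix x and t :: real assume x: "x \<in> C" and t: "0 \<le> t" "t \<le> 1"
    then obtain j where j: "j \<in> J" and xj: "x \<in> closed_simplex (lab ` V j)"
      by (auto simp: C_def)
    have hull: "bary j x \<in> convex hull V j"
      by (rule bary_in_hull[OF j xj])
    then have "bary j x \<in> windows"
      using j by (auto simp: windows_def)
    then have "f (g x) = F (bary j x)"
      by (simp add: g_eq[OF j xj] f_E)
    then have "f (g x) \<in> closed_simplex (lab ` V j)"
      using F_in_simplex[OF j hull] by simp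
    from closed_simplex_convex[OF this xj t] j
    show "(\<lambda>v. (1 - t) * (f \<circ> g) x v + t * id x v) \<in> C"
      by (auto simp: C_def)
  qed (auto simp: continuous_on_id)
  show ?thesis
    unfolding homotopy_equivalent_space_def
  proof (intro exI conjI)
    show "continuous_map (top_of_set C) (top_of_set (E ` windows)) g"
      using g_cont g_in by (auto simp: continuous_map_in_subtopology)
    show "continuous_map (top_of_set (E ` windows)) (top_of_set C) f"
      using f_cont f_in by (auto simp: continuous_map_in_subtopology)
    show "homotopic_with (\<lambda>x. True) (top_of_set C) (top_of_set C) (f \<circ> g) id"
      by (rule fg)
    show "homotopic_with (\<lambda>x. True) (top_of_set (E ` windows)) (top_of_set (E ` windows)) (g \<circ> f) id"
      using gf f_cont g_cont f_in g_in
      by (intro homotopic_with_equal)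
        (auto intro!: continuous_on_compose simp: image_subset_iff Pi_iff intro: continuous_on_subset)
  qed
qed

end

section \<open>Spheres and tori\<close>

lemma homeomorphic_imp_homeomorphic_space:
  "S homeomorphic T \<Longrightarrow> top_of_set S homeomorphic_space top_of_set T"
  unfolding homeomorphic_def homeomorphism_def homeomorphic_space_def homeomorphic_maps_def
  by (elim exE conjE) (intro exI conjI, auto)

lemma sphere_homeomorphic_nsphere:
  "top_of_set (sphere (0::'n::euclidean_space) 1) homeomorphic_space nsphere (DIM('n) - 1)"
  using homeomorphic_maps_nsphere_euclidean_sphere[of "Basis :: 'n set" "DIM('n)"]
  by (metis (no_types, lifting) DIM_positive homeomorphic_space_def homeomorphic_space_sym
      independent_Basis inf_top.right_neutral neq0_conv norm_Basis orthogonal_Basis span_Basis)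

lemma continuous_on_if_const:
  "continuous_on S f \<Longrightarrow> continuous_on S g \<Longrightarrow> continuous_on S (\<lambda>x. if P then f x else g x)"
  by (cases P) auto

lemma convex_on_max:
  assumes "convex_on S f" "convex_on S g"
  shows "convex_on S (\<lambda>x. max (f x) (g x))"
proof (rule convex_onI)
  fix t x y assume t: "0 < t" "t < (1::real)" and xy: "x \<in> S" "y \<in> S"
  have "f ((1 - t) *\<^sub>R x + t *\<^sub>R y) \<le> (1 - t) * f x + t * f y"
       "g ((1 - t) *\<^sub>R x + t *\<^sub>R y) \<le> (1 - t) * g x + t * g y"
    using assms t xy by (auto intro: convex_onD)
  moreover have "(1 - t) * f x \<le> (1 - t) * max (f x) (g x)" "t * f y \<le> t * max (f y) (g y)"
      "(1 - t) * g x \<le> (1 - t) * max (f x) (g x)" "t * g y \<le> t * max (f y) (g y)"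
    using t by (auto intro: mult_left_mono)
  ultimately show "max (f ((1 - t) *\<^sub>R x + t *\<^sub>R y)) (g ((1 - t) *\<^sub>R x + t *\<^sub>R y))
      \<le> (1 - t) * max (f x) (g x) + t * max (f y) (g y)"
    by linarith
qed (use assms convex_on_imp_convex in blast)

text \<open>The sublevel set is a compact convex body with interior \<open>h < 0\<close>, so the
  level set is its frontier, and the frontier of such a body is homeomorphic to that of the unit
  ball. Simplex boundaries and pinched tetrahedra are both recognised as spheres in this
  way.\<close>

lemma convex_level_set_homeomorphic_nsphere:
  fixes h :: "'n::euclidean_space \<Rightarrow> real"
  assumes cont: "continuous_on UNIV h" and conv: "convex_on UNIV h"
    and p: "h p < 0" and bdd: "bounded {x. h x \<le> 0}"
  shows "compact {x. h x = 0}"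
    and "top_of_set {x. h x = 0} homeomorphic_space nsphere (DIM('n) - 1)"
proof -
  let ?B = "{x. h x \<le> 0}"
  have closed: "closed ?B" "closed {x. h x = 0}"
    using cont by (auto intro!: closed_Collect_le closed_Collect_eq continuous_intros)
  show "compact {x. h x = 0}"
    using closed bdd by (auto simp: compact_eq_bounded_closed intro: bounded_subset)
  have convB: "convex ?B"
  proof (rule convexI)
    fix x y and u v :: real
    assume xy: "x \<in> ?B" "y \<in> ?B" and uv: "0 \<le> u" "0 \<le> v" "u + v = 1"
    have "h (u *\<^sub>R x + v *\<^sub>R y) \<le> u * h x + v * h y"
      using conv uv by (auto simp: convex_on_def)
    also have "\<dots> \<le> 0"
      using xy uv by (simp add: add_nonpos_nonpos mult_nonneg_nonpos)
    finally show "u *\<^sub>R x + v *\<^sub>R y \<in> ?B" by simp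
  qed
  have int: "interior ?B = {x. h x < 0}"
  proof (rule interior_unique)
    show "open {x. h x < 0}"
      using cont by (intro open_Collect_less continuous_intros) auto
    fix T assume T: "T \<subseteq> ?B" "open T"
    show "T \<subseteq> {x. h x < 0}"
    proof
      fix x assume x: "x \<in> T"
      \<comment> \<open>Inside the open set \<open>T\<close> one can move slightly beyond
        \<open>x\<close>, away from \<open>p\<close>. Then \<open>x\<close> lies strictly between a
        point with \<open>h \<le> 0\<close> and the point \<open>p\<close> with
        \<open>h p < 0\<close>, so convexity makes \<open>h x\<close> negative.\<close>
      have "((\<lambda>e. x + e *\<^sub>R (x - p)) \<longlongrightarrow> x + 0 *\<^sub>R (x - p)) (at_right 0)"
        by (intro tendsto_intros)
      then have "\<forall>\<^sub>F e in at_right 0. x + e *\<^sub>R (x - p) \<in> T"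
        by (rule topological_tendstoD[OF _ T(2)]) (use x in simp)
      then have "\<forall>\<^sub>F e in at_right (0::real). x + e *\<^sub>R (x - p) \<in> T \<and> 0 < e"
        by (intro eventually_conj eventually_at_right_less)
      then obtain e :: real where e: "x + e *\<^sub>R (x - p) \<in> T" "0 < e"
        using eventually_happens trivial_limit_at_right_real by blast
      define y where "y = x + e *\<^sub>R (x - p)"
      have "h y \<le> 0"
        using e T(1) y_def by auto
      define c where "c = 1 / (1 + e)"
      have "c *\<^sub>R y + (c * e) *\<^sub>R p = (c * (1 + e)) *\<^sub>R x"
        unfolding y_def by (simp add: algebra_simps)
      then have "x = (1 / (1 + e)) *\<^sub>R y + (e / (1 + e)) *\<^sub>R p"
        using e by (simp add: c_def)
      moreover have "1 / (1 + e) + e / (1 + e) = 1"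
        using e by (simp add: field_simps)
      ultimately have "h x \<le> (1 / (1 + e)) * h y + (e / (1 + e)) * h p"
        using conv e(2) by (metis UNIV_I add_nonneg_nonneg convex_on_def divide_nonneg_nonneg less_imp_le zero_le_one)
      also have "\<dots> < 0"
        using \<open>h y \<le> 0\<close> p e by (intro add_nonpos_neg mult_pos_neg mult_nonneg_nonpos) auto
      finally show "x \<in> {x. h x < 0}" by simp
    qed
  qed auto
  have ne: "interior ?B \<noteq> {}"
    using int p by auto
  have "rel_frontier ?B = {x. h x = 0}"
    using rel_frontier_nonempty_interior[OF ne] closed int by (auto simp: frontier_def)
  moreover have "rel_frontier (cball (0::'n) 1) = sphere 0 1"
    by (simp add: rel_frontier_nonempty_interior)
  moreover have "aff_dim ?B = aff_dim (cball (0::'n) 1)"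
    using aff_dim_nonempty_interior[OF ne] by (simp add: aff_dim_cball)
  then have "rel_frontier ?B homeomorphic rel_frontier (cball (0::'n) 1)"
    by (intro homeomorphic_rel_frontiers_convex_bounded_sets convB bdd) auto
  ultimately have "{x. h x = 0} homeomorphic sphere (0::'n) 1"
    by simp
  then show "top_of_set {x. h x = 0} homeomorphic_space nsphere (DIM('n) - 1)"
    using homeomorphic_imp_homeomorphic_space homeomorphic_space_trans sphere_homeomorphic_nsphere
    by blast
qed

lemma embedded_convex_level_set:
  fixes h :: "'n::euclidean_space \<Rightarrow> real" and j :: "'n \<Rightarrow> 'v::countable \<Rightarrow> real"
  assumes "continuous_on UNIV h" "convex_on UNIV h" "h p < 0" "bounded {x. h x \<le> 0}"
    and "continuous_on UNIV j" "inj j"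
  shows "top_of_set (j ` {x. h x = 0}) homeomorphic_space nsphere (DIM('n) - 1)"
    and "compact (j ` {x. h x = 0})"
proof -
  note lvl = convex_level_set_homeomorphic_nsphere[OF assms(1-4)]
  have cont: "continuous_on {x. h x = 0} j"
    using assms(5) continuous_on_subset by blast
  then show "compact (j ` {x. h x = 0})"
    by (rule compact_continuous_image) (rule lvl)
  have "{x. h x = 0} homeomorphic j ` {x. h x = 0}"
    using lvl(1) cont assms(6) by (intro homeomorphic_compact[where f = j]) (auto intro: inj_on_subset)
  then have "top_of_set (j ` {x. h x = 0}) homeomorphic_space top_of_set {x. h x = 0}"
    using homeomorphic_imp_homeomorphic_space homeomorphic_space_sym by blast
  then show "top_of_set (j ` {x. h x = 0}) homeomorphic_space nsphere (DIM('n) - 1)"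
    using lvl(2) homeomorphic_space_trans by blast
qed

lemma boundary_4_simplex:
  fixes A :: "'v::countable set"
  assumes "card A = 5"
  shows "top_of_set (\<Union>v\<in>A. closed_simplex (A - {v})) homeomorphic_space nsphere 3"
proof -
  have "finite A"
    using assms card.infinite by fastforce
  obtain v0 A0 where A0: "A = insert v0 A0" "v0 \<notin> A0" "card A0 = 4"
    using assms by (metis card_eq_SucD eval_nat_numeral(3) numeral_eq_Suc pred_numeral_simps(3))
  obtain v1 A1 where A1: "A0 = insert v1 A1" "v1 \<notin> A1" "card A1 = 3"
    using A0(3) by (metis card_eq_SucD numeral_eq_Suc pred_numeral_simps(2) semiring_norm(26) semiring_norm(27))
  obtain v2 v3 v4 where A2: "A1 = {v2, v3, v4}" "v2 \<noteq> v3" "v2 \<noteq> v4" "v3 \<noteq> v4"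
    using A1(3) by (auto simp: card_3_iff)
  have A: "A = {v0, v1, v2, v3, v4}"
    using A0 A1 A2 by auto
  have dist: "v0 \<noteq> v1" "v0 \<noteq> v2" "v0 \<noteq> v3" "v0 \<noteq> v4" "v1 \<noteq> v2" "v1 \<noteq> v3" "v1 \<noteq> v4"
      "v2 \<noteq> v3" "v2 \<noteq> v4" "v3 \<noteq> v4"
    using A0 A1 A2 by auto
  define a b c d :: "real \<times> real \<times> real \<times> real \<Rightarrow> real"
    where "a = fst" and "b = (\<lambda>x. fst (snd x))"
      and "c = (\<lambda>x. fst (snd (snd x)))" and "d = (\<lambda>x. snd (snd (snd x)))"
  note abcd = a_def b_def c_def d_def
  \<comment> \<open>Four barycentric coordinates are free and the fifth is 1 minus their sum. As the
    maximum of the negated coordinates, \<open>h\<close> is nonpositive exactly on the simplex and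
    zero exactly on its boundary; the barycentre serves as the point with
    \<open>h < 0\<close>.\<close>
  define h where "h = (\<lambda>x. max (max (- a x) (- b x)) (max (max (- c x) (- d x)) (a x + b x + c x + d x - 1)))"
  define j where "j = (\<lambda>x u. if u = v0 then a x else if u = v1 then b x else if u = v2 then c x
      else if u = v3 then d x else if u = v4 then 1 - a x - b x - c x - d x else 0)"
  have h_le: "h x \<le> 0 \<longleftrightarrow> 0 \<le> a x \<and> 0 \<le> b x \<and> 0 \<le> c x \<and> 0 \<le> d x \<and> 0 \<le> 1 - a x - b x - c x - d x"
    and h_less: "h x < 0 \<longleftrightarrow> 0 < a x \<and> 0 < b x \<and> 0 < c x \<and> 0 < d x \<and> 0 < 1 - a x - b x - c x - d x" for x
    by (auto simp: h_def)
  have affine: "convex_on UNIV f" if "\<And>t x y. f ((1 - t) *\<^sub>R x + t *\<^sub>R y) = (1 - t) * f x + t * f y"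
    for f :: "real \<times> real \<times> real \<times> real \<Rightarrow> real"
    using that by (intro convex_onI) auto
  have cont: "continuous_on UNIV a" "continuous_on UNIV b" "continuous_on UNIV c" "continuous_on UNIV d"
    unfolding abcd by (intro continuous_intros)+
  have bounded: "bounded {x. h x \<le> 0}"
  proof (rule bounded_subset[OF bounded_cbox])
    show "{x. h x \<le> 0} \<subseteq> cbox (0, 0, 0, 0) (1, 1, 1, 1)"
      by (auto simp: h_le abcd cbox_Pair_eq)
  qed
  have hom: "top_of_set (j ` {x. h x = 0}) homeomorphic_space nsphere (DIM(real \<times> real \<times> real \<times> real) - 1)"
  proof (rule embedded_convex_level_set)
    show "continuous_on UNIV h"
      unfolding h_def by (intro continuous_intros cont)
    show "convex_on UNIV h"
      unfolding h_def abcd by (intro convex_on_max affine) (simp_all add: algebra_simps)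
    show "h (1/5, 1/5, 1/5, 1/5) < 0"
      by (simp add: h_def abcd)
    show "continuous_on UNIV j"
    proof (rule continuous_on_coordinatewise_then_product)
      show "continuous_on UNIV (\<lambda>x. j x u)" for u
        unfolding j_def by (intro continuous_on_if_const continuous_intros cont)
    qed
    show "inj j"
    proof (rule injI)
      fix x y assume "j x = j y"
      then have "j x v0 = j y v0" "j x v1 = j y v1" "j x v2 = j y v2" "j x v3 = j y v3"
        by auto
      then show "x = y"
        by (simp add: j_def dist dist[symmetric] abcd prod_eq_iff)
    qed
  qed (rule bounded)
  have sumA: "sum f A = f v0 + f v1 + f v2 + f v3 + f v4" for f :: "'v \<Rightarrow> real"
    using dist by (simp add: A)
  have simplex: "(\<Union>v\<in>A. closed_simplex (A - {v})) = {f \<in> closed_simplex A. \<exists>v\<in>A. f v = 0}"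
  proof (intro equalityI subsetI)
    fix f assume "f \<in> (\<Union>v\<in>A. closed_simplex (A - {v}))"
    then obtain v where v: "v \<in> A" "f \<in> closed_simplex (A - {v})"
      by auto
    then have "f \<in> closed_simplex A"
      using closed_simplex_mono[OF \<open>finite A\<close>, of "A - {v}"] by auto
    then show "f \<in> {f \<in> closed_simplex A. \<exists>v\<in>A. f v = 0}"
      using v by (auto simp: closed_simplex_def)
  next
    fix f :: "'v \<Rightarrow> real" assume "f \<in> {f \<in> closed_simplex A. \<exists>v\<in>A. f v = 0}"
    then obtain v where v: "v \<in> A" "f v = 0" and f: "f \<in> closed_simplex A"
      by auto
    have "sum f A = f v + sum f (A - {v})"
      using \<open>finite A\<close> v by (simp add: sum.remove)
    then have "f \<in> closed_simplex (A - {v})"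
      using f v by (auto simp: closed_simplex_def)
    then show "f \<in> (\<Union>v\<in>A. closed_simplex (A - {v}))"
      using v by blast
  qed
  have "j ` {x. h x = 0} = {f \<in> closed_simplex A. \<exists>v\<in>A. f v = 0}"
  proof (intro equalityI subsetI)
    fix f assume "f \<in> j ` {x. h x = 0}"
    then obtain x where x: "h x = 0" "f = j x"
      by auto
    have vals: "j x v0 = a x" "j x v1 = b x" "j x v2 = c x" "j x v3 = d x"
        "j x v4 = 1 - a x - b x - c x - d x" "\<And>u. u \<notin> A \<Longrightarrow> j x u = 0"
      by (simp_all add: j_def A dist dist[symmetric])
    have ge: "0 \<le> a x" "0 \<le> b x" "0 \<le> c x" "0 \<le> d x" "0 \<le> 1 - a x - b x - c x - d x"
      and eq: "a x = 0 \<or> b x = 0 \<or> c x = 0 \<or> d x = 0 \<or> 1 - a x - b x - c x - d x = 0"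
      using h_le[of x] h_less[of x] x(1) by auto
    have "0 \<le> j x u" for u
      using ge by (simp add: j_def)
    moreover have "sum (j x) A = 1"
      by (simp add: sumA vals)
    moreover have "\<exists>v\<in>A. j x v = 0"
      using eq by (simp add: A vals)
    ultimately show "f \<in> {f \<in> closed_simplex A. \<exists>v\<in>A. f v = 0}"
      using vals(6) x(2) by (simp add: closed_simplex_def)
  next
    fix f assume f: "f \<in> {f \<in> closed_simplex A. \<exists>v\<in>A. f v = 0}"
    let ?x = "(f v0, f v1, f v2, f v3)"
    have s: "f v4 = 1 - f v0 - f v1 - f v2 - f v3"
      using f by (auto simp: closed_simplex_def sumA)
    have "f u = j ?x u" for u
    proof (cases "u \<in> A")
      case True
      then show ?thesis
        unfolding A by (elim insertE emptyE) (simp_all add: j_def abcd s dist dist[symmetric])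
    next
      case False
      then show ?thesis
        using f by (simp add: closed_simplex_def j_def A)
    qed
    then have "f = j ?x"
      by blast
    moreover have "0 \<le> f v0" "0 \<le> f v1" "0 \<le> f v2" "0 \<le> f v3" "0 \<le> f v4"
      "f v0 = 0 \<or> f v1 = 0 \<or> f v2 = 0 \<or> f v3 = 0 \<or> f v4 = 0"
      using f by (auto simp: closed_simplex_def A)
    then have "h ?x = 0"
      using h_le[of ?x] h_less[of ?x] s by (auto simp: abcd not_less order_antisym_conv)
    ultimately show "f \<in> j ` {x. h x = 0}"
      by blast
  qed
  then show ?thesis
    using hom by (simp add: simplex eval_nat_numeral)
qed

lemma circle_homeomorphic_nsphere:
  "top_of_set (sphere (0::complex) 1) homeomorphic_space nsphere 1"
  using sphere_homeomorphic_nsphere[where 'n = complex] by simp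

text \<open>The result asks for a model inside \<open>nat \<Rightarrow> real\<close>. The four real
  coordinates of two unit complex numbers provide it, the last one being repeated from index 3 on. A
  single torus is the base case \<open>single\<close>.\<close>

lemma torus_in_sequence_space:
  "\<exists>X :: (nat \<Rightarrow> real) topology. connected_sum_of_tori X \<and>
     top_of_set (sphere (0::complex) 1 \<times> sphere (0::complex) 1) homotopy_equivalent_space X"
proof -
  define j :: "complex \<times> complex \<Rightarrow> nat \<Rightarrow> real" where
    "j = (\<lambda>z i. if i = 0 then Re (fst z) else if i = 1 then Im (fst z)
       else if i = 2 then Re (snd z) else Im (snd z))"
  let ?S = "sphere (0::complex) 1 \<times> sphere (0::complex) 1"
  have "continuous_on ?S j"
  proof (rule continuous_on_coordinatewise_then_product)
    show "continuous_on ?S (\<lambda>x. j x i)" for i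
      unfolding j_def by (intro continuous_on_if_const continuous_intros)
  qed
  moreover have "inj_on j ?S"
  proof (rule inj_onI)
    fix x y assume "j x = j y"
    then have "j x 0 = j y 0" "j x 1 = j y 1" "j x 2 = j y 2" "j x 3 = j y 3"
      by auto
    then show "x = y"
      by (simp add: j_def prod_eq_iff complex_eq_iff)
  qed
  ultimately have "?S homeomorphic j ` ?S"
    by (intro homeomorphic_compact[where f = j]) (auto intro: compact_Times)
  then have hom: "top_of_set ?S homeomorphic_space top_of_set (j ` ?S)"
    by (rule homeomorphic_imp_homeomorphic_space)
  have "top_of_set ?S = prod_topology (top_of_set (sphere 0 1)) (top_of_set (sphere 0 1))"
    by (simp flip: subtopology_Times)
  then have "top_of_set ?S homeomorphic_space torus"
    using homeomorphic_space_prod_topology circle_homeomorphic_nsphere by metis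
  then have "connected_sum_of_tori (top_of_set (j ` ?S))"
    using hom by (intro connected_sum_of_tori.single) (metis homeomorphic_space_sym homeomorphic_space_trans)
  then show ?thesis
    using hom homeomorphic_imp_homotopy_equivalent_space by blast
qed

section \<open>Chains of spheres\<close>

text \<open>
  The map \<open>w \<mapsto> w * stretch w\<close> expands the middle third of \<open>[0, 1]\<close> to the whole interval, while
  \<open>w \<mapsto> (1 - w) * damp w\<close> is \<open>1\<close> on the first two thirds and then decreases to \<open>0\<close>.
\<close>

definition stretch :: "real \<Rightarrow> real" where
  "stretch w = max 0 (min 1 (3 * w - 1)) / max w (1/3)"

definition damp :: "real \<Rightarrow> real" where
  "damp w = 1 / max (1 - w) (1/3)"

text \<open>The numerator vanishes for \<open>w \<le> 1/3\<close>, so cutting the denominator off at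
  \<open>1/3\<close> leaves the quotient unchanged for positive \<open>w\<close> and removes the
  singularity at 0.\<close>

lemma continuous_on_stretch: "continuous_on S stretch"
  unfolding stretch_def by (intro continuous_intros) (auto simp: max_def)

lemma continuous_on_damp: "continuous_on S damp"
  unfolding damp_def by (intro continuous_intros) (auto simp: max_def)

lemmas continuous_on_stretch_damp [continuous_intros] =
  continuous_on_compose2[OF continuous_on_stretch _ subset_UNIV]
  continuous_on_compose2[OF continuous_on_damp _ subset_UNIV]

lemma stretch_nonneg: "0 \<le> stretch w"
  by (simp add: stretch_def)

lemma stretch_eq_0: "w \<le> 1/3 \<Longrightarrow> stretch w = 0"
  by (simp add: stretch_def)

lemma mult_stretch: "w * stretch w = max 0 (min 1 (3 * w - 1))"
  by (auto simp: stretch_def max_def)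

text \<open>The clipped ramps at \<open>w\<close> and \<open>1 - w\<close> are complementary, so
  rescaling the weights of two edges that carry everything keeps the total equal to 1.\<close>

lemma stretch_unity: "w * stretch w + (1 - w) * stretch (1 - w) = 1"
  unfolding mult_stretch by (simp add: max_def min_def)

lemma damp_nonneg: "0 \<le> damp w"
  by (simp add: damp_def max_def)

lemma mult_damp_le: "(1 - w) * damp w \<le> 1"
  by (simp add: damp_def max_def)

lemma mult_damp_eq: "w \<le> 2/3 \<Longrightarrow> (1 - w) * damp w = 1"
  by (simp add: damp_def max_def)

text \<open>\<open>damp w\<close> cancels \<open>1 - w\<close> up to \<open>w = 2/3\<close>; beyond
  that point \<open>stretch (1 - w)\<close> is already 0.\<close>

lemma mult_damp_stretch: "damp w * ((1 - w) * stretch (1 - w)) = stretch (1 - w)"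
  using mult_damp_eq[of w] stretch_eq_0[of "1 - w"] by (cases "w \<le> 2/3") (auto simp: mult.commute mult.left_commute)

text \<open>
  The edges \<open>{a i, b i}\<close>, with \<open>star\<close> exchanging their endpoints, are opposite edges of consecutive
  tetrahedra. All maps and homotopies have the form \<open>M \<alpha> \<beta>\<close>: they rescale, for each edge, its total
  weight and the difference of the weights of its endpoints.
\<close>

locale sphere_chain =
  fixes m :: nat and a b :: "nat \<Rightarrow> 'v::countable" and star :: "'v \<Rightarrow> 'v"
  assumes m: "3 \<le> m"
    and star_a: "\<And>i. i < m \<Longrightarrow> star (a i) = b i"
    and star_b: "\<And>i. i < m \<Longrightarrow> star (b i) = a i"
    and star_out: "\<And>u. (\<And>i. i < m \<Longrightarrow> u \<noteq> a i \<and> u \<noteq> b i) \<Longrightarrow> star u = u"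
    and ab: "\<And>i j. i < m \<Longrightarrow> j < m \<Longrightarrow> a i \<noteq> b j"
    and a_inj: "\<And>i j. i < m \<Longrightarrow> j < m \<Longrightarrow> a i = a j \<Longrightarrow> i = j"
    and b_inj: "\<And>i j. i < m \<Longrightarrow> j < m \<Longrightarrow> b i = b j \<Longrightarrow> i = j"
begin

definition nx :: "nat \<Rightarrow> nat" where "nx i = Suc i mod m"

definition wt :: "('v \<Rightarrow> real) \<Rightarrow> 'v \<Rightarrow> real" where "wt x u = x u + x (star u)"

definition df :: "('v \<Rightarrow> real) \<Rightarrow> 'v \<Rightarrow> real" where "df x u = x u - x (star u)"

text \<open>Under \<open>star\<close>, \<open>wt\<close> is even and \<open>df\<close> is odd, and
  half their sum is the original coordinate. \<open>M\<close> multiplies the two parts by separate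
  factors that depend only on the even part.\<close>

definition M :: "(real \<Rightarrow> real) \<Rightarrow> (real \<Rightarrow> real) \<Rightarrow> ('v \<Rightarrow> real) \<Rightarrow> 'v \<Rightarrow> real" where
  "M \<alpha> \<beta> x u = (wt x u * \<alpha> (wt x u) + df x u * \<beta> (wt x u)) / 2"

definition cell :: "(real \<Rightarrow> real \<Rightarrow> real \<Rightarrow> real \<Rightarrow> bool) \<Rightarrow> nat \<Rightarrow> ('v \<Rightarrow> real) set" where
  "cell R i = {x. (\<forall>u. u \<notin> {a i, b i, a (nx i), b (nx i)} \<longrightarrow> x u = 0) \<and>
     R (wt x (a i)) (df x (a i)) (wt x (a (nx i))) (df x (a (nx i)))}"

text \<open>With \<open>w\<close> the sum and \<open>d\<close> the difference of two endpoint
  weights, \<open>\<bar>d\<bar> \<le> w\<close> says that both are nonnegative and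
  \<open>\<bar>d\<bar> = w\<close> that one of them is 0. The final disjunction thus selects the
  boundary of the tetrahedron.\<close>

definition tetra :: "real \<Rightarrow> real \<Rightarrow> real \<Rightarrow> real \<Rightarrow> bool" where
  "tetra w d w' d' \<longleftrightarrow> w + w' = 1 \<and> \<bar>d\<bar> \<le> w \<and> \<bar>d'\<bar> \<le> w' \<and> (\<bar>d\<bar> = w \<or> \<bar>d'\<bar> = w')"

text \<open>The boundary of a tetrahedron with two opposite edges collapsed to points.\<close>

definition pinched :: "real \<Rightarrow> real \<Rightarrow> real \<Rightarrow> real \<Rightarrow> bool" where
  "pinched w d w' d' \<longleftrightarrow> w + w' = 1 \<and> \<bar>d\<bar> \<le> w * w' \<and> \<bar>d'\<bar> \<le> w * w' \<and> (\<bar>d\<bar> = w * w' \<or> \<bar>d'\<bar> = w * w')"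

definition chain :: "(real \<Rightarrow> real \<Rightarrow> real \<Rightarrow> real \<Rightarrow> bool) \<Rightarrow> ('v \<Rightarrow> real) set" where
  "chain R = (\<Union>i<m. cell R i)"

lemma ba: "i < m \<Longrightarrow> j < m \<Longrightarrow> b i \<noteq> a j"
  using ab by metis

lemma ab_disjoint: "i < m \<Longrightarrow> j < m \<Longrightarrow> i \<noteq> j \<Longrightarrow> {a i, b i} \<inter> {a j, b j} = {}"
  using ab[of i j] ba[of i j] a_inj[of i j] b_inj[of i j] by auto

lemma nx_less: "nx i < m"
  using m by (simp add: nx_def)

lemma nx_eq: "i < m \<Longrightarrow> nx i = (if Suc i = m then 0 else Suc i)"
  by (auto simp: nx_def)

text \<open>Here \<open>3 \<le> m\<close> enters: in a cycle of two cells the successor and the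
  predecessor would coincide, and adjacent cells would share two edges.\<close>

lemma nx_neq: "i < m \<Longrightarrow> nx i \<noteq> i" "i < m \<Longrightarrow> nx (nx i) \<noteq> i"
  using m by (auto simp: nx_eq nx_less)

lemma star_star: "star (star u) = u"
proof (cases "\<exists>i<m. u = a i \<or> u = b i")
  case True
  then show ?thesis by (auto simp: star_a star_b)
next
  case False
  then show ?thesis by (metis star_out)
qed

lemma wt_star: "wt x (star u) = wt x u" and df_star: "df x (star u) = - df x u"
  by (simp_all add: wt_def df_def star_star)

lemma wt_M: "wt (M \<alpha> \<beta> x) u = wt x u * \<alpha> (wt x u)"
  and df_M: "df (M \<alpha> \<beta> x) u = df x u * \<beta> (wt x u)"
  by (simp_all add: wt_def[of "M \<alpha> \<beta> x"] df_def[of "M \<alpha> \<beta> x"] M_def wt_star df_star field_simps)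

text \<open>The inner map turns a weight \<open>w\<close> into \<open>w * \<alpha>' w\<close>, and
  the outer factors are evaluated there. Comparing compositions thereby reduces to identities
  between real functions of one variable.\<close>

lemma M_M: "M \<alpha> \<beta> (M \<alpha>' \<beta>' x) = M (\<lambda>w. \<alpha>' w * \<alpha> (w * \<alpha>' w)) (\<lambda>w. \<beta>' w * \<beta> (w * \<alpha>' w)) x"
  by (rule ext) (simp add: M_def[of \<alpha> \<beta>] M_def[of "\<lambda>w. \<alpha>' w * \<alpha> (w * \<alpha>' w)"] wt_M df_M mult.assoc)

lemma M_id: "M (\<lambda>_. 1) (\<lambda>_. 1) x = x"
  by (rule ext) (simp add: M_def wt_def df_def)

lemma M_cell:
  assumes "i < m" "x \<in> cell R i"
    and "\<And>w d w' d'. R w d w' d' \<Longrightarrow> R' (w * \<alpha> w) (d * \<beta> w) (w' * \<alpha> w') (d' * \<beta> w')"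
  shows "M \<alpha> \<beta> x \<in> cell R' i"
proof -
  have "M \<alpha> \<beta> x u = 0" if u: "u \<notin> {a i, b i, a (nx i), b (nx i)}" for u
  proof -
    have "star u \<notin> {a i, b i, a (nx i), b (nx i)}"
      using u star_star[of u] star_a star_b assms(1) nx_less by auto
    then show ?thesis
      using u assms(2) by (simp add: M_def wt_def df_def cell_def)
  qed
  then show ?thesis
    using assms(2,3) by (simp add: cell_def wt_M df_M)
qed

text \<open>The factor at a vertex depends only on the weight of its own edge, so one formula serves
  all cells and agrees on shared edges without any gluing.\<close>

lemma M_chain:
  assumes "x \<in> chain R"
    and "\<And>w d w' d'. R w d w' d' \<Longrightarrow> R' (w * \<alpha> w) (d * \<beta> w) (w' * \<alpha> w') (d' * \<beta> w')"
  shows "M \<alpha> \<beta> x \<in> chain R'"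
proof -
  obtain i where i: "i < m" "x \<in> cell R i"
    using assms(1) by (auto simp: chain_def)
  have "M \<alpha> \<beta> x \<in> cell R' i"
    by (rule M_cell[OF i]) (rule assms(2))
  then show ?thesis
    using i by (auto simp: chain_def)
qed

lemma continuous_on_coord: "continuous_on S (\<lambda>x. x (u::'v) :: real)"
  by (rule continuous_on_subset[OF continuous_on_product_coordinates]) simp

lemma continuous_on_snd_coord: "continuous_on S (\<lambda>z. snd z (u::'v) :: real)"
  by (rule continuous_on_compose2[OF continuous_on_product_coordinates]) (auto intro: continuous_intros)

lemma M_chain_homotopic:
  fixes \<alpha> \<beta> :: "real \<Rightarrow> real \<Rightarrow> real"
  assumes "\<And>t w d w' d'. 0 \<le> t \<Longrightarrow> t \<le> 1 \<Longrightarrow> R w d w' d' \<Longrightarrow>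
      R (w * \<alpha> t w) (d * \<beta> t w) (w' * \<alpha> t w') (d' * \<beta> t w')"
    and "continuous_on UNIV (\<lambda>z. \<alpha> (fst z) (snd z))" "continuous_on UNIV (\<lambda>z. \<beta> (fst z) (snd z))"
  shows "homotopic_with_canon (\<lambda>_. True) (chain R) (chain R) (M (\<alpha> 0) (\<beta> 0)) (M (\<alpha> 1) (\<beta> 1))"
proof (rule homotopic_with_canonI[where h = "\<lambda>t. M (\<alpha> t) (\<beta> t)"])
  have w: "continuous_on S (\<lambda>z. wt (snd z) u)" and d: "continuous_on S (\<lambda>z. df (snd z) u)" for u S
    unfolding wt_def df_def by (intro continuous_intros continuous_on_snd_coord)+
  have cont: "continuous_on S (\<lambda>z. \<gamma> (fst z) (wt (snd z) u))"
    if "continuous_on UNIV (\<lambda>z. \<gamma> (fst z) (snd z))" for \<gamma> :: "real \<Rightarrow> real \<Rightarrow> real" and S u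
  proof -
    have "continuous_on S (\<lambda>z. (fst z, wt (snd z) u))"
      by (intro continuous_intros w)
    from continuous_on_compose2[OF that this] show ?thesis
      by simp
  qed
  show "continuous_on ({0..1} \<times> chain R) (\<lambda>z. M (\<alpha> (fst z)) (\<beta> (fst z)) (snd z))"
    unfolding M_def
    by (intro continuous_on_coordinatewise_then_product continuous_intros w d cont[OF assms(2)] cont[OF assms(3)]) auto
  show "M (\<alpha> t) (\<beta> t) x \<in> chain R" if "x \<in> chain R" "0 \<le> t" "t \<le> 1" for x t
    by (rule M_chain[OF that(1)]) (rule assms(1)[OF that(2,3)])
qed auto

lemma continuous_on_M:
  assumes "continuous_on UNIV \<alpha>" "continuous_on UNIV \<beta>"
  shows "continuous_on S (M \<alpha> \<beta>)"
proof (rule continuous_on_coordinatewise_then_product)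
  fix u
  have w: "continuous_on S (\<lambda>z. wt z u)" and d: "continuous_on S (\<lambda>z. df z u)"
    unfolding wt_def df_def by (intro continuous_intros continuous_on_coord)+
  show "continuous_on S (\<lambda>x. M \<alpha> \<beta> x u)"
    unfolding M_def
    by (intro continuous_intros w d continuous_on_compose2[OF assms(1) w]
        continuous_on_compose2[OF assms(2) w]) auto
qed

section \<open>Rescalings that respect the tetrahedron boundary and its pinched form\<close>

lemma tetra_unit: "tetra w d w' d' \<Longrightarrow> w' = 1 - w \<and> 0 \<le> w \<and> w \<le> 1"
  by (auto simp: tetra_def)

lemma pinched_unit: "pinched w d w' d' \<Longrightarrow> w' = 1 - w \<and> 0 \<le> w \<and> w \<le> 1"
proof -
  assume "pinched w d w' d'"
  then have "0 \<le> w * w'" "w + w' = 1"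
    by (auto simp: pinched_def)
  then show ?thesis
    by (auto simp: zero_le_mult_iff)
qed

text \<open>Scaling \<open>w\<close> and \<open>d\<close> by the same nonnegative factor preserves
  \<open>\<bar>d\<bar> \<le> w\<close> and \<open>\<bar>d\<bar> = w\<close>; the total stays 1 by
  \<open>stretch_unity\<close>, since it is affine in \<open>t\<close>.\<close>

lemma tetra_scale:
  assumes "tetra w d w' d'" "0 \<le> t" "t \<le> 1"
  shows "tetra (w * ((1 - t) + t * stretch w)) (d * ((1 - t) + t * stretch w))
    (w' * ((1 - t) + t * stretch w')) (d' * ((1 - t) + t * stretch w'))"
proof -
  define k k' where "k = (1 - t) + t * stretch w" and "k' = (1 - t) + t * stretch w'"
  have k: "0 \<le> k" "0 \<le> k'"
    using assms stretch_nonneg by (simp_all add: k_def k'_def)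
  have "w * k + w' * k' = (1 - t) * (w + w') + t * (w * stretch w + w' * stretch w')"
    by (simp add: k_def k'_def algebra_simps)
  also have "\<dots> = 1"
    using tetra_unit[OF assms(1)] stretch_unity[of w] by simp
  finally show ?thesis
    using assms(1) k unfolding tetra_def k_def[symmetric] k'_def[symmetric]
    by (auto simp: abs_mult mult_right_mono)
qed

text \<open>Stretching annihilates an edge of weight at most \<open>1/3\<close>, and for such an
  edge the required equality becomes \<open>0 = 0\<close>. So equality has to be known beforehand
  only when neither weight reaches \<open>2/3\<close>, which leaves freedom to alter differences
  near the ends.\<close>

lemma tetra_stretch:
  assumes w: "w' = 1 - w" "0 \<le> w" "w \<le> 1" and e: "\<bar>e\<bar> \<le> w" "\<bar>e'\<bar> \<le> w'"
    and eq: "w \<le> 2/3 \<and> \<bar>e\<bar> = w \<or> w' \<le> 2/3 \<and> \<bar>e'\<bar> = w' \<or> 2/3 \<le> w \<or> 2/3 \<le> w'"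
  shows "tetra (w * stretch w) (e * stretch w) (w' * stretch w') (e' * stretch w')"
proof -
  have le: "\<bar>e * stretch w\<bar> \<le> w * stretch w" "\<bar>e' * stretch w'\<bar> \<le> w' * stretch w'"
    using e stretch_nonneg by (auto simp: abs_mult intro: mult_right_mono)
  have "\<bar>e * stretch w\<bar> = w * stretch w \<or> \<bar>e' * stretch w'\<bar> = w' * stretch w'"
    using eq
  proof (elim disjE)
    assume "2/3 \<le> w"
    then have "stretch w' = 0"
      using w by (intro stretch_eq_0) auto
    then show ?thesis by simp
  next
    assume "2/3 \<le> w'"
    then have "stretch w = 0"
      using w by (intro stretch_eq_0) auto
    then show ?thesis by simp
  qed (use stretch_nonneg in \<open>auto simp: abs_mult\<close>)
  then show ?thesis
    using le stretch_unity[of w] w by (simp add: tetra_def)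
qed

text \<open>The extra factor is 1 for \<open>w \<le> 2/3\<close>. For larger \<open>w\<close> it
  moves points off the faces given by \<open>\<bar>d\<bar> = w\<close>, but there the opposite edge
  is stretched to weight 0, so the boundary is not left.\<close>

lemma tetra_shrink:
  assumes "tetra w d w' d'" "0 \<le> t" "t \<le> 1"
  shows "tetra (w * stretch w) (d * (stretch w * ((1 - t) + t * ((1 - w) * damp w))))
    (w' * stretch w') (d' * (stretch w' * ((1 - t) + t * ((1 - w') * damp w'))))"
proof -
  define c where "c = (\<lambda>w. (1 - t) + t * ((1 - w) * damp w))"
  have c: "0 \<le> c v" "c v \<le> 1" "v \<le> 2/3 \<Longrightarrow> c v = 1" if "v \<le> 1" for v
    using that assms mult_damp_le[of v] mult_damp_eq[of v] damp_nonneg[of v]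
    by (auto simp: c_def mult_left_le)
  have w: "w' = 1 - w" "0 \<le> w" "w \<le> 1" "w' \<le> 1"
    using tetra_unit[OF assms(1)] by auto
  have d: "\<bar>d\<bar> \<le> w" "\<bar>d'\<bar> \<le> w'" "\<bar>d\<bar> = w \<or> \<bar>d'\<bar> = w'"
    using assms(1) by (auto simp: tetra_def)
  have "\<bar>d\<bar> * c w \<le> w * 1" "\<bar>d'\<bar> * c w' \<le> w' * 1"
    using c w d by (intro mult_mono; simp)+
  then have "tetra (w * stretch w) (d * c w * stretch w) (w' * stretch w') (d' * c w' * stretch w')"
    using w c d by (intro tetra_stretch) (auto simp: abs_mult)
  then show ?thesis
    by (simp add: c_def mult_ac)
qed

text \<open>\<open>damp\<close> undoes the pinching factor up to weight \<open>2/3\<close>, where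
  \<open>\<bar>d\<bar> = w * w'\<close> becomes \<open>\<bar>d\<bar> = w\<close> again. Beyond
  \<open>2/3\<close> only an inequality survives, which suffices for
  \<open>tetra_stretch\<close>.\<close>

lemma pinched_to_tetra:
  assumes "pinched w d w' d'"
  shows "tetra (w * stretch w) (d * (stretch w * damp w)) (w' * stretch w') (d' * (stretch w' * damp w'))"
proof -
  have w: "w' = 1 - w" "0 \<le> w" "w \<le> 1" "w' \<le> 1"
    using pinched_unit[OF assms(1)] by auto
  have d: "\<bar>d\<bar> \<le> w * w'" "\<bar>d'\<bar> \<le> w * w'" "\<bar>d\<bar> = w * w' \<or> \<bar>d'\<bar> = w * w'"
    using assms(1) by (auto simp: pinched_def)
  have le: "\<bar>d\<bar> * damp w \<le> w * w' * damp w" "\<bar>d'\<bar> * damp w' \<le> w * w' * damp w'"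
    using d damp_nonneg by (auto intro: mult_right_mono)
  have "w * (w' * damp w) \<le> w * 1" "w' * (w * damp w') \<le> w' * 1"
    using w mult_damp_le[of w] mult_damp_le[of w'] by (intro mult_left_mono; simp)+
  with le have le': "\<bar>d * damp w\<bar> \<le> w" "\<bar>d' * damp w'\<bar> \<le> w'"
    using damp_nonneg by (auto simp: abs_mult mult_ac)
  have eq: "w \<le> 2/3 \<Longrightarrow> w * w' * damp w = w" "w' \<le> 2/3 \<Longrightarrow> w * w' * damp w' = w'"
    using mult_damp_eq[of w] mult_damp_eq[of w'] w by (simp_all add: mult_ac)
  have "tetra (w * stretch w) (d * damp w * stretch w) (w' * stretch w') (d' * damp w' * stretch w')"
  proof (rule tetra_stretch)
    show "w \<le> 2/3 \<and> \<bar>d * damp w\<bar> = w \<or> w' \<le> 2/3 \<and> \<bar>d' * damp w'\<bar> = w' \<or> 2/3 \<le> w \<or> 2/3 \<le> w'"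
      using d(3) eq damp_nonneg by (auto simp: abs_mult)
  qed (use w le' in auto)
  then show ?thesis
    by (simp add: mult_ac)
qed

text \<open>Multiplying each difference by the weight of the other edge replaces both bounds by
  \<open>w * w'\<close>. This product vanishes when one edge carries all the weight, so that edge is
  contracted to its midpoint.\<close>

lemma tetra_to_pinched:
  assumes "tetra w d w' d'"
  shows "pinched (w * 1) (d * (1 - w)) (w' * 1) (d' * (1 - w'))"
proof -
  have w: "w' = 1 - w" "0 \<le> w" "w \<le> 1" "0 \<le> w'"
    using tetra_unit[OF assms(1)] by auto
  have "\<bar>d\<bar> * w' \<le> w * w'" "\<bar>d'\<bar> * w \<le> w' * w"
    using assms w by (auto simp: tetra_def intro: mult_right_mono)
  then show ?thesis
    using assms w by (auto simp: tetra_def pinched_def abs_mult mult.commute)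
qed

text \<open>The bound \<open>w * w'\<close> is scaled by the factors of both edges, so each
  difference must be scaled by their product.\<close>

lemma pinched_scale:
  assumes "pinched w d w' d'" "0 \<le> t" "t \<le> 1"
  shows "pinched (w * ((1 - t) + t * stretch w))
    (d * (((1 - t) + t * stretch w) * ((1 - t) + t * stretch (1 - w))))
    (w' * ((1 - t) + t * stretch w')) (d' * (((1 - t) + t * stretch w') * ((1 - t) + t * stretch (1 - w'))))"
proof -
  have w: "w' = 1 - w" "1 - w' = w"
    using pinched_unit[OF assms(1)] by auto
  define k k' where "k = (1 - t) + t * stretch w" and "k' = (1 - t) + t * stretch w'"
  have k: "0 \<le> k" "0 \<le> k'"
    using assms stretch_nonneg by (simp_all add: k_def k'_def)
  have "w * k + w' * k' = (1 - t) * (w + w') + t * (w * stretch w + w' * stretch w')"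
    by (simp add: k_def k'_def algebra_simps)
  also have "\<dots> = 1"
    by (simp add: w(1) stretch_unity)
  finally have "w * k + w' * k' = 1" .
  moreover have "\<bar>e\<bar> * (k * k') \<le> (w * w') * (k * k')" if "\<bar>e\<bar> \<le> w * w'" for e
    using that k by (intro mult_right_mono) auto
  ultimately have "pinched (w * k) (d * (k * k')) (w' * k') (d' * (k' * k))"
    using assms(1) k unfolding pinched_def by (auto simp: abs_mult mult_ac)
  then show ?thesis
    by (simp add: k_def k'_def w)
qed

theorem homotopy_equivalent:
  "top_of_set (chain tetra) homotopy_equivalent_space top_of_set (chain pinched)"
proof -
  \<comment> \<open>\<open>\<Phi>\<close> pinches. In the other direction \<open>f\<close> maps the
    whole cap \<open>w \<ge> 2/3\<close> around a pinch point into the contracted edge, because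
    \<open>w * stretch w = 1\<close> there, and the pinch point itself to the midpoint.\<close>
  define \<Phi> where "\<Phi> = M (\<lambda>_. 1) (\<lambda>w. 1 - w)"
  define f where "f = M stretch (\<lambda>w. stretch w * damp w)"
  have \<Phi>: "\<Phi> x \<in> chain pinched" if "x \<in> chain tetra" for x
    unfolding \<Phi>_def by (rule M_chain[OF that]) (rule tetra_to_pinched)
  have f: "f x \<in> chain tetra" if "x \<in> chain pinched" for x
    unfolding f_def by (rule M_chain[OF that]) (rule pinched_to_tetra)
  have cont: "continuous_on S \<Phi>" "continuous_on S f" for S
    unfolding \<Phi>_def f_def by (intro continuous_on_M continuous_intros)+
  let ?S = "M stretch stretch"
  have "homotopic_with_canon (\<lambda>_. True) (chain tetra) (chain tetra)
      (M (\<lambda>w. (1 - 0) + 0 * stretch w) (\<lambda>w. (1 - 0) + 0 * stretch w)) (M (\<lambda>w. (1 - 1) + 1 * stretch w) (\<lambda>w. (1 - 1) + 1 * stretch w))"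
    by (rule M_chain_homotopic) (auto intro!: tetra_scale continuous_intros)
  then have 1: "homotopic_with_canon (\<lambda>_. True) (chain tetra) (chain tetra) id ?S"
    by (simp add: M_id[abs_def] id_def)
  have "homotopic_with_canon (\<lambda>_. True) (chain tetra) (chain tetra)
      (M stretch (\<lambda>w. stretch w * ((1 - 0) + 0 * ((1 - w) * damp w)))) (M stretch (\<lambda>w. stretch w * ((1 - 1) + 1 * ((1 - w) * damp w))))"
    by (rule M_chain_homotopic) (auto intro!: tetra_shrink continuous_intros)
  moreover have "f \<circ> \<Phi> = M stretch (\<lambda>w. stretch w * ((1 - w) * damp w))"
    by (rule ext) (simp add: f_def \<Phi>_def M_M mult_ac)
  ultimately have 2: "homotopic_with_canon (\<lambda>_. True) (chain tetra) (chain tetra) ?S (f \<circ> \<Phi>)"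
    by simp
  have "homotopic_with_canon (\<lambda>_. True) (chain pinched) (chain pinched)
      (M (\<lambda>w. (1 - 0) + 0 * stretch w) (\<lambda>w. ((1 - 0) + 0 * stretch w) * ((1 - 0) + 0 * stretch (1 - w))))
      (M (\<lambda>w. (1 - 1) + 1 * stretch w) (\<lambda>w. ((1 - 1) + 1 * stretch w) * ((1 - 1) + 1 * stretch (1 - w))))"
    by (rule M_chain_homotopic) (auto intro!: pinched_scale continuous_intros)
  then have "homotopic_with_canon (\<lambda>_. True) (chain pinched) (chain pinched) id (M stretch (\<lambda>w. stretch w * stretch (1 - w)))"
    by (simp add: M_id[abs_def] id_def)
  \<comment> \<open>\<open>\<Phi>\<close> evaluates its factor at the stretched weight, and
    \<open>1 - w * stretch w\<close> is the stretched complementary weight; the factor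
    \<open>1 - w\<close> in it is then cancelled by \<open>damp w\<close>.\<close>
  moreover have "M stretch (\<lambda>w. stretch w * stretch (1 - w)) x = (\<Phi> \<circ> f) x" if "x \<in> chain pinched" for x
  proof -
    have "1 - w * stretch w = (1 - w) * stretch (1 - w)" for w
      using stretch_unity[of w] by simp
    then have *: "stretch w * damp w * (1 - w * stretch w) = stretch w * stretch (1 - w)" for w
      using mult_damp_stretch[of w] by (simp add: mult.assoc)
    show ?thesis
      unfolding \<Phi>_def f_def comp_def M_M * by simp
  qed
  ultimately have 3: "homotopic_with_canon (\<lambda>_. True) (chain pinched) (chain pinched) id (\<Phi> \<circ> f)"
    by (auto intro: homotopic_with_eq)
  show ?thesis
    unfolding homotopy_equivalent_space_def
  proof (intro exI conjI)
    show "continuous_map (top_of_set (chain tetra)) (top_of_set (chain pinched)) \<Phi>"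
      "continuous_map (top_of_set (chain pinched)) (top_of_set (chain tetra)) f"
      using cont \<Phi> f by (auto simp: continuous_map_in_subtopology)
    show "homotopic_with (\<lambda>_. True) (top_of_set (chain tetra)) (top_of_set (chain tetra)) (f \<circ> \<Phi>) id"
      using 1 2 homotopic_with_trans homotopic_with_symD by blast
    show "homotopic_with (\<lambda>_. True) (top_of_set (chain pinched)) (top_of_set (chain pinched)) (\<Phi> \<circ> f) id"
      using 3 homotopic_with_symD by blast
  qed
qed

section \<open>The pinched cells as the spheres of a garland\<close>

lemma pinched_sphere:
  assumes i: "i < m"
  shows "top_of_set (cell pinched i) homeomorphic_space nsphere 2"
proof -
  define w d e :: "real \<times> real \<times> real \<Rightarrow> real"
    where "w = fst" and "d = (\<lambda>x. fst (snd x))" and "e = (\<lambda>x. snd (snd x))"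
  note wde = w_def d_def e_def
  \<comment> \<open>After eliminating \<open>w' = 1 - w\<close>, the pinched boundary is
    \<open>max \<bar>d\<bar> \<bar>e\<bar> = w * (1 - w)\<close>. The right-hand side is concave in
    \<open>w\<close>, so the difference of the two sides is convex.\<close>
  define h where "h = (\<lambda>x. max \<bar>d x\<bar> \<bar>e x\<bar> + (w x * w x - w x))"
  define j where "j = (\<lambda>x u. if u = a i then (w x + d x) / 2 else if u = b i then (w x - d x) / 2
      else if u = a (nx i) then (1 - w x + e x) / 2 else if u = b (nx i) then (1 - w x - e x) / 2 else 0)"
  have ne: "a i \<noteq> b i" "a i \<noteq> a (nx i)" "a i \<noteq> b (nx i)" "b i \<noteq> a (nx i)" "b i \<noteq> b (nx i)"
      "a (nx i) \<noteq> b (nx i)"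
    using ab[of i i] ab[of i "nx i"] ab[of "nx i" i] ab[of "nx i" "nx i"] a_inj[of i "nx i"]
      b_inj[of i "nx i"] nx_neq(1)[OF i] i nx_less[of i] by auto
  have cont: "continuous_on UNIV w" "continuous_on UNIV d" "continuous_on UNIV e"
    unfolding wde by (intro continuous_intros)+
  have h_eq: "h x \<le> 0 \<longleftrightarrow> \<bar>d x\<bar> \<le> w x * (1 - w x) \<and> \<bar>e x\<bar> \<le> w x * (1 - w x)"
    "h x = 0 \<longleftrightarrow> pinched (w x) (d x) (1 - w x) (e x)" for x
    unfolding h_def pinched_def right_diff_distrib by (auto simp: max_def abs_le_iff split: if_splits)
  have hom: "top_of_set (j ` {x. h x = 0}) homeomorphic_space nsphere (DIM(real \<times> real \<times> real) - 1)"
  proof (rule embedded_convex_level_set)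
    show "continuous_on UNIV h"
      unfolding h_def by (intro continuous_intros cont)
    have abs: "convex_on UNIV (\<lambda>x. \<bar>f x\<bar>)" if "\<And>t x y. f ((1 - t) *\<^sub>R x + t *\<^sub>R y) = (1 - t) * f x + t * f y"
      for f :: "real \<times> real \<times> real \<Rightarrow> real"
    proof (rule convex_onI)
      fix t :: real and x y assume t: "0 < t" "t < 1"
      have "\<bar>(1 - t) * f x + t * f y\<bar> \<le> \<bar>(1 - t) * f x\<bar> + \<bar>t * f y\<bar>"
        by (rule abs_triangle_ineq)
      then show "\<bar>f ((1 - t) *\<^sub>R x + t *\<^sub>R y)\<bar> \<le> (1 - t) * \<bar>f x\<bar> + t * \<bar>f y\<bar>"
        using t by (simp add: that abs_mult)
    qed auto
    have quad: "convex_on UNIV (\<lambda>x. w x * w x - w x)"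
    proof (rule convex_onI)
      fix t :: real and x y assume t: "0 < t" "t < 1"
      have lin: "w ((1 - t) *\<^sub>R x + t *\<^sub>R y) = (1 - t) * w x + t * w y"
        by (simp add: w_def)
      have "(1 - t) * (w x * w x - w x) + t * (w y * w y - w y)
          - (((1 - t) * w x + t * w y) * ((1 - t) * w x + t * w y) - ((1 - t) * w x + t * w y))
          = t * (1 - t) * (w x - w y)\<^sup>2"
        by (simp add: power2_eq_square algebra_simps)
      moreover have "0 \<le> t * (1 - t) * (w x - w y)\<^sup>2"
        using t by simp
      ultimately show "w ((1 - t) *\<^sub>R x + t *\<^sub>R y) * w ((1 - t) *\<^sub>R x + t *\<^sub>R y) - w ((1 - t) *\<^sub>R x + t *\<^sub>R y)
          \<le> (1 - t) * (w x * w x - w x) + t * (w y * w y - w y)"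
        unfolding lin by linarith
    qed auto
    show "convex_on UNIV h"
      unfolding h_def
      by (intro convex_on_add convex_on_max abs quad) (simp_all add: d_def e_def)
    show "h (1/2, 0, 0) < 0"
      by (simp add: h_def wde)
    show "bounded {x. h x \<le> 0}"
    proof (rule bounded_subset[OF bounded_cbox])
      show "{x. h x \<le> 0} \<subseteq> cbox (0, -1, -1) (1, 1, 1)"
      proof
        fix x assume "x \<in> {x. h x \<le> 0}"
        then have x: "\<bar>d x\<bar> \<le> w x * (1 - w x)" "\<bar>e x\<bar> \<le> w x * (1 - w x)"
          by (auto simp: h_eq)
        then have "0 \<le> w x * (1 - w x)"
          by linarith
        then have w01: "0 \<le> w x" "w x \<le> 1"
          by (auto simp: zero_le_mult_iff)
        then have "w x * (1 - w x) \<le> 1"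
          by (simp add: mult_le_one)
        then have "\<bar>d x\<bar> \<le> 1" "\<bar>e x\<bar> \<le> 1"
          using x by linarith+
        then show "x \<in> cbox (0, -1, -1) (1, 1, 1)"
          using w01 by (cases x) (auto simp: wde cbox_Pair_eq)
      qed
    qed
    show "continuous_on UNIV j"
    proof (rule continuous_on_coordinatewise_then_product)
      show "continuous_on UNIV (\<lambda>x. j x u)" for u
        unfolding j_def by (intro continuous_on_if_const continuous_intros cont) simp_all
    qed
    show "inj j"
    proof (rule injI)
      fix x y assume "j x = j y"
      then have "j x (a i) = j y (a i)" "j x (b i) = j y (b i)" "j x (a (nx i)) = j y (a (nx i))"
        by auto
      then have "w x + d x = w y + d y" "w x - d x = w y - d y" "1 - w x + e x = 1 - w y + e y"
        by (simp_all add: j_def ne ne[symmetric])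
      then have "w x = w y" "d x = d y" "e x = e y"
        by linarith+
      then show "x = y"
        by (simp add: wde prod_eq_iff)
    qed
  qed
  have star: "star (a i) = b i" "star (a (nx i)) = b (nx i)"
    using i nx_less by (auto simp: star_a)
  have vals: "wt (j x) (a i) = w x" "df (j x) (a i) = d x" "wt (j x) (a (nx i)) = 1 - w x"
      "df (j x) (a (nx i)) = e x" for x
    by (simp_all add: wt_def df_def star j_def ne ne[symmetric] field_simps)
  have "j ` {x. h x = 0} = cell pinched i"
  proof (intro equalityI subsetI)
    fix y assume "y \<in> j ` {x. h x = 0}"
    then obtain x where "h x = 0" and y: "y = j x"
      by auto
    then have "pinched (wt y (a i)) (df y (a i)) (wt y (a (nx i))) (df y (a (nx i)))"
      by (simp add: vals h_eq)
    then show "y \<in> cell pinched i"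
      by (simp add: cell_def y j_def)
  next
    fix y assume y: "y \<in> cell pinched i"
    define x where "x = (wt y (a i), df y (a i), df y (a (nx i)))"
    have p: "pinched (w x) (d x) (wt y (a (nx i))) (e x)"
      using y by (simp add: cell_def x_def wde)
    then have w': "wt y (a (nx i)) = 1 - w x"
      by (auto simp: pinched_def)
    have "y u = j x u" for u
    proof (cases "u \<in> {a i, b i, a (nx i), b (nx i)}")
      case True
      have "1 - w x = y (a (nx i)) + y (b (nx i))"
        using w' by (simp add: wt_def star)
      moreover have "w x = y (a i) + y (b i)" "d x = y (a i) - y (b i)" "e x = y (a (nx i)) - y (b (nx i))"
        by (simp_all add: x_def wde wt_def df_def star)
      ultimately show ?thesis
        using True by (auto simp: j_def ne ne[symmetric])
    next
      case False
      then show ?thesis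
        using y by (simp add: cell_def j_def)
    qed
    moreover have "h x = 0"
      using p w' by (simp add: h_eq)
    ultimately show "y \<in> j ` {x. h x = 0}"
      by blast
  qed
  then show ?thesis
    using hom by (simp add: eval_nat_numeral)
qed

text \<open>A common point is supported on the shared edge, which then has weight 1 while the other
  edge has weight 0. The bound \<open>w * w' = 0\<close> forces equal weights at its endpoints,
  leaving only the midpoint.\<close>

lemma pinched_adjacent:
  assumes i: "i < m"
  shows "cell pinched i \<inter> cell pinched (nx i) = {\<lambda>u. if u \<in> {a (nx i), b (nx i)} then 1/2 else 0}"
proof -
  let ?j = "nx i" and ?k = "nx (nx i)"
  have j: "?j < m" and k: "?k < m"
    using nx_less by auto
  have "i \<noteq> ?j" "i \<noteq> ?k" "?j \<noteq> ?k"
    using nx_neq[OF i] nx_neq(1)[OF j] by auto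
  then have ne: "a i \<notin> {a ?j, b ?j, a ?k, b ?k}" "b i \<notin> {a ?j, b ?j, a ?k, b ?k}"
      "a ?k \<notin> {a i, b i, a ?j, b ?j}" "b ?k \<notin> {a i, b i, a ?j, b ?j}" "a ?j \<noteq> b ?j"
    using ab_disjoint[OF i j] ab_disjoint[OF i k] ab_disjoint[OF j k] ab[OF j j] by auto
  have star: "star (a i) = b i" "star (a ?j) = b ?j" "star (a ?k) = b ?k"
    using i j k by (auto simp: star_a)
  show ?thesis
  proof (intro equalityI subsetI)
    fix x assume x: "x \<in> cell pinched i \<inter> cell pinched ?j"
    then have z: "x u = 0" if "u \<notin> {a ?j, b ?j}" for u
      using that ne by (cases "u \<in> {a i, b i}") (auto simp: cell_def)
    have "wt x (a i) = 0"
      using z ne by (simp add: wt_def star)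
    then have "wt x (a ?j) = 1" "df x (a ?j) = 0"
      using x by (auto simp: cell_def pinched_def)
    then have "x (a ?j) = 1/2" "x (b ?j) = 1/2"
      by (auto simp: wt_def df_def star)
    then show "x \<in> {\<lambda>u. if u \<in> {a ?j, b ?j} then 1/2 else 0}"
      using z by (auto simp: fun_eq_iff)
  next
    fix x :: "'v \<Rightarrow> real" assume "x \<in> {\<lambda>u. if u \<in> {a ?j, b ?j} then 1/2 else 0}"
    then have x: "x = (\<lambda>u. if u \<in> {a ?j, b ?j} then 1/2 else 0)"
      by simp
    have "wt x (a i) = 0" "df x (a i) = 0" "wt x (a ?j) = 1" "df x (a ?j) = 0" "wt x (a ?k) = 0"
        "df x (a ?k) = 0"
      using ne by (simp_all add: x wt_def df_def star)
    then show "x \<in> cell pinched i \<inter> cell pinched ?j"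
      by (simp add: cell_def pinched_def) (simp add: x)
  qed
qed

lemma pinched_disjoint:
  assumes "i < m" "j < m" "i \<noteq> j" "nx i \<noteq> j" "nx j \<noteq> i"
  shows "cell pinched i \<inter> cell pinched j = {}"
proof -
  have nx: "nx i \<noteq> nx j"
    using assms by (auto simp: nx_eq split: if_splits)
  note ab_disjoint[OF assms(1,2,3)] ab_disjoint[OF assms(1) nx_less assms(5)[symmetric]]
    ab_disjoint[OF nx_less assms(2,4)] ab_disjoint[OF nx_less nx_less nx]
  then have disj: "{a i, b i, a (nx i), b (nx i)} \<inter> {a j, b j, a (nx j), b (nx j)} = {}"
    by (simp add: insert_commute)
  have zero: "x u = 0" if "x \<in> cell pinched i" "x \<in> cell pinched j" for x u
    using that disj unfolding cell_def mem_Collect_eq by blast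
  have False if x: "x \<in> cell pinched i" "x \<in> cell pinched j" for x
  proof -
    have "wt x (a i) + wt x (a (nx i)) = 1"
      using x(1) unfolding cell_def pinched_def by blast
    then show False
      unfolding wt_def zero[OF x] by simp
  qed
  then show ?thesis
    by blast
qed

theorem garland_of_spheres_pinched: "garland_of_spheres (top_of_set (chain pinched))"
  unfolding garland_of_spheres_def
proof (intro conjI exI)
  \<comment> \<open>\<open>garland\<close> numbers its pieces from 1, the chain numbers its cells
    from 0.\<close>
  let ?A = "\<lambda>i. cell pinched (i - 1)"
  show "Hausdorff_space (top_of_set (chain pinched))"
    by (simp add: Hausdorff_space_subtopology)
  have chain_eq: "chain pinched = (\<Union>i\<in>{1..m}. ?A i)"
  proof -
    have "{..<m} = (\<lambda>i. i - 1) ` {1..m}"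
      by (auto simp: image_iff intro!: bexI[where x = "Suc _"])
    then show ?thesis
      by (simp add: chain_def)
  qed
  have nx_iff: "i - 1 = nx (j - 1) \<longleftrightarrow> [int i - int j = 1] (mod int m)"
    if "i \<in> {1..m}" "j \<in> {1..m}" for i j
  proof -
    have "[int i - int j = 1] (mod int m) \<longleftrightarrow> [int (i - 1) = int j] (mod int m)"
      using that by (auto simp: cong_iff_dvd_diff algebra_simps of_nat_diff)
    also have "\<dots> \<longleftrightarrow> (i - 1) mod m = j mod m"
      by (subst cong_int_iff) (simp add: cong_def)
    also have "(i - 1) mod m = i - 1"
      using that by (intro mod_less) auto
    finally show ?thesis
      using that by (simp add: nx_def)
  qed
  show "garland (top_of_set (chain pinched)) m ?A"
    unfolding garland_def
  proof (intro conjI ballI impI)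
    show "1 \<le> m"
      using m by simp
    show "topspace (top_of_set (chain pinched)) = (\<Union>i\<in>{1..m}. ?A i)"
      by (simp add: chain_eq)
    fix i j assume ij: "i \<in> {1..m}" "j \<in> {1..m}" "i \<noteq> j"
    have "[int i - int j = - 1] (mod int m) \<longleftrightarrow> [int j - int i = 1] (mod int m)"
      using cong_minus_minus_iff[of "int i - int j" "-1" "int m"] by simp
    then have iff: "[int i - int j = 1] (mod int m) \<or> [int i - int j = - 1] (mod int m) \<longleftrightarrow>
        i - 1 = nx (j - 1) \<or> j - 1 = nx (i - 1)"
      using nx_iff ij by simp
    have lt: "i - 1 < m" "j - 1 < m" "i - 1 \<noteq> j - 1"
      using ij by auto
    show "if [int i - int j = 1] (mod int m) \<or> [int i - int j = - 1] (mod int m)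
         then card (?A i \<inter> ?A j) = 1 else ?A i \<inter> ?A j = {}"
      unfolding iff using pinched_adjacent[OF lt(1)] pinched_adjacent[OF lt(2)] pinched_disjoint[OF lt]
      by (auto simp: Int_commute)
  qed
  show "\<forall>i\<in>{1..m}. subtopology (top_of_set (chain pinched)) (?A i) homeomorphic_space nsphere 2"
  proof
    fix i assume i: "i \<in> {1..m}"
    then have "?A i \<subseteq> chain pinched"
      by (auto simp: chain_eq)
    moreover have "i - 1 < m"
      using i by auto
    ultimately show "subtopology (top_of_set (chain pinched)) (?A i) homeomorphic_space nsphere 2"
      using pinched_sphere by (simp add: subtopology_subtopology Int_absorb1)
  qed
qed

lemma cell_tetra:
  assumes i: "i < m"
  shows "cell tetra i = closed_simplex {a i, b i, a (nx i)} \<union> closed_simplex {a i, b i, b (nx i)} \<union>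
    closed_simplex {a (nx i), b (nx i), a i} \<union> closed_simplex {a (nx i), b (nx i), b i}"
proof -
  let ?j = "nx i"
  have j: "?j < m" and "i \<noteq> ?j"
    using nx_less nx_neq[OF i] by auto
  then have ne: "a i \<noteq> b i" "a i \<noteq> a ?j" "a i \<noteq> b ?j" "b i \<noteq> a ?j" "b i \<noteq> b ?j" "a ?j \<noteq> b ?j"
    using ab_disjoint[OF i j] ab[OF i i] ab[OF j j] by auto
  have star: "star (a i) = b i" "star (a ?j) = b ?j"
    using i j by (auto simp: star_a)
  show ?thesis
  proof (intro equalityI subsetI)
    fix x assume x: "x \<in> cell tetra i"
    then have z: "x u = 0" if "u \<notin> {a i, b i, a ?j, b ?j}" for u
      using that by (auto simp: cell_def)
    have t: "tetra (x (a i) + x (b i)) (x (a i) - x (b i)) (x (a ?j) + x (b ?j)) (x (a ?j) - x (b ?j))"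
      using x by (simp add: cell_def wt_def df_def star)
    then have nn: "0 \<le> x (a i)" "0 \<le> x (b i)" "0 \<le> x (a ?j)" "0 \<le> x (b ?j)"
        and s: "x (a i) + x (b i) + (x (a ?j) + x (b ?j)) = 1"
      unfolding tetra_def abs_le_iff by linarith+
    have or: "x (b i) = 0 \<or> x (a i) = 0 \<or> x (b ?j) = 0 \<or> x (a ?j) = 0"
      using t unfolding tetra_def abs_if by (auto split: if_splits)
    have "0 \<le> x u" for u
      using nn z by (cases "u \<in> {a i, b i, a ?j, b ?j}") auto
    then have "x (b ?j) = 0 \<Longrightarrow> x \<in> closed_simplex {a i, b i, a ?j}"
        "x (a ?j) = 0 \<Longrightarrow> x \<in> closed_simplex {a i, b i, b ?j}"
        "x (b i) = 0 \<Longrightarrow> x \<in> closed_simplex {a ?j, b ?j, a i}"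
        "x (a i) = 0 \<Longrightarrow> x \<in> closed_simplex {a ?j, b ?j, b i}"
      using s z by (auto simp: closed_simplex_def ne ne[symmetric]) metis
    then show "x \<in> closed_simplex {a i, b i, a ?j} \<union> closed_simplex {a i, b i, b ?j} \<union>
        closed_simplex {a ?j, b ?j, a i} \<union> closed_simplex {a ?j, b ?j, b i}"
      using or by auto
  next
    fix x assume "x \<in> closed_simplex {a i, b i, a ?j} \<union> closed_simplex {a i, b i, b ?j} \<union>
        closed_simplex {a ?j, b ?j, a i} \<union> closed_simplex {a ?j, b ?j, b i}"
    then have "(\<forall>u. 0 \<le> x u) \<and> (\<forall>u. u \<notin> {a i, b i, a ?j, b ?j} \<longrightarrow> x u = 0) \<and>
        x (a i) + x (b i) + (x (a ?j) + x (b ?j)) = 1 \<and>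
        (x (b i) = 0 \<or> x (a i) = 0 \<or> x (b ?j) = 0 \<or> x (a ?j) = 0)"
      by (elim UnE) (auto simp: closed_simplex_def ne ne[symmetric])
    moreover from this have "tetra (x (a i) + x (b i)) (x (a i) - x (b i)) (x (a ?j) + x (b ?j)) (x (a ?j) - x (b ?j))"
      by (auto simp: tetra_def abs_le_iff)
    ultimately show "x \<in> cell tetra i"
      by (auto simp: cell_def wt_def df_def star)
  qed
qed

end

section \<open>Collapsing free edges, circles and tori\<close>

text \<open>The retraction \<open>r\<close> takes the smaller of the weights at \<open>e1\<close>
  and \<open>e2\<close> away from both and adds it to \<open>v1\<close> and \<open>v2\<close>, so
  the total is kept and one end of the free edge drops out. By freeness only the term of the
  tetrahedron at hand is nonzero, hence a single global sum defines \<open>r\<close> continuously,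
  and straight lines stay in that tetrahedron.\<close>

lemma collapse_free_edges:
  fixes v1 v2 e1 e2 :: "'i \<Rightarrow> 'v"
  assumes I: "finite I"
    and distinct: "\<And>i. i \<in> I \<Longrightarrow> distinct [v1 i, v2 i, e1 i, e2 i]"
    and free: "\<And>i k. i \<in> I \<Longrightarrow> k \<in> I \<Longrightarrow> {e1 i, e2 i} \<subseteq> {v1 k, v2 k, e1 k, e2 k} \<Longrightarrow> i = k"
  shows "top_of_set (\<Union>i\<in>I. closed_simplex {v1 i, v2 i, e1 i, e2 i}) homotopy_equivalent_space
    top_of_set (\<Union>i\<in>I. closed_simplex {v1 i, v2 i, e1 i} \<union> closed_simplex {v1 i, v2 i, e2 i})"
    (is "top_of_set ?C homotopy_equivalent_space top_of_set ?K")
proof -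
  define \<epsilon> :: "'i \<Rightarrow> 'v \<Rightarrow> real"
    where "\<epsilon> = (\<lambda>i u. if u \<in> {v1 i, v2 i} then 1 else if u \<in> {e1 i, e2 i} then - 1 else 0)"
  define r :: "('v \<Rightarrow> real) \<Rightarrow> 'v \<Rightarrow> real"
    where "r = (\<lambda>x u. x u + (\<Sum>i\<in>I. min (x (e1 i)) (x (e2 i)) * \<epsilon> i u))"
  have KC: "?K \<subseteq> ?C"
    by (intro UN_mono subset_refl Un_least closed_simplex_mono) auto
  have r_eq: "r x u = x u + min (x (e1 i)) (x (e2 i)) * \<epsilon> i u"
    if i: "i \<in> I" and x: "x \<in> closed_simplex {v1 i, v2 i, e1 i, e2 i}" for x u i
  proof -
    have "min (x (e1 k)) (x (e2 k)) = 0" if "k \<in> I" "k \<noteq> i" for k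
    proof -
      have "e1 k \<notin> {v1 i, v2 i, e1 i, e2 i} \<or> e2 k \<notin> {v1 i, v2 i, e1 i, e2 i}"
        using free[of k i] that i by blast
      then have "x (e1 k) = 0 \<or> x (e2 k) = 0"
        using closed_simplexD(2)[OF x] by blast
      then show ?thesis
        using closed_simplexD(1)[OF x] by (auto simp: min_def order_antisym)
    qed
    then have "(\<Sum>k\<in>I. min (x (e1 k)) (x (e2 k)) * \<epsilon> k u) =
        (\<Sum>k\<in>I. if k = i then min (x (e1 i)) (x (e2 i)) * \<epsilon> i u else 0)"
      by (intro sum.cong) auto
    then show ?thesis
      using i I by (simp add: r_def)
  qed
  have r_in: "r x \<in> closed_simplex {v1 i, v2 i, e1 i} \<union> closed_simplex {v1 i, v2 i, e2 i}"
    if i: "i \<in> I" and x: "x \<in> closed_simplex {v1 i, v2 i, e1 i, e2 i}" for x i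
  proof -
    have d: "v1 i \<noteq> v2 i" "v1 i \<noteq> e1 i" "v1 i \<noteq> e2 i" "v2 i \<noteq> e1 i" "v2 i \<noteq> e2 i" "e1 i \<noteq> e2 i"
      using distinct[OF i] by auto
    have nn: "0 \<le> x u" for u
      using closed_simplexD(1)[OF x] .
    have one: "x (v1 i) + x (v2 i) + x (e1 i) + x (e2 i) = 1"
      using closed_simplexD(3)[OF x] d by simp
    define \<mu> where "\<mu> = min (x (e1 i)) (x (e2 i))"
    have \<mu>: "0 \<le> \<mu>" "\<mu> \<le> x (e1 i)" "\<mu> \<le> x (e2 i)" "\<mu> = x (e1 i) \<or> \<mu> = x (e2 i)"
      using nn by (auto simp: \<mu>_def)
    have vals: "r x (v1 i) = x (v1 i) + \<mu>" "r x (v2 i) = x (v2 i) + \<mu>" "r x (e1 i) = x (e1 i) - \<mu>"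
        "r x (e2 i) = x (e2 i) - \<mu>"
      using d d[symmetric] by (simp_all add: r_eq[OF i x] \<mu>_def \<epsilon>_def)
    have out: "r x u = 0" if "u \<notin> {v1 i, v2 i, e1 i, e2 i}" for u
      using that closed_simplexD(2)[OF x] by (simp add: r_eq[OF i x] \<epsilon>_def)
    have r_nn: "0 \<le> r x u" for u
    proof (cases "u \<in> {v1 i, v2 i, e1 i, e2 i}")
      case True
      then show ?thesis
        using vals nn[of "v1 i"] nn[of "v2 i"] \<mu> by auto
    qed (simp add: out)
    have one': "r x (v1 i) + r x (v2 i) + r x (e1 i) + r x (e2 i) = 1"
      using one unfolding vals by linarith
    show ?thesis
    proof (cases "\<mu> = x (e1 i)")
      case True
      then have "r x (e1 i) = 0"
        by (simp add: vals)
      then have "r x \<in> closed_simplex {v1 i, v2 i, e2 i}"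
        using r_nn one' out d by (auto simp: closed_simplex_def)
      then show ?thesis by blast
    next
      case False
      then have "r x (e2 i) = 0"
        using \<mu> by (simp add: vals)
      then have "r x \<in> closed_simplex {v1 i, v2 i, e1 i}"
        using r_nn one' out d by (auto simp: closed_simplex_def)
      then show ?thesis by blast
    qed
  qed
  have r_id: "r x = x" if x: "x \<in> ?K" for x
  proof -
    obtain i where i: "i \<in> I" and x': "x \<in> closed_simplex {v1 i, v2 i, e1 i} \<or> x \<in> closed_simplex {v1 i, v2 i, e2 i}"
      using x by blast
    have "closed_simplex {v1 i, v2 i, e1 i} \<union> closed_simplex {v1 i, v2 i, e2 i}
        \<subseteq> closed_simplex {v1 i, v2 i, e1 i, e2 i}"
      by (intro Un_least closed_simplex_mono) auto
    then have xi: "x \<in> closed_simplex {v1 i, v2 i, e1 i, e2 i}"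
      using x' by blast
    have "x (e1 i) = 0 \<or> x (e2 i) = 0"
      using x' distinct[OF i] closed_simplexD(2)[of x] by (elim disjE) auto
    then have "min (x (e1 i)) (x (e2 i)) = 0"
      using closed_simplexD(1)[OF xi] by (auto simp: min_def order_antisym)
    then show ?thesis
      using r_eq[OF i xi] by auto
  qed
  have r_cont: "continuous_on S r" for S
  proof -
    have coord: "continuous_on S (\<lambda>x. x u :: real)" for u :: 'v
      by (rule continuous_on_subset[OF continuous_on_product_coordinates]) simp
    show ?thesis
      unfolding r_def by (intro continuous_on_coordinatewise_then_product continuous_intros coord)
  qed
  have r_img: "r x \<in> ?K" if "x \<in> ?C" for x
    using that r_in by blast
  have hom: "homotopic_with_canon (\<lambda>_. True) ?C ?C (id \<circ> r) id"
  proof (rule homotopic_straight_line)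
    show "continuous_on ?C (id \<circ> r)"
      using r_cont by (simp add: comp_def)
    fix x and t :: real assume x: "x \<in> ?C" and t: "0 \<le> t" "t \<le> 1"
    then obtain i where i: "i \<in> I" and xi: "x \<in> closed_simplex {v1 i, v2 i, e1 i, e2 i}"
      by blast
    have "closed_simplex {v1 i, v2 i, e1 i} \<union> closed_simplex {v1 i, v2 i, e2 i}
        \<subseteq> closed_simplex {v1 i, v2 i, e1 i, e2 i}"
      by (intro Un_least closed_simplex_mono) auto
    then have "r x \<in> closed_simplex {v1 i, v2 i, e1 i, e2 i}"
      using r_in[OF i xi] by blast
    from closed_simplex_convex[OF this xi t] i
    show "(\<lambda>v. (1 - t) * (id \<circ> r) x v + t * id x v) \<in> ?C"
      by auto
  qed (auto simp: continuous_on_id)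
  show ?thesis
    unfolding homotopy_equivalent_space_def
  proof (intro exI conjI)
    have incl: "continuous_map (top_of_set A) (top_of_set B) id" if "A \<subseteq> B" for A B :: "('v \<Rightarrow> real) set"
      using that by (auto simp: continuous_map_in_subtopology)
    show r: "continuous_map (top_of_set ?C) (top_of_set ?K) r"
      using r_cont r_img by (auto simp: continuous_map_in_subtopology)
    show i: "continuous_map (top_of_set ?K) (top_of_set ?C) id"
      by (rule incl[OF KC])
    show "homotopic_with (\<lambda>x. True) (top_of_set ?C) (top_of_set ?C) (id \<circ> r) id"
      by (rule hom)
    show "homotopic_with (\<lambda>x. True) (top_of_set ?K) (top_of_set ?K) (r \<circ> id) id"
      using continuous_map_compose[OF i r] r_id by (intro homotopic_with_equal) simp_all
  qed
qed

text \<open>The linear B-spline: on the line its integer translates form a partition of unity and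
  reproduce affine functions, as \<open>lattice_model\<close> demands of
  \<open>\<phi>\<close>.\<close>

definition hat :: "real \<Rightarrow> real" where "hat x = max 0 (1 - \<bar>x\<bar>)"

lemma hat_nonneg: "0 \<le> hat x"
  by (simp add: hat_def)

lemma continuous_on_hat: "continuous_on S hat"
  unfolding hat_def by (intro continuous_intros)

lemma hat_neq_0: "hat x \<noteq> 0 \<longleftrightarrow> \<bar>x\<bar> < 1"
  by (auto simp: hat_def)

section \<open>Windows on a circle\<close>

lemma cis_2pi_eq_iff: "cis (2 * pi * x) = cis (2 * pi * y) \<longleftrightarrow> x - y \<in> \<int>"
proof -
  have "cis (2 * pi * x) = cis (2 * pi * y) \<longleftrightarrow> (\<exists>k::int. 2 * pi * x = 2 * pi * y + 2 * pi * k)"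
    by (metis cis.sel(1,2) complex_eq_iff sin_cos_eq_iff)
  also have "\<dots> \<longleftrightarrow> (\<exists>k::int. x - y = of_int k)"
  proof -
    have "2 * pi * x = 2 * pi * y + 2 * pi * k \<longleftrightarrow> 2 * pi * (x - y) = 2 * pi * k" for k :: real
      by (auto simp: algebra_simps)
    then show ?thesis
      by simp
  qed
  finally show ?thesis
    by (auto simp: Ints_def)
qed

lemma cis_2pi_surj:
  assumes "z \<in> sphere (0::complex) 1"
  obtains x where "z = cis (2 * pi * x)"
proof -
  have "z = cis (2 * pi * (Arg z / (2 * pi)))"
    using assms cis_Arg[of z] by (cases "z = 0") (auto simp: sgn_eq)
  then show ?thesis
    by (rule that)
qed

text \<open>Each tetrahedron is replaced by an interval of length 3 on the circle obtained from the
  real line modulo \<open>m\<close>.\<close>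

lemma cyclic_windows_homotopy_equivalent_circle:
  fixes lab :: "int \<Rightarrow> 'v"
  assumes m: "7 \<le> m" and lab: "\<And>a b. lab a = lab b \<longleftrightarrow> m dvd a - b"
  shows "top_of_set (\<Union>k. closed_simplex (lab ` {k..k+3})) homotopy_equivalent_space nsphere 1"
proof -
  define V :: "int \<Rightarrow> real set" where "V = (\<lambda>k. of_int ` {k..k+3})"
  define L :: "real set" where "L = range (\<lambda>k. of_int (m * k))"
  define E :: "real \<Rightarrow> complex" where "E = (\<lambda>y. cis (2 * pi * (y / m)))"
  \<comment> \<open>The constant 6 is 3 + 3: two coincidences of labels between the same two windows
    involve positions at most 3 apart in either window. With \<open>7 \<le> m\<close> both therefore
    come from the same translation.\<close>
  have small: "d = 0" if "m dvd d" "\<bar>d\<bar> \<le> 6" for d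
    using that m dvd_imp_le_int[of d m] by fastforce
  have V_expl: "V k = {of_int k, of_int k + 1, of_int k + 2, of_int k + 3}" for k
  proof -
    have "{k..k+3} = {k, k+1, k+2, k+3}"
      by auto
    then show ?thesis
      by (simp add: V_def)
  qed
  have hull: "convex hull V k \<subseteq> {of_int k..of_int k + 3}" for k
    by (rule hull_minimal) (auto simp: V_expl)
  have E_eq: "E x = E y \<longleftrightarrow> x - y \<in> L" for x y
  proof -
    have "E x = E y \<longleftrightarrow> (x - y) / m \<in> \<int>"
      unfolding E_def cis_2pi_eq_iff by (simp add: diff_divide_distrib)
    also have "\<dots> \<longleftrightarrow> x - y \<in> L"
      using m by (auto simp: L_def Ints_def field_simps image_iff)
    finally show ?thesis .
  qed
  interpret LM: lattice_model \<int> "\<lambda>x. lab \<lfloor>x\<rfloor>" "{0..<m}" V hat E L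
  proof
    show "inj_on (\<lambda>x. lab \<lfloor>x\<rfloor>) (V k)" for k
    proof (rule inj_onI)
      fix x y assume "x \<in> V k" "y \<in> V k" "lab \<lfloor>x\<rfloor> = lab \<lfloor>y\<rfloor>"
      then show "x = y"
        using small[of "\<lfloor>x\<rfloor> - \<lfloor>y\<rfloor>"] by (auto simp: V_def lab)
    qed
    show "u \<in> V k" if "y \<in> convex hull V k" "u \<in> \<int>" "hat (y - u) \<noteq> 0" for k y u
    proof -
      obtain a where "u = of_int a"
        using \<open>u \<in> \<int>\<close> Ints_cases by blast
      moreover have "of_int k - 1 < u" "u < of_int k + 4"
        using that(3) subsetD[OF hull that(1)] by (auto simp: hat_neq_0)
      ultimately have "k \<le> a" "a \<le> k + 3"
        by linarith+
      then show ?thesis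
        using \<open>u = of_int a\<close> by (auto simp: V_def)
    qed
    show "(\<Sum>u\<in>V k. hat (y - u)) = 1" and "(\<Sum>u\<in>V k. hat (y - u) *\<^sub>R u) = y"
      if "y \<in> convex hull V k" for k y
    proof -
      define x where "x = y - of_int k"
      have x: "0 \<le> x" "x \<le> 3" and y: "y = of_int k + x"
        using subsetD[OF hull that] by (auto simp: x_def)
      consider "x \<le> 1" | "1 \<le> x" "x \<le> 2" | "2 \<le> x"
        by linarith
      then have *: "hat x + hat (x - 1) + hat (x - 2) + hat (x - 3) = 1 \<and>
          hat (x - 1) + hat (x - 2) * 2 + hat (x - 3) * 3 = x"
        using x by cases (auto simp: hat_def)
      have eq: "y - of_int k = x" "y - (of_int k + c) = x - c" "y - (c + of_int k) = x - c" for c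
        by (simp_all add: y)
      show "(\<Sum>u\<in>V k. hat (y - u)) = 1"
        using * by (simp add: V_expl eq)
      have "(\<Sum>u\<in>V k. hat (y - u) *\<^sub>R u) =
          (hat x + hat (x - 1) + hat (x - 2) + hat (x - 3)) * of_int k +
          (hat (x - 1) + hat (x - 2) * 2 + hat (x - 3) * 3)"
        by (simp add: V_expl eq algebra_simps)
      then show "(\<Sum>u\<in>V k. hat (y - u) *\<^sub>R u) = y"
        using * y by simp
    qed
    show "\<exists>\<tau>\<in>L. \<forall>u\<in>V j. \<forall>u'\<in>V k. lab \<lfloor>u\<rfloor> = lab \<lfloor>u'\<rfloor> \<longrightarrow> u' = u + \<tau>" for j k
    proof (cases "\<exists>a\<in>{j..j+3}. \<exists>b\<in>{k..k+3}. m dvd b - a")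
      case True
      then obtain a b where ab: "a \<in> {j..j+3}" "b \<in> {k..k+3}" "m dvd b - a"
        by blast
      have "d - c = b - a" if "c \<in> {j..j+3}" "d \<in> {k..k+3}" "m dvd d - c" for c d
        using small[of "(d - c) - (b - a)"] ab that by (auto simp: dvd_diff)
      then have "real_of_int d = real_of_int c + real_of_int (b - a)"
        if "c \<in> {j..j+3}" "d \<in> {k..k+3}" "m dvd d - c" for c d
        using that by (smt (verit) of_int_add)
      moreover have "real_of_int (b - a) \<in> L"
        using ab(3) unfolding L_def by (metis dvdE rangeI)
      ultimately show ?thesis
        by (intro bexI[of _ "real_of_int (b - a)"]) (auto simp: V_def lab dvd_diff_commute)
    next
      case False
      then show ?thesis
        by (intro bexI[of _ 0]) (auto simp: V_def L_def lab dvd_diff_commute image_iff)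
    qed
    show "u + \<tau> \<in> \<int> \<and> lab \<lfloor>u + \<tau>\<rfloor> = lab \<lfloor>u\<rfloor>" if \<tau>u: "\<tau> \<in> L" "u \<in> \<int>" for u \<tau>
    proof -
      obtain k where "\<tau> = of_int (m * k)"
        using \<tau>u(1) unfolding L_def by blast
      moreover obtain a where "u = of_int a"
        using \<tau>u(2) Ints_cases by blast
      ultimately have "u + \<tau> = of_int (a + m * k)" "u = of_int a"
        by auto
      then show ?thesis
        by (simp only: floor_of_int lab) simp
    qed
    show "continuous_on UNIV E"
      unfolding E_def using m by (intro continuous_intros) auto
  qed (use E_eq in \<open>auto simp: V_def hat_nonneg intro: continuous_on_hat\<close>)
  have lab_V: "(\<lambda>x. lab \<lfloor>x\<rfloor>) ` V k = lab ` {k..k+3}" for k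
    by (auto simp: V_def image_image)
  \<comment> \<open>\<open>lattice_model\<close> needs finitely many windows, while the union runs
    over all integers; shifting a window by a multiple of \<open>m\<close> does not change its
    labels.\<close>
  have mod_lab: "lab ` {k..k+3} = lab ` {k mod m..k mod m+3}" for k
  proof -
    have "lab (k + i) = lab (k mod m + i)" for i
      by (simp add: lab minus_mod_eq_mult_div)
    moreover have "{c..c+3} = (+) c ` {0..3}" for c :: int
      by simp
    ultimately show ?thesis
      by (simp add: image_image del: image_add_atLeastAtMost)
  qed
  have C: "LM.C = (\<Union>k. closed_simplex (lab ` {k..k+3}))"
  proof (intro equalityI subsetI)
    fix x assume "x \<in> (\<Union>k. closed_simplex (lab ` {k..k+3}))"
    then obtain k where "x \<in> closed_simplex (lab ` {k mod m..k mod m+3})"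
      using mod_lab by auto
    moreover have "k mod m \<in> {0..<m}"
      using m by simp
    ultimately show "x \<in> LM.C"
      unfolding LM.C_def lab_V by blast
  qed (auto simp: LM.C_def lab_V)
  have "E ` LM.windows = sphere 0 1"
  proof (intro equalityI subsetI)
    fix z :: complex assume "z \<in> sphere 0 1"
    then obtain x where z: "z = cis (2 * pi * x)"
      by (rule cis_2pi_surj)
    define y where "y = frac x * m"
    have "y / m - x = of_int (- \<lfloor>x\<rfloor>)"
      using m by (simp add: y_def frac_def)
    then have "y / m - x \<in> \<int>"
      by (metis Ints_of_int)
    then have zy: "z = E y"
      unfolding z E_def by (subst eq_commute) (simp only: cis_2pi_eq_iff)
    have y: "0 \<le> y" "y < m"
      using m frac_lt_1[of x] frac_ge_0[of x] by (auto simp: y_def)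
    then have k: "\<lfloor>y\<rfloor> \<in> {0..<m}"
      by (auto simp: floor_less_iff)
    have "y \<in> closed_segment (of_int \<lfloor>y\<rfloor>) (of_int \<lfloor>y\<rfloor> + 1)"
      by (simp add: closed_segment_eq_real_ivl)
    also have "\<dots> \<subseteq> convex hull V \<lfloor>y\<rfloor>"
      by (intro closed_segment_subset_convex_hull hull_inc) (auto simp: V_expl)
    finally have "y \<in> LM.windows"
      unfolding LM.windows_def by (rule UN_I[OF k])
    then show "z \<in> E ` LM.windows"
      using zy by blast
  qed (auto simp: E_def)
  then have "top_of_set (\<Union>k. closed_simplex (lab ` {k..k+3})) homotopy_equivalent_space top_of_set (sphere (0::complex) 1)"
    using LM.homotopy_equivalent C by simp
  also have "top_of_set (sphere (0::complex) 1) homotopy_equivalent_space nsphere 1"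
    by (rule homeomorphic_imp_homotopy_equivalent_space[OF circle_homeomorphic_nsphere])
  finally show ?thesis .
qed

text \<open>
  The lattice of all \<open>(a, b)\<close> with \<open>n dvd a * p + b * q\<close> has a basis of the form \<open>(d, e), (0, h)\<close>.
\<close>

lemma torus_covering:
  fixes n p q :: int
  assumes n: "0 < n"
  obtains E :: "real \<times> real \<Rightarrow> complex \<times> complex" where
    "continuous_on UNIV E"
    "\<And>x y. E x = E y \<longleftrightarrow> (\<exists>a b. x - y = (of_int a, of_int b) \<and> n dvd a * p + b * q)"
    "range E = sphere 0 1 \<times> sphere 0 1"
proof -
  \<comment> \<open>Hermite normal form: \<open>h\<close> generates the relations with first
    coordinate 0, and \<open>d\<close> is the least positive first coordinate of any relation,
    completed by some \<open>e\<close>. Both exist because \<open>n\<close> itself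
    qualifies.\<close>
  define h where "h = (LEAST h. 0 < h \<and> n dvd int h * q)"
  define d where "d = (LEAST d. 0 < d \<and> (\<exists>e. n dvd int d * p + e * q))"
  have h: "0 < h" "n dvd int h * q"
    using LeastI[of "\<lambda>h. 0 < h \<and> n dvd int h * q" "nat n"] n by (auto simp: h_def)
  have "0 < d \<and> (\<exists>e. n dvd int d * p + e * q)"
    unfolding d_def by (rule LeastI[of _ "nat n"]) (use n in \<open>auto intro!: exI[of _ 0]\<close>)
  then obtain e where d: "0 < d" and e: "n dvd int d * p + e * q"
    by blast
  have basis: "n dvd a * p + b * q \<longleftrightarrow> (\<exists>k l. a = k * int d \<and> b = k * e + l * int h)" for a b
  proof
    assume ab: "n dvd a * p + b * q"
    define k where "k = a div int d"
    have "a - k * d = a mod int d"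
      by (simp add: k_def minus_div_mult_eq_mod)
    then have r: "0 \<le> a - k * d" "a - k * d < d"
      using d by auto
    have kd: "n dvd (a - k * d) * p + (b - k * e) * q"
    proof -
      have "(a - k * d) * p + (b - k * e) * q = (a * p + b * q) - k * (d * p + e * q)"
        by (simp add: algebra_simps)
      then show ?thesis
        using ab e by (simp add: dvd_diff)
    qed
    have "a - k * d = 0"
    proof (rule ccontr)
      assume "a - k * d \<noteq> 0"
      then have "0 < nat (a - k * d) \<and> (\<exists>e. n dvd int (nat (a - k * d)) * p + e * q)"
        using r kd by auto
      then have "d \<le> nat (a - k * d)"
        unfolding d_def by (rule Least_le)
      then show False
        using r by linarith
    qed
    define l where "l = (b - k * e) div int h"
    have "b - k * e - l * h = (b - k * e) mod int h"
      by (simp add: l_def minus_div_mult_eq_mod)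
    then have r: "0 \<le> b - k * e - l * h" "b - k * e - l * h < h"
      using h by auto
    have "n dvd (b - k * e) * q"
      using kd \<open>a - k * d = 0\<close> by simp
    moreover have "(b - k * e - l * h) * q = (b - k * e) * q - l * (h * q)"
      by (simp add: algebra_simps)
    ultimately have lh: "n dvd (b - k * e - l * h) * q"
      using h by (simp add: dvd_diff)
    have "b - k * e - l * h = 0"
    proof (rule ccontr)
      assume "b - k * e - l * h \<noteq> 0"
      then have "0 < nat (b - k * e - l * h) \<and> n dvd int (nat (b - k * e - l * h)) * q"
        using r lh by auto
      then have "h \<le> nat (b - k * e - l * h)"
        unfolding h_def by (rule Least_le)
      then show False
        using r by linarith
    qed
    then show "\<exists>k l. a = k * int d \<and> b = k * e + l * int h"
      using \<open>a - k * d = 0\<close> by (intro exI[of _ k] exI[of _ l]) linarith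
  next
    assume "\<exists>k l. a = k * int d \<and> b = k * e + l * int h"
    then obtain k l where "a = k * int d" "b = k * e + l * int h"
      by blast
    then have "a * p + b * q = k * (d * p + e * q) + l * (h * q)"
      by (simp add: algebra_simps)
    then show "n dvd a * p + b * q"
      using e h by simp
  qed
  \<comment> \<open>The two angles are the coordinates with respect to the basis:
    \<open>(u, v) = k * (d, e) + l * (0, h)\<close> gives \<open>k = u / d\<close> and
    \<open>l = (v - e * u / d) / h\<close>.\<close>
  define E :: "real \<times> real \<Rightarrow> complex \<times> complex" where
    "E = (\<lambda>x. (cis (2 * pi * (fst x / real d)),
      cis (2 * pi * ((snd x - real_of_int e * fst x / real d) / real h))))"
  show ?thesis
  proof (rule that)
    show "continuous_on UNIV E"
      unfolding E_def using d h by (intro continuous_intros) auto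
    show "E x = E y \<longleftrightarrow> (\<exists>a b. x - y = (of_int a, of_int b) \<and> n dvd a * p + b * q)" for x y
    proof -
      obtain u v where uv: "x - y = (u, v)"
        by (cases "x - y")
      then have u: "fst x = fst y + u" and v: "snd x = snd y + v"
        by (auto simp: prod_eq_iff)
      have "E x = E y \<longleftrightarrow> u / d \<in> \<int> \<and> (v - e * u / d) / h \<in> \<int>"
      proof -
        have "(fst x) / d - (fst y) / d = u / d"
          by (simp add: u add_divide_distrib)
        moreover have "(snd x - e * fst x / d) / h - (snd y - e * fst y / d) / h = (v - e * u / d) / h"
          unfolding u v by (simp add: field_simps flip: diff_divide_distrib)
        ultimately show ?thesis
          unfolding E_def prod.inject cis_2pi_eq_iff by simp
      qed
      also have "\<dots> \<longleftrightarrow> (\<exists>k l :: int. u = of_int (k * int d) \<and> v = of_int (k * e + l * int h))"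
      proof
        assume "u / d \<in> \<int> \<and> (v - e * u / d) / h \<in> \<int>"
        then obtain k l :: int where "u / d = k" "(v - e * u / d) / h = l"
          by (auto elim!: Ints_cases)
        then have "u = k * d" "v - e * (u / d) = l * h"
          using d h by (auto simp: field_simps)
        then have "u = k * d" "v = k * e + l * h"
          using \<open>u / d = k\<close> by (auto simp: algebra_simps)
        then have "u = of_int (k * int d) \<and> v = of_int (k * e + l * int h)"
          by simp
        then show "\<exists>k l :: int. u = of_int (k * int d) \<and> v = of_int (k * e + l * int h)"
          by blast
      qed (use d h in auto)
      also have "\<dots> \<longleftrightarrow> (\<exists>a b. x - y = (of_int a, of_int b) \<and> n dvd a * p + b * q)"
        unfolding uv basis prod.inject by blast
      finally show ?thesis .
    qed
    show "range E = sphere 0 1 \<times> sphere 0 1"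
    proof (intro equalityI subsetI)
      fix z :: "complex \<times> complex" assume "z \<in> sphere 0 1 \<times> sphere 0 1"
      then have "fst z \<in> sphere 0 1" "snd z \<in> sphere 0 1"
        by auto
      then obtain x y where xy: "fst z = cis (2 * pi * x)" "snd z = cis (2 * pi * y)"
        by (metis cis_2pi_surj)
      have "E (d * x, h * y + e * x) = z"
        using d h xy by (simp add: E_def prod_eq_iff mult.assoc)
      then show "z \<in> range E"
        by (metis rangeI)
    qed (auto simp: E_def)
  qed
qed

text \<open>Two coincidences of labels between the same two unit squares by different translations
  would differ by a relation with coefficients at most 1 + 1 = 2. Excluding these makes the lifts
  compatible and each square injectively labelled. The function \<open>\<phi>\<close> is the product
  of two tents.\<close>

lemma square_windows_homotopy_equivalent_torus:
  fixes lab :: "int \<Rightarrow> int \<Rightarrow> 'v" and n p q :: int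
  assumes n: "0 < n"
    and lab: "\<And>a b a' b'. lab a b = lab a' b' \<longleftrightarrow> n dvd (a - a') * p + (b - b') * q"
    and small: "\<And>a b. \<bar>a\<bar> \<le> 2 \<Longrightarrow> \<bar>b\<bar> \<le> 2 \<Longrightarrow> n dvd a * p + b * q \<Longrightarrow> a = 0 \<and> b = 0"
  shows "top_of_set (\<Union>a b. closed_simplex {lab a b, lab (a + 1) b, lab a (b + 1), lab (a + 1) (b + 1)})
    homotopy_equivalent_space top_of_set (sphere (0::complex) 1 \<times> sphere (0::complex) 1)"
proof -
  obtain E :: "real \<times> real \<Rightarrow> complex \<times> complex" where E: "continuous_on UNIV E"
    "\<And>x y. E x = E y \<longleftrightarrow> (\<exists>a b. x - y = (of_int a, of_int b) \<and> n dvd a * p + b * q)"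
    "range E = sphere 0 1 \<times> sphere 0 1"
    using torus_covering[OF n] by metis
  define W :: "int \<Rightarrow> real set" where "W = (\<lambda>k. {of_int k, of_int k + 1})"
  define V :: "int \<times> int \<Rightarrow> (real \<times> real) set" where "V = (\<lambda>k. W (fst k) \<times> W (snd k))"
  define L :: "(real \<times> real) set"
    where "L = {x. \<exists>a b. x = (of_int a, of_int b) \<and> n dvd a * p + b * q}"
  define \<phi> :: "real \<times> real \<Rightarrow> real" where "\<phi> = (\<lambda>x. hat (fst x) * hat (snd x))"
  define lab' :: "real \<times> real \<Rightarrow> 'v" where "lab' = (\<lambda>x. lab \<lfloor>fst x\<rfloor> \<lfloor>snd x\<rfloor>)"
  have hullW: "convex hull W k = {of_int k..of_int k + 1}" for k
    by (simp add: W_def closed_segment_eq_real_ivl flip: segment_convex_hull)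
  have hull: "convex hull V k = (convex hull W (fst k)) \<times> (convex hull W (snd k))" for k
    unfolding V_def by (rule convex_hull_Times)
  have W_int: "u \<in> W k \<longleftrightarrow> (\<exists>a\<in>{k..k+1}. u = of_int a)" for u k
  proof -
    have "{k..k+1} = {k, k+1}" by auto
    then show ?thesis by (auto simp: W_def)
  qed
  have hat_W: "u \<in> W k" if "x \<in> convex hull W k" "u \<in> \<int>" "hat (x - u) \<noteq> 0" for x u k
  proof -
    obtain a where u: "u = of_int a"
      using \<open>u \<in> \<int>\<close> Ints_cases by blast
    moreover have "of_int k - 1 < u" "u < of_int k + 2"
      using that(1,3) by (auto simp: hat_neq_0 hullW)
    ultimately have "k \<le> a" "a \<le> k + 1"
      by linarith+
    then show ?thesis
      using u by (auto simp: W_int)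
  qed
  have sum_W: "(\<Sum>u\<in>W k. hat (x - u)) = 1" "(\<Sum>u\<in>W k. hat (x - u) * u) = x"
    if "x \<in> convex hull W k" for x k
  proof -
    have "hat (x - of_int k) = 1 - (x - of_int k)" "hat (x - (of_int k + 1)) = x - of_int k"
      using that by (auto simp: hat_def hullW)
    then show "(\<Sum>u\<in>W k. hat (x - u)) = 1" "(\<Sum>u\<in>W k. hat (x - u) * u) = x"
      by (simp_all add: W_def) (simp add: algebra_simps)
  qed
  interpret LM: lattice_model "\<int> \<times> \<int>" lab' "{0..<n} \<times> {0..<n}" V \<phi> E L
  proof
    show "inj_on lab' (V k)" for k
    proof (rule inj_onI)
      fix x y assume x: "x \<in> V k" and y: "y \<in> V k" and eq: "lab' x = lab' y"
      obtain a b c d where ab: "x = (of_int a, of_int b)" "a \<in> {fst k..fst k + 1}" "b \<in> {snd k..snd k + 1}"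
        and cd: "y = (of_int c, of_int d)" "c \<in> {fst k..fst k + 1}" "d \<in> {snd k..snd k + 1}"
        using x y by (auto simp: V_def W_int)
      have "n dvd (a - c) * p + (b - d) * q"
        using eq ab(1) cd(1) by (simp add: lab'_def lab)
      then show "x = y"
        using small[of "a - c" "b - d"] ab cd by auto
    qed
    show "u \<in> V k" if "y \<in> convex hull V k" "u \<in> \<int> \<times> \<int>" "\<phi> (y - u) \<noteq> 0" for k y u
    proof -
      have "fst y \<in> convex hull W (fst k)" "snd y \<in> convex hull W (snd k)"
        using that(1) unfolding hull by auto
      then show ?thesis
        using that(2,3) hat_W by (auto simp: \<phi>_def V_def)
    qed
    show "(\<Sum>u\<in>V k. \<phi> (y - u)) = 1" and "(\<Sum>u\<in>V k. \<phi> (y - u) *\<^sub>R u) = y"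
      if yV: "y \<in> convex hull V k" for k y
    proof -
      obtain x z where y: "y = (x, z)" and x: "x \<in> convex hull W (fst k)" and z: "z \<in> convex hull W (snd k)"
        using yV unfolding hull by auto
      have sum_V: "(\<Sum>u\<in>V k. f (fst u) * g (snd u)) = (\<Sum>u\<in>W (fst k). f u) * (\<Sum>u\<in>W (snd k). g u)"
        for f g :: "real \<Rightarrow> real"
        unfolding V_def sum_product by (simp add: sum.cartesian_product case_prod_unfold)
      show "(\<Sum>u\<in>V k. \<phi> (y - u)) = 1"
        using sum_V[of "\<lambda>u. hat (x - u)" "\<lambda>u. hat (z - u)"] sum_W[OF x] sum_W[OF z]
        by (simp add: \<phi>_def y)
      have "fst (\<Sum>u\<in>V k. \<phi> (y - u) *\<^sub>R u) = x"
        using sum_V[of "\<lambda>u. hat (x - u) * u" "\<lambda>u. hat (z - u)"] sum_W[OF x] sum_W[OF z]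
        by (simp add: \<phi>_def y fst_sum mult_ac)
      moreover have "snd (\<Sum>u\<in>V k. \<phi> (y - u) *\<^sub>R u) = z"
        using sum_V[of "\<lambda>u. hat (x - u)" "\<lambda>u. hat (z - u) * u"] sum_W[OF x] sum_W[OF z]
        by (simp add: \<phi>_def y snd_sum mult_ac)
      ultimately show "(\<Sum>u\<in>V k. \<phi> (y - u) *\<^sub>R u) = y"
        by (simp add: y prod_eq_iff)
    qed
    show "\<exists>\<tau>\<in>L. \<forall>u\<in>V j. \<forall>u'\<in>V k. lab' u = lab' u' \<longrightarrow> u' = u + \<tau>" for j k
    proof (cases "\<exists>u\<in>V j. \<exists>u'\<in>V k. lab' u = lab' u'")
      case True
      then obtain a b c d where ab: "a \<in> {fst j..fst j + 1}" "b \<in> {snd j..snd j + 1}"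
        and cd: "c \<in> {fst k..fst k + 1}" "d \<in> {snd k..snd k + 1}"
        and eq: "n dvd (c - a) * p + (d - b) * q"
        by (auto simp: V_def W_int lab'_def) (metis lab)
      have "(of_int (c - a), of_int (d - b)) \<in> L"
        using eq unfolding L_def by blast
      moreover have "u' = u + (of_int (c - a), of_int (d - b))"
        if "u \<in> V j" "u' \<in> V k" "lab' u = lab' u'" for u u'
      proof -
        obtain a' b' c' d' where ab': "a' \<in> {fst j..fst j + 1}" "b' \<in> {snd j..snd j + 1}"
          and cd': "c' \<in> {fst k..fst k + 1}" "d' \<in> {snd k..snd k + 1}"
          and u: "u = (of_int a', of_int b')" "u' = (of_int c', of_int d')"
          using \<open>u \<in> V j\<close> \<open>u' \<in> V k\<close> by (auto simp: V_def W_int)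
        have "lab c' d' = lab a' b'"
          using that(3) u by (simp add: lab'_def)
        then have eq': "n dvd (c' - a') * p + (d' - b') * q"
          by (simp add: lab)
        have "((c' - a') - (c - a)) * p + ((d' - b') - (d - b)) * q =
            ((c' - a') * p + (d' - b') * q) - ((c - a) * p + (d - b) * q)"
          by (simp add: algebra_simps)
        then have "n dvd ((c' - a') - (c - a)) * p + ((d' - b') - (d - b)) * q"
          using eq eq' by (simp add: dvd_diff)
        then have "c' - a' = c - a \<and> d' - b' = d - b"
          using small[of "(c' - a') - (c - a)" "(d' - b') - (d - b)"] ab cd ab' cd' by auto
        then have "c' = a' + (c - a)" "d' = b' + (d - b)"
          by auto
        then show ?thesis
          by (simp add: u)
      qed
      ultimately show ?thesis
        by blast
    next
      case False
      have "(0, 0) \<in> L"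
        unfolding L_def by (auto intro!: exI[of _ 0])
      then show ?thesis
        using False by blast
    qed
    show "u + \<tau> \<in> \<int> \<times> \<int> \<and> lab' (u + \<tau>) = lab' u" if \<tau>u: "\<tau> \<in> L" "u \<in> \<int> \<times> \<int>" for u \<tau>
    proof -
      obtain a b c d where \<tau>: "\<tau> = (of_int a, of_int b)" "n dvd a * p + b * q"
        and u: "u = (of_int c, of_int d)"
        using \<tau>u by (auto simp: L_def elim!: Ints_cases)
      then have "u + \<tau> = (of_int (c + a), of_int (d + b))"
        by auto
      then show ?thesis
        using \<tau>(2) unfolding u lab'_def fst_conv snd_conv floor_of_int lab by auto
    qed
    show "continuous_on UNIV \<phi>"
      unfolding \<phi>_def
      by (intro continuous_intros continuous_on_compose2[OF continuous_on_hat[of UNIV]]) auto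
  qed (use E in \<open>auto simp: V_def W_def L_def \<phi>_def hat_nonneg\<close>)
  have lab_V: "lab' ` V (a, b) = {lab a b, lab (a + 1) b, lab a (b + 1), lab (a + 1) (b + 1)}" for a b
    by (auto simp: V_def W_def lab'_def)
  have C: "LM.C = (\<Union>a b. closed_simplex {lab a b, lab (a + 1) b, lab a (b + 1), lab (a + 1) (b + 1)})"
  proof (intro equalityI subsetI)
    fix x assume "x \<in> LM.C"
    then obtain a b where "x \<in> closed_simplex (lab' ` V (a, b))"
      by (auto simp: LM.C_def)
    then show "x \<in> (\<Union>a b. closed_simplex {lab a b, lab (a + 1) b, lab a (b + 1), lab (a + 1) (b + 1)})"
      unfolding lab_V by blast
  next
    fix x assume "x \<in> (\<Union>a b. closed_simplex {lab a b, lab (a + 1) b, lab a (b + 1), lab (a + 1) (b + 1)})"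
    then obtain a b where x: "x \<in> closed_simplex {lab a b, lab (a + 1) b, lab a (b + 1), lab (a + 1) (b + 1)}"
      by blast
    have "lab (a + i) (b + j) = lab (a mod n + i) (b mod n + j)" for i j
      unfolding lab by (simp add: minus_mod_eq_mult_div)
    note this[of 0 0] this[of 1 0] this[of 0 1] this[of 1 1]
    then have "x \<in> closed_simplex (lab' ` V (a mod n, b mod n))"
      using x unfolding lab_V by simp
    moreover have "(a mod n, b mod n) \<in> {0..<n} \<times> {0..<n}"
      using n by simp
    ultimately show "x \<in> LM.C"
      unfolding LM.C_def by (rule UN_I[rotated])
  qed
  have "E ` LM.windows = range E"
  proof (intro equalityI subsetI)
    fix z assume "z \<in> range E"
    then obtain x y where z: "z = E (x, y)"
      by auto
    \<comment> \<open>Reduction modulo \<open>n\<close> in each coordinate: every pair of multiples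
      of \<open>n\<close> is a relation, so the \<open>n\<close> by \<open>n\<close> block of
      squares covers the torus.\<close>
    define red where "red = (\<lambda>x::real. x - n * \<lfloor>x / n\<rfloor>)"
    have red: "0 \<le> red x" "red x < n" for x
    proof -
      have "red x = n * frac (x / n)"
        using n by (simp add: red_def frac_def right_diff_distrib)
      then show "0 \<le> red x" "red x < n"
        using n frac_lt_1[of "x / n"] by simp_all
    qed
    have "E (x, y) = E (red x, red y)"
      unfolding E(2)
      by (intro exI[of _ "n * \<lfloor>x / n\<rfloor>"] exI[of _ "n * \<lfloor>y / n\<rfloor>"]) (simp add: red_def)
    moreover have "(red x, red y) \<in> LM.windows"
    proof -
      have "(red x, red y) \<in> convex hull V (\<lfloor>red x\<rfloor>, \<lfloor>red y\<rfloor>)"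
        unfolding hull hullW by (auto simp: less_imp_le)
      moreover have "(\<lfloor>red x\<rfloor>, \<lfloor>red y\<rfloor>) \<in> {0..<n} \<times> {0..<n}"
        using red by (auto simp: floor_less_iff)
      ultimately show ?thesis
        unfolding LM.windows_def by blast
    qed
    ultimately show "z \<in> E ` LM.windows"
      using z by blast
  qed auto
  then show ?thesis
    using LM.homotopy_equivalent C E(3) by simp
qed

section \<open>Neighborhood complexes of circulant graphs\<close>

text \<open>The quotient \<open>a div gcd a b\<close> is the additive order of \<open>b\<close>
  modulo \<open>a\<close>.\<close>

lemma dvd_mult_iff_div_gcd:
  fixes a b k :: int
  assumes "0 < a"
  shows "a dvd k * b \<longleftrightarrow> a div gcd a b dvd k"
proof -
  define g where "g = gcd a b"
  have g: "0 < g" and a: "a = g * (a div g)" and b: "b = g * (b div g)"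
    using assms by (auto simp: g_def)
  have cop: "coprime (a div g) (b div g)"
    using assms by (simp add: g_def div_gcd_coprime)
  have "a dvd k * b \<longleftrightarrow> g * (a div g) dvd g * (k * (b div g))"
    using a b by (metis mult.left_commute)
  also have "\<dots> \<longleftrightarrow> a div g dvd k * (b div g)"
    using g by simp
  also have "\<dots> \<longleftrightarrow> a div g dvd k"
    using cop by (rule coprime_dvd_mult_left_iff)
  finally show ?thesis
    by (simp add: g_def)
qed

lemma int_dvd_cases:
  fixes n x :: int
  assumes "n dvd x" "\<bar>x\<bar> < 2 * n"
  shows "x = 0 \<or> x = n \<or> x = - n"
proof -
  obtain k where k: "x = n * k"
    using assms(1) by (rule dvdE)
  have "0 < n"
    using assms(2) by linarith
  then have "\<bar>k\<bar> < 2"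
    using assms(2) by (simp add: k abs_mult mult.commute[of n])
  then have "k = 0 \<or> k = 1 \<or> k = -1"
    by linarith
  then show ?thesis
    using k by auto
qed

text \<open>Up to sign there are twelve nonzero pairs \<open>(a, b)\<close>. Each combination is
  less than \<open>2 * n\<close> in absolute value, so divisibility would make it 0 or plus or minus
  \<open>n\<close>, and every such equation contradicts an assumption or the size bounds.\<close>

lemma no_small_relation:
  fixes S T n a b :: int
  assumes "0 < S" "2 * S < n" "0 < T" "2 * T < n" "S \<noteq> T" "2 * (S + T) \<noteq> n"
    and "3 * S \<noteq> T" "3 * T \<noteq> S" "4 * S \<noteq> n" "4 * T \<noteq> n"
    and "3 * S \<noteq> n + T" "3 * T \<noteq> n + S" "3 * S + T \<noteq> n" "3 * T + S \<noteq> n"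
    and ab: "\<bar>a\<bar> \<le> 2" "\<bar>b\<bar> \<le> 2" "n dvd a * (S + T) + b * (S - T)"
  shows "a = 0 \<and> b = 0"
proof -
  have nd: "\<not> n dvd y" if "y \<noteq> 0" "y \<noteq> n" "y \<noteq> - n" "- (2 * n) < y" "y < 2 * n" for y
    using int_dvd_cases[of "n" y] that by linarith
  note bounds = assms(1-4)
  have p2: "2 * S + 2 * T \<noteq> n"
    using assms(6) by (simp add: distrib_left)
  have e1: "0 * (S + T) + 1 * (S - T) = S - T" and nd1: "\<not> n dvd S - T"
    by simp (rule nd; use bounds assms(5) in linarith)
  have e2: "0 * (S + T) + 2 * (S - T) = 2 * S - 2 * T" and nd2: "\<not> n dvd 2 * S - 2 * T"
    by simp (rule nd; use bounds assms(5) in linarith)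
  have e3: "1 * (S + T) + (- 2) * (S - T) = 3 * T - S" and nd3: "\<not> n dvd 3 * T - S"
    by simp (rule nd; use bounds assms(8,12) in linarith)
  have e4: "1 * (S + T) + (- 1) * (S - T) = 2 * T" and nd4: "\<not> n dvd 2 * T"
    by simp (rule nd; use bounds  in linarith)
  have e5: "1 * (S + T) + 0 * (S - T) = S + T" and nd5: "\<not> n dvd S + T"
    by simp (rule nd; use bounds  in linarith)
  have e6: "1 * (S + T) + 1 * (S - T) = 2 * S" and nd6: "\<not> n dvd 2 * S"
    by simp (rule nd; use bounds  in linarith)
  have e7: "1 * (S + T) + 2 * (S - T) = 3 * S - T" and nd7: "\<not> n dvd 3 * S - T"
    by simp (rule nd; use bounds assms(7,11) in linarith)
  have e8: "2 * (S + T) + (- 2) * (S - T) = 4 * T" and nd8: "\<not> n dvd 4 * T"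
    by simp (rule nd; use bounds assms(10) in linarith)
  have e9: "2 * (S + T) + (- 1) * (S - T) = 3 * T + S" and nd9: "\<not> n dvd 3 * T + S"
    by simp (rule nd; use bounds assms(14) in linarith)
  have e10: "2 * (S + T) + 0 * (S - T) = 2 * S + 2 * T" and nd10: "\<not> n dvd 2 * S + 2 * T"
    by simp (rule nd; use bounds p2 in linarith)
  have e11: "2 * (S + T) + 1 * (S - T) = 3 * S + T" and nd11: "\<not> n dvd 3 * S + T"
    by simp (rule nd; use bounds assms(13) in linarith)
  have e12: "2 * (S + T) + 2 * (S - T) = 4 * S" and nd12: "\<not> n dvd 4 * S"
    by simp (rule nd; use bounds assms(9) in linarith)
  note nds = e1 nd1 e2 nd2 e3 nd3 e4 nd4 e5 nd5 e6 nd6 e7 nd7 e8 nd8 e9 nd9 e10 nd10 e11 nd11 e12 nd12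
  have pos: "\<not> n dvd a * (S + T) + b * (S - T)"
    if ab: "0 \<le> a" "a \<le> 2" "- 2 \<le> b" "b \<le> 2" "0 < a \<or> 0 < b" for a b
  proof -
    have "a = 0 \<or> a = 1 \<or> a = 2" "b = - 2 \<or> b = - 1 \<or> b = 0 \<or> b = 1 \<or> b = 2"
      using ab(1-4) by linarith+
    then have "(a, b) \<in> {(0, 1), (0, 2), (1, - 2), (1, - 1), (1, 0), (1, 1), (1, 2),
        (2, - 2), (2, - 1), (2, 0), (2, 1), (2, 2)}"
      using ab(5) by (elim disjE) simp_all
    then show ?thesis
      by (elim insertE emptyE) (simp_all only: prod.inject nds simp_thms)
  qed
  show ?thesis
  proof (rule ccontr)
    assume ne: "\<not> (a = 0 \<and> b = 0)"
    have "(- a) * (S + T) + (- b) * (S - T) = - (a * (S + T) + b * (S - T))"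
      by (simp add: algebra_simps)
    then have "n dvd (- a) * (S + T) + (- b) * (S - T)"
      using ab(3) by (simp only: dvd_minus_iff)
    moreover have "0 \<le> a \<and> (0 < a \<or> 0 < b) \<or> 0 \<le> - a \<and> (0 < - a \<or> 0 < - b)"
      using ne by linarith
    moreover have le: "a \<le> 2" "- a \<le> 2" "b \<le> 2" "- b \<le> 2" "- 2 \<le> b" "- 2 \<le> - b"
      using ab(1,2) by linarith+
    ultimately show False
      using pos[of a b] pos[of "- a" "- b"] ab(3) le by blast
  qed
qed

section \<open>Facets and components of the neighborhood complex\<close>

locale circulant_graph =
  fixes n s t :: nat
  assumes s: "0 < s" "2 * s < n" and t: "0 < t" "2 * t < n" and st: "s \<noteq> t" "2 * (s + t) \<noteq> n"
begin

text \<open>The shift by 1 selects representatives in \<open>{1..n}\<close>, the vertex set of the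
  graph, so that \<open>n\<close> represents the residue 0.\<close>

definition \<rho> :: "int \<Rightarrow> nat" where "\<rho> z = nat ((z - 1) mod int n) + 1"

definition N :: "int \<Rightarrow> nat set" where
  "N z = {\<rho> (z + int s), \<rho> (z - int s), \<rho> (z + int t), \<rho> (z - int t)}"

definition K :: "(nat \<Rightarrow> real) set" where
  "K = geometric_realization (neighborhood_complex {1..n} (circulant_adj n s t))"

definition comp :: "int \<Rightarrow> (nat \<Rightarrow> real) set" where
  "comp c = (\<Union>a b. closed_simplex (N (c + a * (int s + int t) + b * (int s - int t))))"

lemma n_pos: "0 < n"
  using s by linarith

lemma \<rho>_eq: "\<rho> z = \<rho> w \<longleftrightarrow> int n dvd z - w"
proof -
  have "\<rho> z = \<rho> w \<longleftrightarrow> (z - 1) mod int n = (w - 1) mod int n"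
    using n_pos by (simp add: \<rho>_def eq_nat_nat_iff)
  also have "\<dots> \<longleftrightarrow> int n dvd z - w"
    by (simp add: mod_eq_dvd_iff)
  finally show ?thesis .
qed

lemma \<rho>_in: "\<rho> z \<in> {1..n}"
proof -
  have "0 \<le> (z - 1) mod int n" "(z - 1) mod int n < int n"
    using n_pos by auto
  then show ?thesis
    unfolding \<rho>_def by auto
qed

lemma \<rho>_int: "u \<in> {1..n} \<Longrightarrow> \<rho> (int u) = u"
  by (auto simp: \<rho>_def nat_diff_distrib of_nat_diff)

lemma \<rho>_dvd: "int n dvd int (\<rho> z) - z"
  using \<rho>_eq[of "int (\<rho> z)" z] \<rho>_int[OF \<rho>_in[of z]] by simp

lemma \<rho>_eq_nat: "u \<in> {1..n} \<Longrightarrow> u = \<rho> z \<longleftrightarrow> int n dvd int u - z"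
  using \<rho>_int \<rho>_eq by metis

lemma N_cong: "int n dvd z - w \<Longrightarrow> N z = N w"
  unfolding N_def
  by (intro arg_cong2[where f = insert] refl; subst \<rho>_eq; simp)

lemma N_iff: "v \<in> N z \<longleftrightarrow> (\<exists>x\<in>{int s, - int s, int t, - int t}. v = \<rho> (z + x))"
  by (simp add: N_def)

lemma finite_N [simp]: "finite (N z)"
  by (simp add: N_def)

lemma adj_iff:
  assumes v: "v \<in> {1..n}"
  shows "circulant_adj n s t v x \<longleftrightarrow> x \<in> N (int v)"
proof (cases "x \<in> {1..n}")
  case True
  have iff: "y mod int n = int n - k \<longleftrightarrow> int n dvd y + k" "y mod int n = k \<longleftrightarrow> int n dvd y - k"
    if "0 < k" "k < int n" for k y :: int
  proof -
    have "y mod int n = k \<longleftrightarrow> y mod int n = k mod int n"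
      using that by simp
    then show "y mod int n = k \<longleftrightarrow> int n dvd y - k"
      by (simp add: mod_eq_dvd_iff)
    have "(int n - k) mod int n = int n - k"
      by (rule mod_pos_pos_trivial) (use that in auto)
    then have "y mod int n = int n - k \<longleftrightarrow> y mod int n = (int n - k) mod int n"
      by (simp only:)
    also have "\<dots> \<longleftrightarrow> int n dvd y - (int n - k)"
      by (rule mod_eq_dvd_iff)
    also have "\<dots> \<longleftrightarrow> int n dvd y + k"
    proof -
      have "y + k = (y - (int n - k)) + int n"
        by simp
      then show ?thesis
        by (subst \<open>y + k = _\<close>) (simp only: dvd_add_triv_right_iff)
    qed
    finally show "y mod int n = int n - k \<longleftrightarrow> int n dvd y + k" .
  qed
  have "circulant_adj n s t v x \<longleftrightarrow>
      int n dvd (int v - int x) - s \<or> int n dvd (int v - int x) - t \<or>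
      int n dvd (int v - int x) + s \<or> int n dvd (int v - int x) + t"
    using v True s t
    by (simp add: circulant_adj_def iff(1)[of "int s"] iff(1)[of "int t"] iff(2)[of "int s"] iff(2)[of "int t"])
  also have "\<dots> \<longleftrightarrow> int n dvd int x - (int v - s) \<or> int n dvd int x - (int v - t) \<or>
      int n dvd int x - (int v + s) \<or> int n dvd int x - (int v + t)"
  proof -
    have "(int v - int x) - k = - (int x - (int v - k))" "(int v - int x) + k = - (int x - (int v + k))" for k
      by simp_all
    then show ?thesis
      by (simp only: dvd_minus_iff)
  qed
  also have "\<dots> \<longleftrightarrow> x \<in> N (int v)"
    using True by (auto simp: N_def \<rho>_eq_nat)
  finally show ?thesis .
next
  case False
  then show ?thesis
    using \<rho>_in by (auto simp: circulant_adj_def N_def)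
qed

lemma K_eq: "K = (\<Union>z. closed_simplex (N z))"
  unfolding K_def
proof (rule geometric_realization_eq_Union)
  have "(\<exists>v\<in>{1..n}. \<forall>x\<in>\<sigma>. circulant_adj n s t v x) \<and> \<sigma> \<subseteq> {1..n} \<longleftrightarrow> (\<exists>z. \<sigma> \<subseteq> N z)" for \<sigma>
  proof
    assume "\<exists>z. \<sigma> \<subseteq> N z"
    then obtain z where z: "\<sigma> \<subseteq> N z" by blast
    then have "\<sigma> \<subseteq> N (int (\<rho> z))"
      using N_cong[OF \<rho>_dvd] by simp
    then have "\<forall>x\<in>\<sigma>. circulant_adj n s t (\<rho> z) x"
      using adj_iff[OF \<rho>_in] by blast
    moreover have "\<sigma> \<subseteq> {1..n}"
      using z \<rho>_in by (auto simp: N_def)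
    ultimately show "(\<exists>v\<in>{1..n}. \<forall>x\<in>\<sigma>. circulant_adj n s t v x) \<and> \<sigma> \<subseteq> {1..n}"
      using \<rho>_in by blast
  qed (use adj_iff in blast)
  then show "neighborhood_complex {1..n} (circulant_adj n s t) = {\<sigma>. \<sigma> \<noteq> {} \<and> (\<exists>z\<in>UNIV. \<sigma> \<subseteq> N z)}"
    by (auto simp: neighborhood_complex_def)
qed simp

lemma K_residues: "K = (\<Union>z\<in>{1..int n}. closed_simplex (N z))"
proof -
  have "\<exists>w\<in>{1..int n}. N z = N w" for z
    using N_cong[OF \<rho>_dvd[of z]] \<rho>_in[of z] by (intro bexI[of _ "int (\<rho> z)"]) auto
  then show ?thesis
    unfolding K_eq by (metis (no_types, lifting) SUP_eq UNIV_I order_refl)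
qed

text \<open>Intersecting with \<open>{1..int n}\<close> lists each facet centre of
  \<open>comp c\<close> once. This finite indexing gives closedness of the union and lets every free
  edge be collapsed once; \<open>Union_cls\<close> passes between it and the parameters
  \<open>a\<close>, \<open>b\<close>.\<close>

definition cls :: "int \<Rightarrow> int set" where
  "cls c = {z. \<exists>a b. int n dvd z - (c + a * (int s + int t) + b * (int s - int t))}"

lemma Union_cls:
  fixes X :: "int \<Rightarrow> 'a set"
  assumes "\<And>z w. int n dvd z - w \<Longrightarrow> X z = X w"
  shows "(\<Union>z\<in>cls c \<inter> {1..int n}. X z) = (\<Union>a b. X (c + a * (int s + int t) + b * (int s - int t)))"
proof (intro equalityI subsetI)
  fix x assume "x \<in> (\<Union>z\<in>cls c \<inter> {1..int n}. X z)"
  then obtain z a b where "x \<in> X z" "int n dvd z - (c + a * (int s + int t) + b * (int s - int t))"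
    by (auto simp: cls_def)
  then show "x \<in> (\<Union>a b. X (c + a * (int s + int t) + b * (int s - int t)))"
    using assms by blast
next
  fix x assume "x \<in> (\<Union>a b. X (c + a * (int s + int t) + b * (int s - int t)))"
  then obtain a b where ab: "x \<in> X (c + a * (int s + int t) + b * (int s - int t))"
    by blast
  let ?z = "int (\<rho> (c + a * (int s + int t) + b * (int s - int t)))"
  have "?z \<in> cls c \<inter> {1..int n}"
    using \<rho>_dvd \<rho>_in[of "c + a * (int s + int t) + b * (int s - int t)"] by (auto simp: cls_def)
  moreover have "x \<in> X ?z"
    using assms[OF \<rho>_dvd] ab by simp
  ultimately show "x \<in> (\<Union>z\<in>cls c \<inter> {1..int n}. X z)"
    by blast
qed

lemma comp_eq: "comp c = (\<Union>z\<in>cls c \<inter> {1..int n}. closed_simplex (N z))"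
  unfolding comp_def by (rule Union_cls[symmetric]) (simp add: N_cong)

text \<open>The four offsets \<open>s\<close>, \<open>-s\<close>, \<open>t\<close>,
  \<open>-t\<close> lie in one coset of the subgroup generated by \<open>s + t\<close> and
  \<open>s - t\<close>. If two facets share a vertex, their centres differ modulo \<open>n\<close>
  by a difference of offsets, hence by an element of this subgroup.\<close>

lemma cls_diff:
  assumes z: "z \<in> cls c" and "N z \<inter> N w \<noteq> {}"
  shows "w \<in> cls c"
proof -
  let ?S = "int s" and ?T = "int t"
  obtain a b where ab: "int n dvd z - (c + a * (?S + ?T) + b * (?S - ?T))"
    using z by (auto simp: cls_def)
  obtain v where "v \<in> N z" "v \<in> N w"
    using assms(2) by blast
  then obtain x y where xy: "x \<in> {?S, - ?S, ?T, - ?T}" "y \<in> {?S, - ?S, ?T, - ?T}" "\<rho> (w + y) = \<rho> (z + x)"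
    unfolding N_iff by metis
  have dvd: "int n dvd (w + y) - (z + x)"
    using xy(3) by (simp only: \<rho>_eq)
  have rep: "\<exists>a b. u = ?S + a * (?S + ?T) + b * (?S - ?T)" if u: "u \<in> {?S, - ?S, ?T, - ?T}" for u
  proof -
    consider "u = ?S + 0 * (?S + ?T) + 0 * (?S - ?T)" | "u = ?S + (- 1) * (?S + ?T) + (- 1) * (?S - ?T)"
      | "u = ?S + 0 * (?S + ?T) + (- 1) * (?S - ?T)" | "u = ?S + (- 1) * (?S + ?T) + 0 * (?S - ?T)"
      using u by fastforce
    then show ?thesis
      by cases blast+
  qed
  obtain a1 b1 a2 b2 where "x = ?S + a1 * (?S + ?T) + b1 * (?S - ?T)" "y = ?S + a2 * (?S + ?T) + b2 * (?S - ?T)"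
    using rep[OF xy(1)] rep[OF xy(2)] by blast
  then have "x - y = (a1 - a2) * (?S + ?T) + (b1 - b2) * (?S - ?T)"
    by (simp add: algebra_simps)
  then obtain a' b' where ab': "x - y = a' * (?S + ?T) + b' * (?S - ?T)"
    by blast
  have eq: "w - (c + (a + a') * (?S + ?T) + (b + b') * (?S - ?T)) =
      ((w + y) - (z + x)) + (z - (c + a * (?S + ?T) + b * (?S - ?T)))
      + ((x - y) - (a' * (?S + ?T) + b' * (?S - ?T)))"
    by (simp add: algebra_simps)
  have "int n dvd w - (c + (a + a') * (?S + ?T) + (b + b') * (?S - ?T))"
    unfolding eq by (intro dvd_add dvd ab) (simp add: ab')
  then show ?thesis
    unfolding cls_def by blast
qed

lemma int_closed:
  assumes "P (0::int)" "\<And>i. P i \<Longrightarrow> P (i + 1)" "\<And>i. P i \<Longrightarrow> P (i - 1)"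
  shows "P i"
  by (induction i rule: int_induct[where k = 0]) (use assms in auto)

text \<open>Neighbouring centres have facets with a common vertex, so connectedness spreads from one
  facet to all of \<open>comp c\<close>. Conversely, the facets outside form a closed set, being
  finite in number, and it misses \<open>comp c\<close> by \<open>cls_diff\<close>.\<close>

lemma component_eq_comp:
  assumes C: "C \<in> components K"
  shows "\<exists>c. C = comp c"
proof -
  have sub: "closed_simplex (N w) \<subseteq> C" if zC: "closed_simplex (N z) \<subseteq> C" and zw: "N z \<inter> N w \<noteq> {}" for z w
  proof -
    obtain u where "u \<in> N z" "u \<in> N w"
      using zw by blast
    then have "(\<lambda>v. if v = u then 1 else 0) \<in> closed_simplex (N z) \<inter> closed_simplex (N w)"
      using vertex_in_closed_simplex[of "N z" u] vertex_in_closed_simplex[of "N w" u] by simp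
    then have "C \<inter> closed_simplex (N w) \<noteq> {}"
      using zC by blast
    then show ?thesis
      by (intro components_maximal[OF C] connected_closed_simplex) (auto simp: K_eq)
  qed
  obtain x where x: "x \<in> C"
    using in_components_nonempty[OF C] by blast
  then obtain c where c: "x \<in> closed_simplex (N c)"
    using in_components_subset[OF C] by (auto simp: K_eq)
  have c_sub: "closed_simplex (N c) \<subseteq> C"
    using x c by (intro components_maximal[OF C] connected_closed_simplex) (auto simp: K_eq)
  let ?p = "int s + int t" and ?q = "int s - int t"
  have inter: "N z \<inter> N (z + ?p) \<noteq> {}" "N z \<inter> N (z + ?q) \<noteq> {}" for z
  proof -
    have "\<rho> (z + int s) \<in> N z" "\<rho> ((z + ?p) - int t) \<in> N (z + ?p)" "\<rho> ((z + ?q) + int t) \<in> N (z + ?q)"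
      unfolding N_def by blast+
    moreover have "(z + ?p) - int t = z + int s" "(z + ?q) + int t = z + int s"
      by simp_all
    ultimately show "N z \<inter> N (z + ?p) \<noteq> {}" "N z \<inter> N (z + ?q) \<noteq> {}"
      by (metis disjoint_iff)+
  qed
  have step: "closed_simplex (N (z + k * d)) \<subseteq> C"
    if "closed_simplex (N z) \<subseteq> C" "\<And>z. N z \<inter> N (z + d) \<noteq> {}" for z d k
  proof (rule int_closed[where P = "\<lambda>k. closed_simplex (N (z + k * d)) \<subseteq> C"])
    fix i assume i: "closed_simplex (N (z + i * d)) \<subseteq> C"
    show "closed_simplex (N (z + (i + 1) * d)) \<subseteq> C"
      using sub[OF i, of "z + (i + 1) * d"] that(2)[of "z + i * d"] by (simp add: algebra_simps)
    show "closed_simplex (N (z + (i - 1) * d)) \<subseteq> C"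
      using sub[OF i, of "z + (i - 1) * d"] that(2)[of "z + (i - 1) * d"]
      by (simp add: algebra_simps Int_commute)
  qed (use that in simp)
  have "closed_simplex (N (c + a * ?p + b * ?q)) \<subseteq> C" for a b
    by (intro step c_sub inter)
  then have "comp c \<subseteq> C"
    by (auto simp: comp_def)
  moreover have "C \<subseteq> comp c"
  proof -
    define R where "R = (\<Union>z\<in>{1..int n} - cls c. closed_simplex (N z))"
    have K: "K = comp c \<union> R"
      unfolding K_residues comp_eq R_def by blast
    have closed: "closed (comp c)" "closed R"
      unfolding comp_eq R_def by (auto intro!: closed_UN closed_closed_simplex)
    have disj: "comp c \<inter> R = {}"
    proof -
      have False if zw: "z \<in> cls c" "w \<notin> cls c" "f \<in> closed_simplex (N z)" "f \<in> closed_simplex (N w)" for z w f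
      proof -
        have "f \<in> closed_simplex (N z \<inter> N w)"
          using closed_simplex_Int zw finite_N by blast
        then have "N z \<inter> N w \<noteq> {}"
          by (auto simp: closed_simplex_def)
        then show False
          using cls_diff zw by blast
      qed
      then show ?thesis
        unfolding comp_eq R_def by blast
    qed
    have "x \<in> comp c"
      using c unfolding comp_def by (auto intro!: exI[of _ 0])
    then have "\<not> (R \<inter> C \<noteq> {})"
      using in_components_connected[OF C] closed disj x in_components_subset[OF C] K
      unfolding connected_closed by blast
    then show ?thesis
      using in_components_subset[OF C] K by blast
  qed
  ultimately show ?thesis
    by blast
qed

section \<open>The homotopy type of a component in the three cases\<close>

lemma comp_torus:
  assumes "3 * s \<noteq> t" "3 * t \<noteq> s" "4 * s \<noteq> n" "4 * t \<noteq> n"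
    and "3 * s \<noteq> n + t" "3 * t \<noteq> n + s" "3 * s + t \<noteq> n" "3 * t + s \<noteq> n"
  shows "top_of_set (comp c) homotopy_equivalent_space
    top_of_set (sphere (0::complex) 1 \<times> sphere (0::complex) 1)"
proof -
  let ?p = "int s + int t" and ?q = "int s - int t"
  have ints: "0 < int s" "2 * int s < int n" "0 < int t" "2 * int t < int n" "int s \<noteq> int t"
    using s t st(1) by simp_all
  have ints6: "2 * (int s + int t) \<noteq> int n"
  proof
    assume "2 * (int s + int t) = int n"
    then have "int (2 * (s + t)) = int n" by simp
    then show False using st(2) by (simp only: of_nat_eq_iff)
  qed
  have ints': "3 * int s \<noteq> int t" "3 * int t \<noteq> int s" "4 * int s \<noteq> int n" "4 * int t \<noteq> int n"
    using assms(1) assms(2) assms(3) assms(4) by linarith+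
  have ints'': "3 * int s \<noteq> int n + int t" "3 * int t \<noteq> int n + int s"
      "3 * int s + int t \<noteq> int n" "3 * int t + int s \<noteq> int n"
    using assms(5) assms(6) assms(7) assms(8) by linarith+
  \<comment> \<open>The origin \<open>c - s\<close> turns the corners of a unit square into
    neighbours of its centre: the offsets \<open>-s\<close>, \<open>-s + p\<close>,
    \<open>-s + q\<close>, \<open>-s + p + q\<close> are \<open>-s\<close>, \<open>t\<close>,
    \<open>-t\<close>, \<open>s\<close>.\<close>
  define lab where "lab = (\<lambda>a b. \<rho> (c - int s + a * ?p + b * ?q))"
  have N: "N (c + a * ?p + b * ?q) = {lab a b, lab (a + 1) b, lab a (b + 1), lab (a + 1) (b + 1)}" for a b
  proof -
    have "lab (a + 1) b = \<rho> (c + a * ?p + b * ?q + int t)" "lab a (b + 1) = \<rho> (c + a * ?p + b * ?q - int t)"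
      "lab (a + 1) (b + 1) = \<rho> (c + a * ?p + b * ?q + int s)" "lab a b = \<rho> (c + a * ?p + b * ?q - int s)"
      unfolding lab_def by (rule arg_cong[where f = \<rho>]; simp add: algebra_simps)+
    then show ?thesis
      by (simp only: N_def insert_commute)
  qed
  have "top_of_set (\<Union>a b. closed_simplex {lab a b, lab (a + 1) b, lab a (b + 1), lab (a + 1) (b + 1)})
    homotopy_equivalent_space top_of_set (sphere (0::complex) 1 \<times> sphere (0::complex) 1)"
  proof (rule square_windows_homotopy_equivalent_torus)
    show "lab a b = lab a' b' \<longleftrightarrow> int n dvd (a - a') * ?p + (b - b') * ?q" for a b a' b'
    proof -
      have "(c - int s + a * ?p + b * ?q) - (c - int s + a' * ?p + b' * ?q) = (a - a') * ?p + (b - b') * ?q"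
        by (simp add: algebra_simps)
      then show ?thesis
        unfolding lab_def \<rho>_eq by simp
    qed
    show "a = 0 \<and> b = 0" if "\<bar>a\<bar> \<le> 2" "\<bar>b\<bar> \<le> 2" "int n dvd a * ?p + b * ?q" for a b
      by (rule no_small_relation[OF ints ints6 ints' ints'' that])
  qed (use n_pos in simp)
  then show ?thesis
    unfolding comp_def N .
qed

text \<open>Here \<open>t\<close> is congruent to \<open>3 * s\<close> or \<open>-3 * s\<close>
  modulo \<open>n\<close>, so the neighbours of \<open>z\<close> are \<open>z - 3s\<close>,
  \<open>z - s\<close>, \<open>z + s\<close>, \<open>z + 3s\<close>, an arithmetic progression with
  step \<open>2s\<close>.\<close>

lemma comp_S1_or_S3:
  assumes A: "3 * s = n + t \<or> 3 * s + t = n" and "3 * t \<noteq> s" "3 * s \<noteq> 5 * t"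
  shows "top_of_set (comp c) homotopy_equivalent_space nsphere 1 \<or>
    top_of_set (comp c) homotopy_equivalent_space nsphere 3"
proof -
  define m where "m = int n div gcd (int n) (2 * int s)"
  have m: "int n dvd k * (2 * int s) \<longleftrightarrow> m dvd k" for k
    unfolding m_def using n_pos by (intro dvd_mult_iff_div_gcd) simp
  have m_pos: "0 < m"
    unfolding m_def using n_pos by (simp add: pos_imp_zdiv_pos_iff zdvd_imp_le)
  \<comment> \<open>Together with \<open>n12\<close> this excludes orders dividing 4 or 6. The
    decisive equations arise for \<open>n = 3s - t\<close>: \<open>8s = 3n\<close> means
    \<open>s = 3t\<close>, and \<open>12s = 5n\<close> means \<open>3s = 5t\<close>.\<close>
  have n8: "\<not> int n dvd 4 * (2 * int s)"
  proof
    assume "int n dvd 4 * (2 * int s)"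
    then obtain k where k: "4 * (2 * int s) = int n * k" ..
    have "0 < int n * k" "int n * k < int n * 4"
      using s k by linarith+
    then have "0 < k" "k < 4"
      using n_pos by (simp_all add: zero_less_mult_iff)
    then have "k = 1 \<or> k = 2 \<or> k = 3"
      by linarith
    then show False
      using k A s t st assms(2,3) by (elim disjE) (simp_all; linarith)+
  qed
  have n12: "\<not> int n dvd 6 * (2 * int s)"
  proof
    assume "int n dvd 6 * (2 * int s)"
    then obtain k where k: "6 * (2 * int s) = int n * k" ..
    have "0 < int n * k" "int n * k < int n * 6"
      using s k by linarith+
    then have "0 < k" "k < 6"
      using n_pos by (simp_all add: zero_less_mult_iff)
    then have "k = 1 \<or> k = 2 \<or> k = 3 \<or> k = 4 \<or> k = 5"
      by linarith
    then show False
      using k A s t st assms(2,3) by (elim disjE) (simp_all; linarith)+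
  qed
  have "m = 5 \<or> 7 \<le> m"
  proof (rule ccontr)
    assume "\<not> (m = 5 \<or> 7 \<le> m)"
    then have "m = 1 \<or> m = 2 \<or> m = 3 \<or> m = 4 \<or> m = 6"
      using m_pos by linarith
    then have "m dvd 4 \<or> m dvd 6"
      by auto
    then show False
      using m n8 n12 by blast
  qed
  \<comment> \<open>The start \<open>c - 3s\<close> makes the window beginning at \<open>k\<close>
    the neighbourhood of \<open>c + 2sk\<close>.\<close>
  define lab where "lab = (\<lambda>k. \<rho> (c - 3 * int s + k * (2 * int s)))"
  have lab: "lab a = lab b \<longleftrightarrow> m dvd a - b" for a b
  proof -
    have "(c - 3 * int s + a * (2 * int s)) - (c - 3 * int s + b * (2 * int s)) = (a - b) * (2 * int s)"
      by (simp add: algebra_simps)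
    then show ?thesis
      unfolding lab_def \<rho>_eq by (simp add: m)
  qed
  have t3: "{\<rho> (z + int t), \<rho> (z - int t)} = {\<rho> (z + 3 * int s), \<rho> (z - 3 * int s)}" for z
    using A
  proof
    assume "3 * s = n + t"
    then have "3 * int s = int n + int t" by linarith
    then have "\<rho> (z + int t) = \<rho> (z + 3 * int s)" "\<rho> (z - int t) = \<rho> (z - 3 * int s)"
      unfolding \<rho>_eq by simp_all
    then show ?thesis by simp
  next
    assume "3 * s + t = n"
    then have "int n = 3 * int s + int t" by linarith
    then have "z + int t - (z - 3 * int s) = int n" "z - int t - (z + 3 * int s) = - int n"
      by linarith+
    then have "\<rho> (z + int t) = \<rho> (z - 3 * int s)" "\<rho> (z - int t) = \<rho> (z + 3 * int s)"
      unfolding \<rho>_eq by (simp_all only: dvd_minus_iff dvd_refl)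
    then show ?thesis by auto
  qed
  have N: "N (c + k * (2 * int s)) = lab ` {k..k+3}" for k
  proof -
    have "{k..k+3} = {k, k+1, k+2, k+3}"
      by auto
    moreover have "lab k = \<rho> (c + k * (2 * int s) - 3 * int s)" "lab (k + 1) = \<rho> (c + k * (2 * int s) - int s)"
      "lab (k + 2) = \<rho> (c + k * (2 * int s) + int s)" "lab (k + 3) = \<rho> (c + k * (2 * int s) + 3 * int s)"
      unfolding lab_def by (rule arg_cong[where f = \<rho>]; simp add: algebra_simps)+
    ultimately have "lab ` {k..k+3} = {\<rho> (c + k * (2 * int s) + int s), \<rho> (c + k * (2 * int s) - int s)} \<union>
        {\<rho> (c + k * (2 * int s) + 3 * int s), \<rho> (c + k * (2 * int s) - 3 * int s)}"
      by auto
    then show ?thesis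
      unfolding t3[symmetric] N_def by auto
  qed
  have comp: "comp c = (\<Union>k. closed_simplex (lab ` {k..k+3}))"
  proof -
    \<comment> \<open>Modulo \<open>n\<close>, \<open>s + t\<close> and \<open>s - t\<close> are
      \<open>4s\<close> and \<open>-2s\<close> if \<open>t\<close> is \<open>3s\<close>, and
      \<open>-2s\<close> and \<open>4s\<close> if \<open>t\<close> is \<open>-3s\<close>. This
      explains the multipliers \<open>2 * a - b\<close> and \<open>2 * b - a\<close>, and why one
      generator suffices in the converse.\<close>
    have "\<exists>k. N (c + a * (int s + int t) + b * (int s - int t)) = N (c + k * (2 * int s))" for a b
      using A
    proof
      assume "3 * s = n + t"
      then have "int t = 3 * int s - int n" by linarith
      then have "(c + a * (int s + int t) + b * (int s - int t)) - (c + (2 * a - b) * (2 * int s)) = int n * (b - a)"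
        by (simp only: \<open>int t = _\<close>) (simp add: algebra_simps)
      then show ?thesis
        using N_cong by (metis dvd_triv_left)
    next
      assume "3 * s + t = n"
      then have "int t = int n - 3 * int s" by linarith
      then have "(c + a * (int s + int t) + b * (int s - int t)) - (c + (2 * b - a) * (2 * int s)) = int n * (a - b)"
        by (simp only: \<open>int t = _\<close>) (simp add: algebra_simps)
      then show ?thesis
        using N_cong by (metis dvd_triv_left)
    qed
    moreover have "\<exists>a b. N (c + k * (2 * int s)) = N (c + a * (int s + int t) + b * (int s - int t))" for k
      using A
    proof
      assume "3 * s = n + t"
      then have "int t = 3 * int s - int n" by linarith
      then have "(c + k * (2 * int s)) - (c + 0 * (int s + int t) + (- k) * (int s - int t)) = int n * k"
        by (simp only: \<open>int t = _\<close>) (simp add: algebra_simps)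
      then show ?thesis
        using N_cong by (metis dvd_triv_left)
    next
      assume "3 * s + t = n"
      then have "int t = int n - 3 * int s" by linarith
      then have "(c + k * (2 * int s)) - (c + (- k) * (int s + int t) + 0 * (int s - int t)) = int n * k"
        by (simp only: \<open>int t = _\<close>) (simp add: algebra_simps)
      then show ?thesis
        using N_cong by (metis dvd_triv_left)
    qed
    ultimately have k: "\<exists>k. N (c + a * (int s + int t) + b * (int s - int t)) = N (c + k * (2 * int s))"
      and ab: "\<exists>a b. N (c + k * (2 * int s)) = N (c + a * (int s + int t) + b * (int s - int t))" for a b k
      by blast+
    have "comp c = (\<Union>k. closed_simplex (N (c + k * (2 * int s))))"
    proof (intro equalityI subsetI)
      fix x assume "x \<in> comp c"
      then obtain a b where "x \<in> closed_simplex (N (c + a * (int s + int t) + b * (int s - int t)))"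
        unfolding comp_def by blast
      then show "x \<in> (\<Union>k. closed_simplex (N (c + k * (2 * int s))))"
        using k[of a b] by auto
    next
      fix x assume "x \<in> (\<Union>k. closed_simplex (N (c + k * (2 * int s))))"
      then obtain k where "x \<in> closed_simplex (N (c + k * (2 * int s)))"
        by blast
      moreover obtain a b where "N (c + k * (2 * int s)) = N (c + a * (int s + int t) + b * (int s - int t))"
        using ab by blast
      ultimately have "x \<in> closed_simplex (N (c + a * (int s + int t) + b * (int s - int t)))"
        by simp
      then show "x \<in> comp c"
        unfolding comp_def by blast
    qed
    then show ?thesis
      by (simp add: N)
  qed
  show ?thesis
    using \<open>m = 5 \<or> 7 \<le> m\<close>
  proof
    assume "7 \<le> m"
    from cyclic_windows_homotopy_equivalent_circle[OF this lab]
    show ?thesis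
      unfolding comp by blast
  next
    assume m5: "m = 5"
    \<comment> \<open>Four consecutive elements of a cyclic group of order 5 omit exactly one, so
      the windows are the five facets of a 4-simplex.\<close>
    define A where "A = lab ` {0..4}"
    have inj: "inj_on lab {k..k+4}" for k
    proof (rule inj_onI)
      fix x y assume "x \<in> {k..k+4}" "y \<in> {k..k+4}" "lab x = lab y"
      then have "5 dvd x - y" "\<bar>x - y\<bar> \<le> 4"
        using lab m5 by auto
      then show "x = y"
        using dvd_imp_le_int[of "x - y" 5] by fastforce
    qed
    have A: "A = lab ` {k..k+4}" for k
    proof -
      have "finite A" "card A = 5"
        using card_image[OF inj[of 0]] by (simp_all add: A_def)
      moreover have "card (lab ` {k..k+4}) = 5"
        using card_image[OF inj[of k]] by simp
      moreover have "lab ` {k..k+4} \<subseteq> A"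
      proof
        fix v assume "v \<in> lab ` {k..k+4}"
        then obtain x where v: "v = lab x" by blast
        have "lab x = lab (x mod 5)"
          by (simp add: lab m5 minus_mod_eq_mult_div)
        moreover have "x mod 5 \<in> {0..4}"
          using pos_mod_bound[of 5 x] pos_mod_sign[of 5 x] by simp
        ultimately show "v \<in> A"
          unfolding v A_def by (metis imageI)
      qed
      ultimately show ?thesis
        by (metis card_subset_eq)
    qed
    have face: "lab ` {k..k+3} = A - {lab (k + 4)}" for k
    proof -
      have "{k..k+3} = {k..k+4} - {k+4}"
        by auto
      then show ?thesis
        using inj[of k] unfolding A[of k] by (simp add: inj_on_image_set_diff[where C = "{k..k+4}"])
    qed
    have "\<exists>k. v = lab (k + 4)" if "v \<in> A" for v
      using that unfolding A_def by (metis diff_add_cancel imageE)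
    moreover have "lab (k + 4) \<in> A" for k
      unfolding A[of k] by simp
    ultimately have "comp c = (\<Union>v\<in>A. closed_simplex (A - {v}))"
      unfolding comp face by blast
    moreover have "card A = 5"
      using card_image[OF inj[of 0]] by (simp add: A_def)
    ultimately show ?thesis
      using boundary_4_simplex homeomorphic_imp_homotopy_equivalent_space by metis
  qed
qed

lemma \<rho>_add: "\<rho> (int (\<rho> x) + y) = \<rho> (x + y)"
  using \<rho>_dvd[of x] by (simp add: \<rho>_eq)

text \<open>Since \<open>2s\<close> is half of \<open>n\<close>, adding it exchanges
  \<open>v + s\<close> and \<open>v - s\<close>, and \<open>s - t = 2s - (s + t)\<close>. A
  component is therefore traversed by the single step \<open>p = s + t\<close>, up to half turns
  that swap the endpoints of the shared edges.\<close>

lemma comp_garland: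
  assumes s4: "4 * s = n" and t3: "3 * t \<noteq> s" "3 * t \<noteq> 5 * s"
  shows "\<exists>X :: (nat \<Rightarrow> real) topology. garland_of_spheres X \<and> top_of_set (comp c) homotopy_equivalent_space X"
proof -
  define S T p where "S = int s" and "T = int t" and "p = S + T"
  have S: "0 < S" and T: "0 < T" "T < 2 * S" and n: "int n = 4 * S" and ST: "S \<noteq> T"
    using s t st(1) s4 by (auto simp: S_def T_def)
  have T3: "3 * T \<noteq> S" "3 * T \<noteq> 5 * S"
    using t3 unfolding S_def T_def by linarith+
  have nd: "\<not> int n dvd y" if "y \<noteq> 0" "y \<noteq> 4 * S" "y \<noteq> - (4 * S)" "- (8 * S) < y" "y < 8 * S" for y
    using int_dvd_cases[of "int n" y] that unfolding n by linarith
  \<comment> \<open>Shared edges repeat once \<open>i * p\<close> is a multiple of half of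
    \<open>n\<close>, so \<open>m\<close> is the order of \<open>p\<close> modulo
    \<open>2 * S\<close>. Orders 1 and 2 would make \<open>T\<close> a multiple of \<open>S\<close>,
    against \<open>0 < T < 2 * S\<close> and \<open>T \<noteq> S\<close>.\<close>
  define m where "m = nat (2 * S div gcd (2 * S) p)"
  have "0 < 2 * S div gcd (2 * S) p"
    using S by (simp add: pos_imp_zdiv_pos_iff zdvd_imp_le)
  then have m_pos: "0 < m" and m_dvd: "2 * S dvd k * p \<longleftrightarrow> int m dvd k" for k
    using dvd_mult_iff_div_gcd[of "2 * S" k p] S by (simp_all add: m_def)
  have "\<not> 2 * S dvd 1 * p"
    using int_dvd_cases[of "2 * S" p] S T ST by (auto simp: p_def)
  moreover have "\<not> 2 * S dvd 2 * p"
  proof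
    assume "2 * S dvd 2 * p"
    then have "S dvd T"
      by (simp add: p_def)
    then show False
      using int_dvd_cases[of S T] S T ST by auto
  qed
  ultimately have "\<not> int m dvd 1" "\<not> int m dvd 2"
    unfolding m_dvd .
  then have "m \<noteq> 1" "m \<noteq> 2"
    by auto
  then have m3: "3 \<le> m"
    using m_pos by linarith
  define z where "z = (\<lambda>i. c + i * p)"
  define A B where "A = (\<lambda>i. \<rho> (z i - S))" and "B = (\<lambda>i. \<rho> (z i + S))"
  define P where "P = (\<lambda>i. {A i, B i})"
  have z_diff: "z i - z j = (i - j) * p" for i j
    by (simp add: z_def algebra_simps)
  have AA: "A i = A j \<longleftrightarrow> int n dvd (i - j) * p" and BB: "B i = B j \<longleftrightarrow> int n dvd (i - j) * p"
    and AB: "A i = B j \<longleftrightarrow> int n dvd (i - j) * p - 2 * S" for i j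
  proof -
    have "(z i - S) - (z j - S) = (i - j) * p" "(z i + S) - (z j + S) = (i - j) * p"
      "(z i - S) - (z j + S) = (i - j) * p - 2 * S"
      unfolding z_diff[symmetric] by simp_all
    then show "A i = A j \<longleftrightarrow> int n dvd (i - j) * p" "B i = B j \<longleftrightarrow> int n dvd (i - j) * p"
      "A i = B j \<longleftrightarrow> int n dvd (i - j) * p - 2 * S"
      unfolding A_def B_def \<rho>_eq by simp_all
  qed
  have half: "2 * S dvd x" if "int n dvd x \<or> int n dvd x - 2 * S" for x
  proof -
    have "2 * S dvd int n"
      unfolding n by simp
    then have "2 * S dvd x \<or> 2 * S dvd x - 2 * S"
      using that dvd_trans by blast
    then show ?thesis
      by (metis diff_add_cancel dvd_add_triv_right_iff)
  qed
  have index: "i = j" if "i < m" "j < m" "2 * S dvd (int i - int j) * p" for i j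
  proof -
    have "int m dvd int i - int j"
      using that m_dvd by blast
    then show ?thesis
      using that dvd_imp_le_int[of "int i - int j" "int m"] by fastforce
  qed
  have not_dvd: "\<not> int n dvd - (2 * S)"
    by (rule nd; use S in linarith)
  \<comment> \<open>An odd number of half turns exchanges \<open>A\<close> and \<open>B\<close>: the
    chain may close up with a twist, so periodicity is claimed only for the unordered edges.\<close>
  have P_periodic: "P i = P j" if ij: "int m dvd i - j" for i j
  proof -
    obtain k where k: "(i - j) * p = 2 * S * k"
      using ij m_dvd by (meson dvd_def)
    show ?thesis
    proof (cases "even k")
      case True
      then have "int n dvd (i - j) * p"
        unfolding k n by auto
      then show ?thesis
        using AA[of i j] BB[of i j] by (simp add: P_def)
    next
      case False
      then obtain l where "k = 2 * l + 1"
        by (rule oddE)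
      then have "(i - j) * p - 2 * S = 4 * S * l" "(j - i) * p - 2 * S = 4 * S * (- l - 1)"
        using k by (simp_all add: algebra_simps)
      then have "int n dvd (i - j) * p - 2 * S" "int n dvd (j - i) * p - 2 * S"
        unfolding n by (metis dvd_triv_left)+
      then have "A i = B j" "A j = B i"
        using AB by simp_all
      then show ?thesis
        by (auto simp: P_def)
    qed
  qed
  have \<rho>_n: "\<rho> (x + 4 * S) = \<rho> x" for x
    by (simp add: \<rho>_eq n)
  \<comment> \<open>A half turn exchanges the endpoints of every edge; elsewhere
    \<open>star_out\<close> demands the identity.\<close>
  define star where "star = (\<lambda>u. if \<exists>i<m. u = A (int i) \<or> u = B (int i) then \<rho> (int u + 2 * S) else u)"
  have star_AB: "\<rho> (int (A i) + 2 * S) = B i" "\<rho> (int (B i) + 2 * S) = A i" for i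
  proof -
    have "z i - S + 2 * S = z i + S" "z i + S + 2 * S = z i - S + 4 * S"
      by simp_all
    then show "\<rho> (int (A i) + 2 * S) = B i" "\<rho> (int (B i) + 2 * S) = A i"
      unfolding A_def B_def \<rho>_add by (simp_all only: \<rho>_n)
  qed
  interpret sphere_chain m "\<lambda>i. A (int i)" "\<lambda>i. B (int i)" star
  proof
    show "star (A (int i)) = B (int i)" "star (B (int i)) = A (int i)" if "i < m" for i
      using that star_AB by (auto simp: star_def)
    show "star u = u" if "\<And>i. i < m \<Longrightarrow> u \<noteq> A (int i) \<and> u \<noteq> B (int i)" for u
      using that by (auto simp: star_def)
    show "A (int i) \<noteq> B (int j)" if "i < m" "j < m" for i j
    proof
      assume "A (int i) = B (int j)"
      then have dvd: "int n dvd (int i - int j) * p - 2 * S"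
        by (simp only: AB)
      then have "i = j"
        using half index that by blast
      then show False
        using dvd not_dvd by simp
    qed
    show "i = j" if "i < m" "j < m" "A (int i) = A (int j)" for i j
      using that half index unfolding AA by blast
    show "i = j" if "i < m" "j < m" "B (int i) = B (int j)" for i j
      using that half index unfolding BB by blast
  qed (rule m3)
  define W where "W = (\<lambda>z. closed_simplex {\<rho> (z + S), \<rho> (z - S), \<rho> (z + T)} \<union>
      closed_simplex {\<rho> (z + S), \<rho> (z - S), \<rho> (z - T)})"
  have W_cong: "W x = W y" if "int n dvd x - y" for x y
  proof -
    have "\<rho> (x + S) = \<rho> (y + S)" "\<rho> (x - S) = \<rho> (y - S)" "\<rho> (x + T) = \<rho> (y + T)" "\<rho> (x - T) = \<rho> (y - T)"
      using that by (simp_all add: \<rho>_eq)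
    then show ?thesis
      by (simp only: W_def)
  qed
  have "top_of_set (\<Union>z\<in>cls c \<inter> {1..int n}. closed_simplex {\<rho> (z + S), \<rho> (z - S), \<rho> (z + T), \<rho> (z - T)})
      homotopy_equivalent_space top_of_set (\<Union>z\<in>cls c \<inter> {1..int n}. W z)"
    unfolding W_def
  proof (rule collapse_free_edges)
    show "distinct [\<rho> (z + S), \<rho> (z - S), \<rho> (z + T), \<rho> (z - T)]" for z
    proof -
      have "\<rho> (z + x) \<noteq> \<rho> (z + y)" if "\<not> int n dvd x - y" for x y
        using that by (simp add: \<rho>_eq)
      note this[of S "- S"] this[of S T] this[of S "- T"] this[of "- S" T] this[of "- S" "- T"] this[of T "- T"]
      moreover have "\<not> int n dvd S - - S" "\<not> int n dvd S - T" "\<not> int n dvd S - - T" "\<not> int n dvd - S - T"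
        "\<not> int n dvd - S - - T" "\<not> int n dvd T - - T"
        by (rule nd; use S T ST in linarith)+
      ultimately show ?thesis
        by simp
    qed
    fix z k
    assume zk: "z \<in> cls c \<inter> {1..int n}" "k \<in> cls c \<inter> {1..int n}"
      and "{\<rho> (z + T), \<rho> (z - T)} \<subseteq> {\<rho> (k + S), \<rho> (k - S), \<rho> (k + T), \<rho> (k - T)}"
    then have "\<rho> (z + T) \<in> N k" "\<rho> (z - T) \<in> N k"
      by (simp_all add: N_def S_def T_def)
    then obtain x y where xy: "x \<in> {S, - S, T, - T}" "y \<in> {S, - S, T, - T}"
      and "\<rho> (z + T) = \<rho> (k + x)" "\<rho> (z - T) = \<rho> (k + y)"
      unfolding N_iff S_def T_def by blast
    then have dvd: "int n dvd (z + T) - (k + x)" "int n dvd (z - T) - (k + y)"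
      by (simp_all only: \<rho>_eq)
    have "int n dvd 2 * T - x + y"
    proof -
      have "2 * T - x + y = ((z + T) - (k + x)) - ((z - T) - (k + y))"
        by simp
      then show ?thesis
        using dvd by (simp only: dvd_diff)
    qed
    \<comment> \<open>A different facet containing \<open>z + T\<close> and \<open>z - T\<close>
      would make one of these numbers divisible by \<open>n\<close>. The critical one is
      \<open>3 * T - S\<close>, which equals 0 or \<open>n = 4 * S\<close> exactly if
      \<open>3t = s\<close> or \<open>3t = 5s\<close>.\<close>
    moreover have "\<not> int n dvd 2 * T - x + y" if "\<not> (x = T \<and> y = - T)"
    proof -
      have "2 * T - x + y \<in> {2 * T, 2 * T - 2 * S, T - S, T + S, 2 * T + 2 * S, 3 * T - S, 3 * T + S, 4 * T}"
        using xy that by (elim insertE emptyE) simp_all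
      moreover have "\<not> int n dvd 2 * T" "\<not> int n dvd 2 * T - 2 * S" "\<not> int n dvd T - S" "\<not> int n dvd T + S"
        "\<not> int n dvd 2 * T + 2 * S" "\<not> int n dvd 3 * T - S" "\<not> int n dvd 3 * T + S" "\<not> int n dvd 4 * T"
        by (rule nd; use S T ST T3 in linarith)+
      ultimately show ?thesis
        by (elim insertE emptyE) (simp_all only: simp_thms)
    qed
    ultimately have "x = T"
      by blast
    then have "int n dvd z - k"
      using dvd(1) by simp
    then show "z = k"
      using zk dvd_imp_le_int[of "z - k" "int n"] by fastforce
  qed simp
  also have "(\<Union>z\<in>cls c \<inter> {1..int n}. closed_simplex {\<rho> (z + S), \<rho> (z - S), \<rho> (z + T), \<rho> (z - T)}) = comp c"
    unfolding comp_eq N_def S_def T_def ..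
  also have "(\<Union>z\<in>cls c \<inter> {1..int n}. W z) = chain tetra"
  proof -
    \<comment> \<open>Two triangles with base \<open>P i\<close> and apex in \<open>P j\<close>;
      with the roles of \<open>i\<close> and \<open>j\<close> exchanged as well, they bound the
      tetrahedron on both edges. Phrased through \<open>P\<close>, they inherit periodicity despite
      a twist.\<close>
    define tri where "tri = (\<lambda>i j. \<Union>y\<in>P j. closed_simplex (insert y (P i)))"
    have tri_eq: "tri i j = closed_simplex {A i, B i, A j} \<union> closed_simplex {A i, B i, B j}" for i j
      by (simp add: tri_def P_def insert_commute)
    \<comment> \<open>The two collapsed tetrahedra on the edge \<open>P i\<close> leave four
      triangles; their apexes are the endpoints of the next and of the previous edge.\<close>
    have W_tri: "W (z i) \<union> W (z i + 2 * S) = tri i (i + 1) \<union> tri i (i - 1)" for i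
    proof -
      have "z i + T = z (i + 1) - S" "z i - T = z (i - 1) + S" "z i + 2 * S + T = z (i + 1) + S"
        "z i + 2 * S - T = z (i - 1) - S + 4 * S" "z i + 2 * S + S = z i - S + 4 * S" "z i + 2 * S - S = z i + S"
        by (simp_all add: z_def p_def algebra_simps)
      then have "W (z i) = closed_simplex {B i, A i, A (i + 1)} \<union> closed_simplex {B i, A i, B (i - 1)}"
        "W (z i + 2 * S) = closed_simplex {A i, B i, B (i + 1)} \<union> closed_simplex {A i, B i, A (i - 1)}"
        by (simp_all only: W_def A_def B_def \<rho>_n)
      then show ?thesis
        by (simp add: tri_eq insert_commute Un_ac)
    qed
    have "(\<Union>z\<in>cls c \<inter> {1..int n}. W z) = (\<Union>a b. W (c + a * (int s + int t) + b * (int s - int t)))"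
      by (rule Union_cls) (rule W_cong)
    also have "\<dots> = (\<Union>i. W (z i) \<union> W (z i + 2 * S))"
    proof (intro equalityI subsetI)
      fix x assume "x \<in> (\<Union>a b. W (c + a * (int s + int t) + b * (int s - int t)))"
      then obtain a b where x: "x \<in> W (c + a * (S + T) + b * (S - T))"
        by (auto simp: S_def T_def)
      have eq: "c + a * (S + T) + b * (S - T) = z (a - b) + 2 * S * b"
        by (simp add: z_def p_def algebra_simps)
      have "W (z (a - b) + 2 * S * b) = W (z (a - b)) \<or> W (z (a - b) + 2 * S * b) = W (z (a - b) + 2 * S)"
      proof (cases "even b")
        case True
        then show ?thesis
          by (intro disjI1 W_cong) (auto simp: n)
      next
        case False
        then obtain l where "b = 2 * l + 1"
          by (rule oddE)
        then have "z (a - b) + 2 * S * b - (z (a - b) + 2 * S) = 4 * S * l"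
          by (simp add: algebra_simps)
        then show ?thesis
          by (intro disjI2 W_cong) (simp add: n)
      qed
      then show "x \<in> (\<Union>i. W (z i) \<union> W (z i + 2 * S))"
        using x unfolding eq by blast
    next
      fix x assume "x \<in> (\<Union>i. W (z i) \<union> W (z i + 2 * S))"
      then obtain i where i: "x \<in> W (z i) \<or> x \<in> W (z i + 2 * S)"
        by blast
      have "z i = c + i * (int s + int t) + 0 * (int s - int t)"
        "z i + 2 * S = c + (i + 1) * (int s + int t) + 1 * (int s - int t)"
        by (simp_all add: z_def p_def S_def T_def algebra_simps)
      then show "x \<in> (\<Union>a b. W (c + a * (int s + int t) + b * (int s - int t)))"
        using i by (elim disjE) (simp only:, blast)+
    qed
    \<comment> \<open>Shifting the index of the triangles that point backwards regroups the union:
      instead of the triangles around one edge, each term now collects those between two consecutive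
      edges.\<close>
    also have "\<dots> = (\<Union>i. tri i (i + 1) \<union> tri (i + 1) i)"
    proof -
      have "(\<Union>i. tri i (i - 1)) = (\<Union>i. tri (i + 1) i)"
      proof (intro equalityI subsetI)
        fix x assume "x \<in> (\<Union>i. tri i (i - 1))"
        then obtain i where "x \<in> tri (i - 1 + 1) (i - 1)"
          by auto
        then show "x \<in> (\<Union>i. tri (i + 1) i)"
          by blast
      next
        fix x assume "x \<in> (\<Union>i. tri (i + 1) i)"
        then obtain i where "x \<in> tri (i + 1) (i + 1 - 1)"
          by auto
        then show "x \<in> (\<Union>i. tri i (i - 1))"
          by blast
      qed
      then show ?thesis
        unfolding W_tri UN_Un_distrib by (rule arg_cong)
    qed
    also have "\<dots> = (\<Union>i<m. tri (int i) (int (nx i)) \<union> tri (int (nx i)) (int i))"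
    proof (intro equalityI subsetI)
      have tri_cong: "tri i j = tri i' j'" if "int m dvd i - i'" "int m dvd j - j'" for i j i' j'
        unfolding tri_def using P_periodic[OF that(1)] P_periodic[OF that(2)] by simp
      have nx: "int m dvd i + 1 - int (nx (nat (i mod int m)))" "int m dvd i - int (nat (i mod int m))" for i
      proof -
        have "int (nat (i mod int m)) = i mod int m"
          using m_pos by simp
        then have "int (nx (nat (i mod int m))) = (i mod int m + 1) mod int m"
          by (simp add: nx_def zmod_int add.commute)
        also have "\<dots> = (i + 1) mod int m"
          by (rule mod_add_left_eq)
        finally show "int m dvd i + 1 - int (nx (nat (i mod int m)))"
          by (simp add: minus_mod_eq_mult_div)
        show "int m dvd i - int (nat (i mod int m))"
          using m_pos by (simp add: minus_mod_eq_mult_div)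
      qed
      {
        fix x assume "x \<in> (\<Union>i. tri i (i + 1) \<union> tri (i + 1) i)"
        then obtain i where "x \<in> tri i (i + 1) \<union> tri (i + 1) i"
          by blast
        moreover have "tri i (i + 1) = tri (int (nat (i mod int m))) (int (nx (nat (i mod int m))))"
          "tri (i + 1) i = tri (int (nx (nat (i mod int m)))) (int (nat (i mod int m)))"
          by (rule tri_cong; rule nx)+
        ultimately have "x \<in> tri (int (nat (i mod int m))) (int (nx (nat (i mod int m)))) \<union>
            tri (int (nx (nat (i mod int m)))) (int (nat (i mod int m)))"
          by (simp only:)
        moreover have "nat (i mod int m) < m"
          using m_pos by (simp add: nat_less_iff)
        ultimately show "x \<in> (\<Union>i<m. tri (int i) (int (nx i)) \<union> tri (int (nx i)) (int i))"
          by blast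
      next
        fix x assume "x \<in> (\<Union>i<m. tri (int i) (int (nx i)) \<union> tri (int (nx i)) (int i))"
        then obtain i where i: "i < m" "x \<in> tri (int i) (int (nx i)) \<union> tri (int (nx i)) (int i)"
          by blast
        have "nat (int i mod int m) = i"
          using i(1) by simp
        then have "int m dvd (int i + 1) - int (nx i)"
          using nx(1)[of "int i"] by simp
        then have "tri (int i) (int (nx i)) = tri (int i) (int i + 1)"
          "tri (int (nx i)) (int i) = tri (int i + 1) (int i)"
          by (auto intro!: tri_cong simp: dvd_diff_commute)
        then show "x \<in> (\<Union>i. tri i (i + 1) \<union> tri (i + 1) i)"
          using i(2) by blast
      }
    qed
    also have "\<dots> = chain tetra"
      unfolding chain_def
    proof (rule SUP_cong)
      fix i assume "i \<in> {..<m}"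
      then have "i < m" by simp
      show "tri (int i) (int (nx i)) \<union> tri (int (nx i)) (int i) = cell tetra i"
        unfolding cell_tetra[OF \<open>i < m\<close>] by (simp only: tri_eq Un_assoc)
    qed simp
    finally show ?thesis .
  qed
  also have "top_of_set (chain tetra) homotopy_equivalent_space top_of_set (chain pinched)"
    by (rule homotopy_equivalent)
  finally show ?thesis
    using garland_of_spheres_pinched by blast
qed

end

lemma neighborhood_complex_commute:
  "neighborhood_complex V (circulant_adj n s t) = neighborhood_complex V (circulant_adj n t s)"
proof -
  have "circulant_adj n s t = circulant_adj n t s"
    by (intro ext) (auto simp: circulant_adj_def)
  then show ?thesis by simp
qed

theorem theorem2p5:
  fixes n s t :: nat
  assumes "n \<ge> 5"
    and "s \<in> {1..n div 2}" and "t \<in> {1..n div 2}" and "s \<noteq> t"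
    and "n \<notin> {2 * s, 2 * t, 2 * (s + t)}"
    and "3 * s \<noteq> t" and "3 * t \<noteq> s" and "3 * s \<noteq> 5 * t" and "3 * t \<noteq> 5 * s"
  shows "\<forall>C \<in> components (geometric_realization
                (neighborhood_complex {1..n} (circulant_adj n s t))).
     (int n \<in> {3 * int s - int t, 3 * int t - int s, 3 * int s + int t, 3 * int t + int s} \<longrightarrow>
        top_of_set C homotopy_equivalent_space nsphere 1 \<or>
        top_of_set C homotopy_equivalent_space nsphere 3) \<and>
     (int n \<notin> {3 * int s - int t, 3 * int t - int s, 3 * int s + int t, 3 * int t + int s} \<and>
      (4 * t = n \<or> 4 * s = n) \<longrightarrow>
        (\<exists>X :: (nat \<Rightarrow> real) topology.
           garland_of_spheres X \<and> top_of_set C homotopy_equivalent_space X)) \<and>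
     (int n \<notin> {3 * int s - int t, 3 * int t - int s, 3 * int s + int t, 3 * int t + int s} \<and>
      4 * s \<noteq> n \<and> 4 * t \<noteq> n \<longrightarrow>
        (\<exists>X :: (nat \<Rightarrow> real) topology.
           connected_sum_of_tori X \<and> top_of_set C homotopy_equivalent_space X))"
proof
  fix C assume C: "C \<in> components (geometric_realization (neighborhood_complex {1..n} (circulant_adj n s t)))"
  have st: "0 < s" "2 * s < n" "0 < t" "2 * t < n" "2 * (s + t) \<noteq> n"
  proof -
    have "2 * s \<le> n" "2 * t \<le> n"
      using assms(2,3) by auto
    then show "0 < s" "2 * s < n" "0 < t" "2 * t < n" "2 * (s + t) \<noteq> n"
      using assms(2,3,5) by auto
  qed
  interpret st: circulant_graph n s t
    by unfold_locales (use st assms(4) in auto)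
  \<comment> \<open>The locale assumptions are symmetric in \<open>s\<close> and \<open>t\<close>,
    so the mirrored alternatives of (A) and (B) are covered by describing the same component
    \<open>C\<close> a second time.\<close>
  interpret ts: circulant_graph n t s
    by unfold_locales (use st assms(4) in \<open>auto simp: add.commute\<close>)
  obtain c where c: "C = st.comp c"
    using st.component_eq_comp C unfolding st.K_def by blast
  obtain d where d: "C = ts.comp d"
    using ts.component_eq_comp C unfolding ts.K_def neighborhood_complex_commute[of _ n t s] by blast
  have A: "top_of_set C homotopy_equivalent_space nsphere 1 \<or> top_of_set C homotopy_equivalent_space nsphere 3"
    if "int n \<in> {3 * int s - int t, 3 * int t - int s, 3 * int s + int t, 3 * int t + int s}"
  proof -
    have "(3 * s = n + t \<or> 3 * s + t = n) \<or> (3 * t = n + s \<or> 3 * t + s = n)"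
      using that by auto
    then show ?thesis
      using st.comp_S1_or_S3[of c] ts.comp_S1_or_S3[of d] assms(6-9) c d by metis
  qed
  have B: "\<exists>X :: (nat \<Rightarrow> real) topology. garland_of_spheres X \<and> top_of_set C homotopy_equivalent_space X"
    if "4 * t = n \<or> 4 * s = n"
    using that st.comp_garland[of c] ts.comp_garland[of d] assms(6-9) c d by metis
  have D: "\<exists>X :: (nat \<Rightarrow> real) topology. connected_sum_of_tori X \<and> top_of_set C homotopy_equivalent_space X"
    if "int n \<notin> {3 * int s - int t, 3 * int t - int s, 3 * int s + int t, 3 * int t + int s}"
      "4 * s \<noteq> n" "4 * t \<noteq> n"
  proof -
    have "3 * s \<noteq> n + t" "3 * t \<noteq> n + s" "3 * s + t \<noteq> n" "3 * t + s \<noteq> n"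
      using that(1) by auto
    then have "top_of_set C homotopy_equivalent_space
        top_of_set (sphere (0::complex) 1 \<times> sphere (0::complex) 1)"
      unfolding c using st.comp_torus assms(6,7) that(2,3) by blast
    then show ?thesis
      using torus_in_sequence_space homotopy_eqv_trans by blast
  qed
  show "(int n \<in> {3 * int s - int t, 3 * int t - int s, 3 * int s + int t, 3 * int t + int s} \<longrightarrow>
        top_of_set C homotopy_equivalent_space nsphere 1 \<or>
        top_of_set C homotopy_equivalent_space nsphere 3) \<and>
     (int n \<notin> {3 * int s - int t, 3 * int t - int s, 3 * int s + int t, 3 * int t + int s} \<and>
      (4 * t = n \<or> 4 * s = n) \<longrightarrow>
        (\<exists>X :: (nat \<Rightarrow> real) topology.
           garland_of_spheres X \<and> top_of_set C homotopy_equivalent_space X)) \<and>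
     (int n \<notin> {3 * int s - int t, 3 * int t - int s, 3 * int s + int t, 3 * int t + int s} \<and>
      4 * s \<noteq> n \<and> 4 * t \<noteq> n \<longrightarrow>
        (\<exists>X :: (nat \<Rightarrow> real) topology.
           connected_sum_of_tori X \<and> top_of_set C homotopy_equivalent_space X))"
    using A B D by blast
qed

end
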